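(* Let $F$ be the random map associated with a finite collection $\{T_1,\dots,T_N\}$ of good and bad maps containing at least one good and at least one bad map, and with a strictly positive probability vector $\mathbf p=(p_j)_{j\in\Sigma}$. Let $\theta=\sum_{b\in\Sigma_B}p_b\ell_b$, $\ell_{\max}=\max\{\ell_b:b\in\Sigma_B\}$, $\gamma_1=\frac{\log\theta}{\log\ell_{\max}}$, and $$\gamma_2=1+\max\Big\{\frac{\log\pi_b}{\log\ell_b}:b\in\Sigma_B\Big\},\qquad \pi_b=\sum_{j\in\Sigma_B:\ \ell_j\ge\ell_b}p_j .$$ Assume that $\theta<1$ and let $\mu$ be the unique acs probability measure of $F$. Furthermore, assume that $\gamma_2>\gamma_1-1$ if $\gamma_1<-1$, and that $\gamma_2>2\gamma_1$ if $-1\le\gamma_1<0$. Let $f\in L^\infty(\Sigma^{\mathbb N}\times[0,1],\mathbb P\times\mu)$ and $h\in\mathcal H$ be such that both $f$ and $h$ are identically zero on $\Sigma^{\mathbb N}\times([0,\frac12]\cup[\frac34,1])$ and such that $$\int_{\Sigma^{\mathbb N}\times[0,1]}f\,d\mathbb P\times\mu\cdot\int_{\Sigma^{\mathbb N}\times[0,1]}h\,d\mathbb P\times\mu>0.$$ Then $$|Cor_n(f,h)|=\Omega(n^{\gamma_2}).$$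
   Context: A map $T_g:[0,1]\to[0,1]$ is called good if, for some $r_g\ge 1$, $T_g(x)=1-2^{r_g}(\frac12-x)^{r_g}$ for $x\in[0,\frac12)$ and $T_g(x)=2x-1$ for $x\in[\frac12,1]$. A map $T_b:[0,1]\to[0,1]$ is called bad if, for some $\ell_b>1$, $T_b(x)=\frac12-2^{\ell_b-1}(\frac12-x)^{\ell_b}$ for $x\in[0,\frac12)$ and $T_b(x)=2x-1$ for $x\in[\frac12,1]$. For a finite collection $T_1,\dots,T_N$ of good and bad maps put $\Sigma=\{1,\dots,N\}$, $\Sigma_G=\{j: T_j\text{ is good}\}$, $\Sigma_B=\{j:T_j\text{ is bad}\}$; both are assumed nonempty. The parameter of $T_g$ is $r_g$ and that of $T_b$ is $\ell_b$. The random map is $F(\omega,x)=(\sigma\omega,T_{\omega_1}(x))$ on $\Sigma^{\mathbb N}\times[0,1]$, with $\sigma$ the left shift. $\lambda$ is Lebesgue measure on $[0,1]$, $\mathbf p=(p_j)_{j\in\Sigma}$ is a probability vector with strictly positive entries and $\mathbb P$ is the $\mathbf p$-Bernoulli measure on $\Sigma^{\mathbb N}$. An acs measure for $F$ is a Borel measure $\mu\ll\lambda$ on $[0,1]$ with $\sum_{j\in\Sigma}p_j\mu(T_j^{-1}A)=\mu(A)$ for all Borel $A\subseteq[0,1]$. When $\theta<1$ there is a unique acs probability measure, denoted $\mu$. Equip $\Sigma^{\mathbb N}\times[0,1]$ with the metric $d((\omega,x),(\omega',y))=2^{-\min\{i\in\mathbb N:\omega_i\ne\omega_i'\}}+|x-y|$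 (first term $0$ if $\omega=\omega'$). For $\alpha\in(0,1)$, $\mathcal H_\alpha$ is the set of $h:\Sigma^{\mathbb N}\times[0,1]\to\mathbb R$ with $\sup_{z_1\ne z_2}\frac{|h(z_1)-h(z_2)|}{d(z_1,z_2)^\alpha}<\infty$, and $\mathcal H=\bigcup_{\alpha\in(0,1)}\mathcal H_\alpha$. The correlations are $$Cor_n(f,h)=\int f\circ F^n\cdot h\,d\mathbb P\times\mu-\int f\,d\mathbb P\times\mu\int h\,d\mathbb P\times\mu,$$ all integrals being over $\Sigma^{\mathbb N}\times[0,1]$. The notation $a_n=\Omega(n^{\gamma_2})$ means that there are $c>0$ and $n_0\in\mathbb N$ with $a_n\ge c\,n^{\gamma_2}$ for all $n\ge n_0$. *)

theory Defs
  imports "HOL-Probability.Probability" "HOL-Library.Landau_Symbols"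
begin

definition good_map :: "real \<Rightarrow> (real \<Rightarrow> real) \<Rightarrow> bool" where
  "good_map r T \<longleftrightarrow> r \<ge> 1 \<and>
     (\<forall>x\<in>{0..<1/2}. T x = 1 - 2 powr r * (1/2 - x) powr r) \<and>
     (\<forall>x\<in>{1/2..1}. T x = 2 * x - 1)"

definition bad_map :: "real \<Rightarrow> (real \<Rightarrow> real) \<Rightarrow> bool" where
  "bad_map l T \<longleftrightarrow> l > 1 \<and>
     (\<forall>x\<in>{0..<1/2}. T x = 1/2 - 2 powr (l - 1) * (1/2 - x) powr l) \<and>
     (\<forall>x\<in>{1/2..1}. T x = 2 * x - 1)"

definition good_symbols :: "nat \<Rightarrow> (nat \<Rightarrow> real \<Rightarrow> real) \<Rightarrow> nat set" where
  "good_symbols N T = {j \<in> {1..N}. \<exists>r. good_map r (T j)}"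

definition bad_symbols :: "nat \<Rightarrow> (nat \<Rightarrow> real \<Rightarrow> real) \<Rightarrow> nat set" where
  "bad_symbols N T = {j \<in> {1..N}. \<exists>l. bad_map l (T j)}"

text \<open>Sequences are indexed from \<open>0\<close>: \<open>\<omega> 0\<close> is the first letter of \<open>\<omega>\<close>.\<close>

definition phase_space :: "nat \<Rightarrow> ((nat \<Rightarrow> nat) \<times> real) set" where
  "phase_space N = (UNIV \<rightarrow> {1..N}) \<times> {0..1}"

definition skew_map :: "(nat \<Rightarrow> real \<Rightarrow> real) \<Rightarrow> (nat \<Rightarrow> nat) \<times> real \<Rightarrow> (nat \<Rightarrow> nat) \<times> real" where
  "skew_map T = (\<lambda>(\<omega>, x). (\<lambda>n. \<omega> (Suc n), T (\<omega> 0) x))"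

definition bernoulli_measure :: "nat \<Rightarrow> (nat \<Rightarrow> real) \<Rightarrow> (nat \<Rightarrow> nat) measure" where
  "bernoulli_measure N p = (\<Pi>\<^sub>M i\<in>UNIV. point_measure {1..N} (\<lambda>j. ennreal (p j)))"

definition acs_measure :: "nat \<Rightarrow> (nat \<Rightarrow> real \<Rightarrow> real) \<Rightarrow> (nat \<Rightarrow> real) \<Rightarrow> real measure \<Rightarrow> bool" where
  "acs_measure N T p \<mu> \<longleftrightarrow>
     sets \<mu> = sets (restrict_space borel {0..1}) \<and>
     absolutely_continuous (restrict_space lborel {0..1}) \<mu> \<and>
     (\<forall>A\<in>sets \<mu>. (\<Sum>j\<in>{1..N}. ennreal (p j) * emeasure \<mu> {x \<in> {0..1}. T j x \<in> A}) = emeasure \<mu> A)"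

definition theta :: "nat set \<Rightarrow> (nat \<Rightarrow> real) \<Rightarrow> (nat \<Rightarrow> real) \<Rightarrow> real" where
  "theta B l p = (\<Sum>b\<in>B. p b * l b)"

definition gamma1 :: "nat set \<Rightarrow> (nat \<Rightarrow> real) \<Rightarrow> (nat \<Rightarrow> real) \<Rightarrow> real" where
  "gamma1 B l p = ln (theta B l p) / ln (Max (l ` B))"

definition pi_bad :: "nat set \<Rightarrow> (nat \<Rightarrow> real) \<Rightarrow> (nat \<Rightarrow> real) \<Rightarrow> nat \<Rightarrow> real" where
  "pi_bad B l p b = (\<Sum>j\<in>{j \<in> B. l j \<ge> l b}. p j)"

definition gamma2 :: "nat set \<Rightarrow> (nat \<Rightarrow> real) \<Rightarrow> (nat \<Rightarrow> real) \<Rightarrow> real" where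
  "gamma2 B l p = 1 + Max ((\<lambda>b. ln (pi_bad B l p b) / ln (l b)) ` B)"

text \<open>With letters numbered from \<open>1\<close>, the first letter in which \<open>\<omega>\<close> and \<open>\<omega>'\<close> differ has
  number \<open>Suc (LEAST i. \<omega> i \<noteq> \<omega>' i)\<close>.\<close>

definition phase_dist :: "(nat \<Rightarrow> nat) \<times> real \<Rightarrow> (nat \<Rightarrow> nat) \<times> real \<Rightarrow> real" where
  "phase_dist = (\<lambda>(\<omega>, x) (\<omega>', y).
     (if \<omega> = \<omega>' then 0 else (1/2) ^ Suc (LEAST i. \<omega> i \<noteq> \<omega>' i)) + \<bar>x - y\<bar>)"

definition hoelder :: "nat \<Rightarrow> real \<Rightarrow> ((nat \<Rightarrow> nat) \<times> real \<Rightarrow> real) set" where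
  "hoelder N \<alpha> = {h. bdd_above {\<bar>h z1 - h z2\<bar> / phase_dist z1 z2 powr \<alpha> | z1 z2.
     z1 \<in> phase_space N \<and> z2 \<in> phase_space N \<and> z1 \<noteq> z2}}"

definition hoelder_functions :: "nat \<Rightarrow> ((nat \<Rightarrow> nat) \<times> real \<Rightarrow> real) set" where
  "hoelder_functions N = (\<Union>\<alpha>\<in>{0<..<1}. hoelder N \<alpha>)"

definition L_infinity :: "'a measure \<Rightarrow> ('a \<Rightarrow> real) set" where
  "L_infinity M = {f \<in> borel_measurable M. \<exists>C. AE z in M. \<bar>f z\<bar> \<le> C}"

definition correlation :: "'a measure \<Rightarrow> ('a \<Rightarrow> 'a) \<Rightarrow> nat \<Rightarrow> ('a \<Rightarrow> real) \<Rightarrow> ('a \<Rightarrow> real) \<Rightarrow> real" where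
  "correlation M F n f h =
     (LINT z|M. f ((F ^^ n) z) * h z) - (LINT z|M. f z) * (LINT z|M. h z)"

end

theory Submission
  imports Defs "HOL-Complex_Analysis.Complex_Analysis" "HOL-Real_Asymp.Real_Asymp"
begin

text \<open>
  On the left half put \<open>x = (1 - u) / 2\<close>: a bad map acts as \<open>u \<mapsto> u powr l\<close>, a good one sends \<open>x\<close> to
  \<open>1 - u powr r\<close>, after which the distance to the fixed point \<open>1\<close> doubles until the orbit is back in
  the left half. Hence a point started at \<open>u\<close> is at \<open>u powr s\<close> after some bad letters, where \<open>s\<close> is
  the product of their exponents, and the return time is of order \<open>s\<close>.

  The return operators contract the logarithmic oscillation of densities, so a fixed fraction
  \<open>\<delta>\<close> of every returning density can be replaced by the constant density. The times at which
  this happens form a scalar renewal process. If \<open>F n\<close> denotes the tail of its waiting time, Wiener's lemma for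
  sequences of decay \<open>n powr - q\<close> shows that the renewal sequence is
  \<open>1 / (\<Sum>k\<le>n. F k)\<close> up to an error that the gap conditions make negligible. Since \<open>f\<close> and \<open>h\<close>
  live on \<open>(1/2, 3/4)\<close>, which is visited only in the step just before a return, the boundary terms
  have the decay of a waiting time distribution and not only of its tail.
  So the correlation is \<open>(\<integral>f)(\<integral>h)(M / (\<Sum>k\<le>n. F k) - 1)\<close> plus a negligible error,
  with \<open>M = (\<Sum>k. F k)\<close>, and strings of bad letters \<open>j\<close> with \<open>l j \<ge> l b\<close> bound \<open>F\<close> from below.
\<close>

subsection \<open>Sequences of polynomial decay and Wiener's lemma\<close>

text \<open>The exact decay of the waiting time tail \<open>F\<close> is not known: the upper bounds
  have exponents below \<open>1 - gamma1\<close>, the lower bound has exponent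
  \<open>1 - gamma2\<close>, and these differ in general. So no asymptotics of \<open>F\<close>
  enters. The main term is kept as \<open>M / (\<Sum>k\<le>n. F k) - 1\<close>, which has a sign and
  only needs a lower bound, while the error is measured by the upper exponent alone. Two exponents
  \<open>q < q0\<close> occur because inverting the series costs an arbitrarily small amount of
  decay; the strict gap conditions pay for it.

  The measure \<open>\<mu>\<close> is given only by invariance and absolute continuity, so its
  density has to be recognised. Convergence of iterates is proved for regular initial densities and
  extends to integrable ones because the observables are bounded; applied to the density of
  \<open>\<mu>\<close>, it evaluates the invariant integrals. Functions of variable sign are handled
  by adding a constant that makes their logarithmic oscillation small.\<close>

definition wt :: "real \<Rightarrow> nat \<Rightarrow> real" where
  "wt q n = (real n + 1) powr - q"

lemma wt_pos [simp]: "wt q n > 0"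
  by (simp add: wt_def)

lemma wt_neq_0 [simp]: "wt q n \<noteq> 0"
  using wt_pos[of q n] by linarith

lemma wt_nonneg [simp]: "wt q n \<ge> 0"
  by (simp add: wt_def)

lemma wt_0 [simp]: "wt q 0 = 1"
  by (simp add: wt_def)

lemma wt_antimono: "q \<ge> 0 \<Longrightarrow> m \<le> n \<Longrightarrow> wt q n \<le> wt q m"
  unfolding wt_def by (rule powr_mono2') auto

lemma wt_le_1: "q \<ge> 0 \<Longrightarrow> wt q n \<le> 1"
  using wt_antimono[of q 0 n] by simp

lemma wt_scale:
  assumes "q \<ge> 0" "c > 0" "real n + 1 \<le> c * (real i + 1)"
  shows "wt q i \<le> c powr q * wt q n"
proof -
  have "(c * (real i + 1)) powr - q \<le> (real n + 1) powr - q"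
    using assms by (intro powr_mono2') auto
  then have "c powr q * (c powr - q * (real i + 1) powr - q) \<le> c powr q * (real n + 1) powr - q"
    using assms by (intro mult_left_mono) (auto simp: powr_mult)
  moreover have "c powr q * c powr - q = 1"
    using assms by (simp flip: powr_add)
  ultimately show ?thesis
    by (simp add: wt_def mult.assoc[symmetric])
qed

lemma wt_half: "q \<ge> 0 \<Longrightarrow> n \<le> 2 * i \<Longrightarrow> wt q i \<le> 2 powr q * wt q n"
  by (rule wt_scale) auto

lemma summable_wt: 
  assumes "q > 1" shows "summable (wt q)"
proof -
  have "summable (\<lambda>n. real (Suc n) powr - q)"
    using assms by (subst summable_Suc_iff) (simp add: summable_real_powr_iff)
  then show ?thesis
    by (simp add: wt_def[abs_def] add.commute)
qed

lemma sum_wt_le: "q > 1 \<Longrightarrow> finite A \<Longrightarrow> sum (wt q) A \<le> suminf (wt q)"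
  by (rule sum_le_suminf) (auto intro: summable_wt)

definition wt_conv_const :: "real \<Rightarrow> real" where
  "wt_conv_const q = 2 * 2 powr q * suminf (wt q)"

lemma wt_conv_const_ge_1: assumes "q > 1" shows "wt_conv_const q \<ge> 1"
proof -
  have "1 \<le> suminf (wt q)"
    using sum_wt_le[OF assms, of "{0}"] by simp
  moreover have "1 \<le> 2 powr q"
    using assms by (simp add: ge_one_powr_ge_zero)
  ultimately have "1 * 1 \<le> 2 powr q * suminf (wt q)"
    by (intro mult_mono) auto
  then show ?thesis by (simp add: wt_conv_const_def)
qed

text \<open>One of \<open>i\<close> and \<open>n - i\<close> is at least \<open>n / 2\<close>, so
  its weight is at most \<open>2 powr q * wt q n\<close>, and the other weight is summed. This makes
  decay of order \<open>q\<close> stable under products of power series.\<close>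

lemma wt_conv:
  assumes "q > 1"
  shows "(\<Sum>i\<le>n. wt q i * wt q (n - i)) \<le> wt_conv_const q * wt q n"
proof -
  have "wt q i * wt q (n - i) \<le> 2 powr q * wt q n * (wt q i + wt q (n - i))" if "i \<le> n" for i
  proof (cases "n \<le> 2 * i")
    case True
    then have "wt q i * wt q (n - i) \<le> 2 powr q * wt q n * wt q (n - i)"
      using assms by (intro mult_right_mono wt_half) auto
    also have "\<dots> \<le> 2 powr q * wt q n * (wt q i + wt q (n - i))"
      by (intro mult_left_mono) auto
    finally show ?thesis .
  next
    case False
    then have "wt q i * wt q (n - i) \<le> wt q i * (2 powr q * wt q n)"
      using assms that by (intro mult_left_mono wt_half) auto
    also have "\<dots> \<le> 2 powr q * wt q n * (wt q i + wt q (n - i))"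
      by (simp add: algebra_simps)
    finally show ?thesis .
  qed
  then have "(\<Sum>i\<le>n. wt q i * wt q (n - i)) \<le> (\<Sum>i\<le>n. 2 powr q * wt q n * (wt q i + wt q (n - i)))"
    by (intro sum_mono) auto
  also have "\<dots> = 2 powr q * wt q n * ((\<Sum>i\<le>n. wt q i) + (\<Sum>i\<le>n. wt q (n - i)))"
    by (simp add: sum_distrib_left[symmetric] sum.distrib)
  also have "(\<Sum>i\<le>n. wt q (n - i)) = (\<Sum>i\<le>n. wt q i)"
    by (rule sum.reindex_bij_witness[of _ "\<lambda>i. n - i" "\<lambda>i. n - i"]) auto
  also have "2 powr q * wt q n * ((\<Sum>i\<le>n. wt q i) + (\<Sum>i\<le>n. wt q i)) \<le>
      2 powr q * wt q n * (suminf (wt q) + suminf (wt q))"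
    using assms by (intro mult_left_mono add_mono sum_wt_le) auto
  finally show ?thesis
    by (simp add: wt_conv_const_def algebra_simps)
qed

section \<open>The algebra of power series with coefficients of order \<open>wt q\<close>\<close>

definition wt_bdd :: "real \<Rightarrow> real \<Rightarrow> 'a :: real_normed_field fps \<Rightarrow> bool" where
  "wt_bdd q A X \<longleftrightarrow> (\<forall>n. norm (fps_nth X n) \<le> A * wt q n)"

lemma wt_bdd_mult:
  assumes "q > 1" "wt_bdd q A X" "wt_bdd q B Y" "A \<ge> 0"
  shows "wt_bdd q (wt_conv_const q * A * B) (X * Y)"
  unfolding wt_bdd_def
proof
  fix n
  have "norm (fps_nth (X * Y) n) \<le> (\<Sum>i\<le>n. norm (fps_nth X i) * norm (fps_nth Y (n - i)))"
    by (auto simp: fps_mult_nth atLeast0AtMost norm_mult intro!: order.trans[OF norm_sum])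
  also have "\<dots> \<le> (\<Sum>i\<le>n. (A * wt q i) * (B * wt q (n - i)))"
    using assms by (intro sum_mono mult_mono) (auto simp: wt_bdd_def)
  also have "\<dots> = A * B * (\<Sum>i\<le>n. wt q i * wt q (n - i))"
    by (simp add: sum_distrib_left mult_ac)
  also have "\<dots> \<le> A * B * (wt_conv_const q * wt q n)"
  proof (intro mult_left_mono wt_conv assms mult_nonneg_nonneg)
    show "B \<ge> 0" using assms(3) by (auto simp: wt_bdd_def dest!: spec[of _ 0] intro: order.trans[OF norm_ge_zero])
  qed
  finally show "norm (fps_nth (X * Y) n) \<le> wt_conv_const q * A * B * wt q n"
    by (simp add: mult_ac)
qed

lemma wt_bdd_power:
  assumes "q > 1" "wt_bdd q A X" "A \<ge> 0"
  shows "wt_bdd q ((wt_conv_const q * A) ^ k) (X ^ k)"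
proof (induction k)
  case 0
  show ?case by (auto simp: wt_bdd_def fps_one_nth)
next
  case (Suc k)
  show ?case
    using wt_bdd_mult[OF assms(1,2) Suc assms(3)] by simp
qed

lemma wt_bdd_sum:
  assumes "\<And>k. k \<in> S \<Longrightarrow> wt_bdd q (A k) (X k)"
  shows "wt_bdd q (sum A S) (sum X S)"
  unfolding wt_bdd_def
proof
  fix n
  have "norm (fps_nth (sum X S) n) \<le> (\<Sum>k\<in>S. norm (fps_nth (X k) n))"
    by (auto simp: fps_sum_nth intro: norm_sum)
  also have "\<dots> \<le> (\<Sum>k\<in>S. A k * wt q n)"
    using assms by (intro sum_mono) (auto simp: wt_bdd_def)
  finally show "norm (fps_nth (sum X S) n) \<le> sum A S * wt q n"
    by (simp add: sum_distrib_right)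
qed

lemma geometric_le_wt:
  assumes "\<rho> > (1::real)"
  obtains C where "C > 0" "\<And>n. (1 / \<rho>) ^ n \<le> C * wt q n"
proof -
  have "(\<lambda>n. (1 / \<rho>) ^ n * (real n + 1) powr q) \<longlonglongrightarrow> 0"
    using assms by real_asymp
  then obtain C where C: "C > 0" "\<And>n. \<bar>(1 / \<rho>) ^ n * (real n + 1) powr q\<bar> \<le> C"
    using Bseq_def[of "\<lambda>n. (1 / \<rho>) ^ n * (real n + 1) powr q"]
    by (auto dest!: convergentI convergent_imp_Bseq)
  have "(1 / \<rho>) ^ n \<le> C * wt q n" for n
  proof -
    have "(1 / \<rho>) ^ n = (1 / \<rho>) ^ n * (real n + 1) powr q * wt q n"
      by (simp add: wt_def powr_minus field_simps)
    also have "\<dots> \<le> C * wt q n"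
      using C(2)[of n] by (intro mult_right_mono) auto
    finally show ?thesis .
  qed
  with C(1) that show ?thesis by blast
qed


text \<open>Multiply by \<open>1 - z\<close>: the differences \<open>f n\<close> form a probability
  distribution, and a zero of the series would give \<open>(\<Sum>n. f n * z ^ Suc n) = 1\<close>.
  Taking real parts forces \<open>Re (z ^ Suc n) = 1\<close> wherever \<open>f n > 0\<close>. Since
  \<open>F 1 < 1\<close> means \<open>f 0 > 0\<close> (aperiodicity), this leaves
  \<open>z = 1\<close>, where the series is positive.\<close>

lemma decseq_power_series_nonzero:
  fixes F :: "nat \<Rightarrow> real" and z :: complex
  assumes dec: "decseq F" and F0: "F 0 = 1" and F1: "F 1 < 1"
    and sm: "summable F" and z: "norm z \<le> 1"
  shows "(\<Sum>n. of_real (F n) * z ^ n) \<noteq> 0"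
proof
  assume *: "(\<Sum>n. of_real (F n) * z ^ n) = 0"
  have nn: "F n \<ge> 0" for n
    using decseq_ge[OF dec summable_LIMSEQ_zero[OF sm]] .
  have nz: "norm (z ^ n) \<le> 1" for n
    using z by (simp add: norm_power power_le_one)
  have sz: "summable (\<lambda>n. of_real (F n) * z ^ n)"
    by (rule summable_comparison_test[OF _ sm])
       (auto simp: norm_mult nn intro!: exI[of _ 0] mult_left_le nz)
  then have S: "(\<lambda>n. of_real (F n) * z ^ n) sums 0"
    using * by (simp add: sums_iff)
  have S1: "(\<lambda>n. of_real (F (Suc n)) * z ^ Suc n) sums -1"
    using S F0 by (subst sums_Suc_iff) simp
  have S2: "(\<lambda>n. of_real (F n) * z ^ Suc n) sums 0"
    using sums_mult[OF S, of z] by (simp add: mult_ac)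
  define f where "f n = F n - F (Suc n)" for n
  have fnn: "f n \<ge> 0" for n
    using dec by (simp add: f_def decseq_Suc_iff)
  have "(\<lambda>n. of_real (f n) * z ^ Suc n) sums 1"
    using sums_diff[OF S2 S1] by (simp add: f_def algebra_simps)
  then have A: "(\<lambda>n. f n * Re (z ^ Suc n)) sums 1"
    using sums_Re by fastforce
  have B: "f sums 1"
    unfolding f_def using telescope_sums'[OF summable_LIMSEQ_zero[OF sm]] F0 by simp
  have C: "(\<lambda>n. f n * (1 - Re (z ^ Suc n))) sums 0"
    using sums_diff[OF B A] by (simp add: algebra_simps)
  have "Re (z ^ n) \<le> 1" for n
    using order.trans[OF complex_Re_le_cmod nz] .
  then have "f n * (1 - Re (z ^ Suc n)) \<ge> 0" for n
    using fnn by (metis diff_ge_0_iff_ge mult_nonneg_nonneg)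
  then have "\<forall>n. f n * (1 - Re (z ^ Suc n)) = 0"
    using C suminf_eq_zero_iff[of "\<lambda>n. f n * (1 - Re (z ^ Suc n))"]
    by (simp add: sums_iff)
  from this[rule_format, of 0] have "Re z = 1"
    using F1 F0 by (simp add: f_def)
  then have "z = 1"
    using z by (smt (verit, best) cmod_power2 complex_eqI one_complex.simps power2_less_eq_zero_iff
        power_le_one norm_ge_zero zero_le_power2 power_one)
  then have "(\<lambda>n. complex_of_real (F n)) sums of_real 0"
    using S by simp
  then have "F sums 0"
    by (simp only: sums_of_real_iff)
  then have "F 0 = 0"
    using suminf_eq_zero_iff[of F] nn sm by (simp add: sums_iff)
  then show False using F0 by simp
qed

text \<open>Cauchy's estimate for the \<open>k\<close>-th power of \<open>1 / h\<close>. The rate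
  \<open>\<rho>\<close> is the same for all \<open>k\<close>, so in a polynomially weighted norm the
  powers grow like \<open>(1 / c) ^ k\<close>; submultiplicativity would bring in the uncontrolled
  weighted norm of \<open>inverse P\<close>.\<close>

lemma norm_fps_nth_inverse_power_le:
  fixes P :: "complex fps"
  assumes h: "h has_fps_expansion P" and hol: "h holomorphic_on UNIV"
    and "fps_nth P 0 \<noteq> 0" "c > 0" "\<rho> > 0"
    and lb: "\<And>z. norm z \<le> \<rho> \<Longrightarrow> norm (h z) \<ge> c"
  shows "norm (fps_nth (inverse P ^ k) n) \<le> (1 / c) ^ k * (1 / \<rho>) ^ n"
proof -
  define g where "g = (\<lambda>z. inverse (h z) ^ k)"
  have nz: "h z \<noteq> 0" if "norm z \<le> \<rho>" for z
    using lb[OF that] \<open>c > 0\<close> by auto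
  have holg: "g holomorphic_on cball 0 \<rho>"
    unfolding g_def using nz by (intro holomorphic_intros holomorphic_on_subset[OF hol]) auto
  have "g has_fps_expansion inverse P ^ k"
    unfolding g_def by (intro fps_expansion_intros h assms)
  then have "fps_nth (inverse P ^ k) n = (deriv ^^ n) g 0 / fact n"
    by (rule fps_nth_fps_expansion)
  moreover have "norm ((deriv ^^ n) g 0) \<le> fact n * (1 / c) ^ k / \<rho> ^ n"
  proof (rule Cauchy_inequality)
    show "g holomorphic_on ball 0 \<rho>"
      using holg by (rule holomorphic_on_subset) auto
    show "continuous_on (cball 0 \<rho>) g"
      using holg by (rule holomorphic_on_imp_continuous_on)
    show "norm (g x) \<le> (1 / c) ^ k" if "norm (0 - x) = \<rho>" for x
      using lb[of x] nz[of x] that \<open>c > 0\<close> unfolding g_def norm_power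
      by (intro power_mono) (auto simp: norm_inverse norm_divide divide_simps)
  qed fact
  then have "norm ((deriv ^^ n) g 0) / fact n \<le> fact n * (1 / c) ^ k / \<rho> ^ n / fact n"
    by (intro divide_right_mono) auto
  ultimately show ?thesis
    by (simp add: norm_divide power_divide)
qed

text \<open>Split \<open>F = P - Q\<close> with a finite section \<open>P\<close>, so that \<open>1 / F = (\<Sum>k. Q ^ k / P ^ (k + 1))\<close>.
  Cauchy's estimate on a circle of radius \<open>\<rho> > 1\<close> bounds the powers of \<open>1 / P\<close>, and \<open>Q\<close> is small in
  the norm of decay \<open>q\<close> because \<open>F\<close> has the better decay \<open>q0\<close>.\<close>

lemma wt_bdd_inverse_complex:
  fixes F :: "nat \<Rightarrow> real"
  assumes dec: "decseq F" and F0: "F 0 = 1" and F1: "F 1 < 1"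
    and q: "1 < q" "q < q0" and nn: "\<And>n. F n \<ge> 0" and bd: "\<And>n. F n \<le> C * wt q0 n"
  shows "\<exists>A. wt_bdd q A (inverse (Abs_fps (\<lambda>n. complex_of_real (F n))))"
proof -
  have summ: "summable (\<lambda>n. C * wt q0 n)"
    using q by (intro summable_mult summable_wt) auto
  have sm: "summable F"
    by (rule summable_comparison_test[OF _ summ]) (use bd nn in auto)
  define g where "g z = (\<Sum>n. of_real (F n) * z ^ n)" for z :: complex
  define h where "h N z = (\<Sum>n<N. of_real (F n) * z ^ n)" for N and z :: complex
  have le: "norm (of_real (F n) * z ^ n) \<le> F n" if "z \<in> cball 0 1" for n and z :: complex
    using that nn by (auto simp: norm_mult norm_power intro!: mult_left_le power_le_one)
  have ul: "uniform_limit (cball 0 1) h g sequentially"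
    unfolding h_def g_def by (rule Weierstrass_m_test) (use le sm in auto)
  have conth: "continuous_on A (h N)" for A N
    unfolding h_def by (intro continuous_intros)
  have "continuous_on (cball 0 1) g"
    by (rule uniform_limit_theorem[OF _ ul]) (auto intro!: always_eventually conth)
  then have "continuous_on (cball 0 1) (\<lambda>z. norm (g z))"
    by (intro continuous_intros)
  then obtain z0 where z0: "z0 \<in> cball 0 1" "\<And>z. z \<in> cball 0 1 \<Longrightarrow> norm (g z0) \<le> norm (g z)"
    using continuous_attains_inf[of "cball 0 (1::real)::complex set" "\<lambda>z. norm (g z)"] by auto
  define c where "c = norm (g z0)"
  have c: "c > 0"
    using decseq_power_series_nonzero[OF dec F0 F1 sm, of z0] z0 by (simp add: c_def g_def)
  define \<kappa> where "\<kappa> = wt_conv_const q"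
  have \<kappa>: "\<kappa> \<ge> 1" using wt_conv_const_ge_1[OF q(1)] by (simp add: \<kappa>_def)
  \<comment> \<open>Makes the ratio of the Neumann series below equal to
    \<open>(4 / c) * (\<kappa> * \<epsilon>) = 1 / 2\<close>: \<open>4 / c\<close> is the growth of
    the powers of \<open>inverse P\<close>, \<open>\<kappa> * \<epsilon>\<close> that of the powers
    of \<open>Q\<close>.\<close>
  define \<epsilon> where "\<epsilon> = c / (8 * \<kappa>)"
  have \<epsilon>: "\<epsilon> > 0" using c \<kappa> by (simp add: \<epsilon>_def)
  have "eventually (\<lambda>N. \<forall>z\<in>cball 0 1. dist (h N z) (g z) < c / 2) sequentially"
    using ul c unfolding uniform_limit_iff by (meson half_gt_zero)
  moreover have "(\<lambda>n. C * (real n + 1) powr (q - q0)) \<longlonglongrightarrow> 0"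
    using q by real_asymp
  then have "eventually (\<lambda>n. C * (real n + 1) powr (q - q0) < \<epsilon>) sequentially"
    using \<epsilon> by (rule order_tendstoD)
  then have "eventually (\<lambda>N. \<forall>n\<ge>N. C * (real n + 1) powr (q - q0) < \<epsilon>) sequentially"
    by (rule eventually_all_ge_at_top)
  ultimately have "eventually (\<lambda>N. (\<forall>z\<in>cball 0 1. dist (h N z) (g z) < c / 2) \<and>
      (\<forall>n\<ge>N. C * (real n + 1) powr (q - q0) < \<epsilon>) \<and> N \<ge> 1) sequentially"
    using eventually_ge_at_top[of 1] by eventually_elim auto
  then obtain N where N: "\<And>z. z \<in> cball 0 1 \<Longrightarrow> dist (h N z) (g z) < c / 2"
     "\<And>n. n \<ge> N \<Longrightarrow> C * (real n + 1) powr (q - q0) < \<epsilon>" "N \<ge> 1"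
    unfolding eventually_sequentially by (metis le_refl)
  have lb1: "norm (h N z) \<ge> c / 2" if "z \<in> cball 0 1" for z
    using z0(2)[OF that] N(1)[OF that] by (simp add: c_def dist_norm) norm
  have "uniformly_continuous_on (cball 0 2) (h N)"
    by (intro compact_uniformly_continuous conth) auto
  then obtain \<delta> where \<delta>: "\<delta> > 0" 
    "\<And>z w. z \<in> cball 0 2 \<Longrightarrow> w \<in> cball 0 2 \<Longrightarrow> dist z w < \<delta> \<Longrightarrow> dist (h N z) (h N w) < c / 4"
    using c unfolding uniformly_continuous_on_def
    by (metis divide_pos_pos zero_less_numeral)
  \<comment> \<open>The lower bound \<open>c / 2\<close> on the closed unit disc survives as
    \<open>c / 4\<close> on a slightly larger one, by uniform continuity of the polynomial
    \<open>h N\<close>. For the full series \<open>g\<close> no such extension is at hand.\<close>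
  define \<rho> where "\<rho> = 1 + min 1 (\<delta> / 2)"
  have \<rho>: "\<rho> > 1" "\<rho> \<le> 2" "\<rho> < 1 + \<delta>" using \<delta>(1) by (auto simp: \<rho>_def min_def)
  have lb: "norm (h N z) \<ge> c / 4" if z: "norm z \<le> \<rho>" for z
  proof (cases "norm z \<le> 1")
    case True
    then show ?thesis using lb1[of z] c by auto
  next
    case False
    define w where "w = z / of_real (norm z)"
    have "z \<noteq> 0" using False by (metis norm_zero zero_le_one)
    then have w: "norm w = 1" by (simp add: w_def norm_divide)
    have "z - w = of_real (norm z - 1) * w"
      using \<open>z \<noteq> 0\<close> by (auto simp: w_def field_simps)
    then have "dist z w = norm z - 1"
      using False w by (simp add: dist_norm norm_mult del: of_real_diff)
    then have "dist (h N z) (h N w) < c / 4"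
      using z w \<rho> by (intro \<delta>(2)) auto
    moreover have "norm (h N w) - norm (h N z) \<le> dist (h N z) (h N w)"
      using norm_triangle_ineq2[of "h N w" "h N z"] by (simp add: dist_norm norm_minus_commute)
    moreover have "norm (h N w) \<ge> c / 2" using lb1[of w] w by simp
    ultimately show ?thesis by linarith
  qed
  define G where "G = Abs_fps (\<lambda>n. complex_of_real (F n))"
  define P where "P = (\<Sum>n<N. fps_const (complex_of_real (F n)) * fps_X ^ n)"
  have P_nth: "fps_nth P n = (if n < N then of_real (F n) else 0)" for n
    by (simp add: P_def fps_sum_nth fps_X_power_nth if_distrib sum.delta cong: if_cong)
  have P0: "fps_nth P 0 = 1" using N(3) F0 by (simp add: P_nth)
  have h: "h N has_fps_expansion P"
    unfolding h_def P_def by (intro fps_expansion_intros)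
  have hol: "h N holomorphic_on UNIV"
    unfolding h_def by (intro holomorphic_intros)
  obtain A where A: "A > 0" "\<And>n. (1 / \<rho>) ^ n \<le> A * wt q n"
    using geometric_le_wt[OF \<rho>(1), of q] by blast
  have bdP: "wt_bdd q (A * (4 / c) ^ k) (inverse P ^ k)" for k
    unfolding wt_bdd_def
  proof
    fix n
    have "norm (fps_nth (inverse P ^ k) n) \<le> (1 / (c / 4)) ^ k * (1 / \<rho>) ^ n"
      by (rule norm_fps_nth_inverse_power_le[OF h hol _ _ _ lb]) (use P0 c \<rho> in auto)
    also have "\<dots> \<le> (1 / (c / 4)) ^ k * (A * wt q n)"
      using c by (intro mult_left_mono A) auto
    finally show "norm (fps_nth (inverse P ^ k) n) \<le> A * (4 / c) ^ k * wt q n"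
      by (simp add: mult_ac)
  qed
  define Q where "Q = P - G"
  have bdQ: "wt_bdd q \<epsilon> Q"
    unfolding wt_bdd_def
  proof
    fix n
    show "norm (fps_nth Q n) \<le> \<epsilon> * wt q n"
    proof (cases "n < N")
      case True
      then show ?thesis using \<epsilon> by (simp add: Q_def P_nth G_def)
    next
      case False
      then have "norm (fps_nth Q n) = F n" using nn by (simp add: Q_def P_nth G_def)
      also have "\<dots> \<le> C * wt q0 n" by (rule bd)
      also have "\<dots> = C * (real n + 1) powr (q - q0) * wt q n"
        by (simp add: wt_def flip: powr_add)
      also have "\<dots> \<le> \<epsilon> * wt q n"
        using N(2)[of n] False by (intro mult_right_mono) auto
      finally show ?thesis .
    qed
  qed
  have Q0: "fps_nth Q 0 = 0" using N(3) by (simp add: Q_def P_nth G_def)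
  have G0: "fps_nth G 0 \<noteq> 0" using F0 by (simp add: G_def)
  define U where "U = Q * inverse P"
  have U0: "fps_nth U 0 = 0" by (simp add: U_def Q0)
  have GP: "G = P * (1 - U)"
    using inverse_mult_eq_1[of P] P0 by (simp add: U_def Q_def algebra_simps)
  have ident: "inverse G = inverse P * (\<Sum>k\<le>n. U ^ k) + inverse G * U ^ Suc n" for n
  proof -
    have "(1 - U) * (\<Sum>k\<le>n. U ^ k) = 1 - U ^ Suc n"
      by (metis lessThan_Suc_atMost one_diff_power_eq)
    then have "G * (inverse P * (\<Sum>k\<le>n. U ^ k)) = 1 - U ^ Suc n"
      using inverse_mult_eq_1[of P] P0 by (simp add: GP mult_ac)
    then have "inverse G * (G * (inverse P * (\<Sum>k\<le>n. U ^ k))) = inverse G * (1 - U ^ Suc n)"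
      by simp
    moreover have "inverse G * (G * X) = X" for X
      using inverse_mult_eq_1[of G] G0 by (simp add: mult.assoc[symmetric])
    ultimately have "inverse P * (\<Sum>k\<le>n. U ^ k) = inverse G - inverse G * U ^ Suc n"
      by (simp only: right_diff_distrib mult_1_right)
    then show ?thesis by simp
  qed
  have bdk: "wt_bdd q (\<kappa> * A * (4 / c) * (1 / 2) ^ k) (inverse P * U ^ k)" for k
  proof -
    have "wt_bdd q (\<kappa> * (A * (4 / c) ^ Suc k) * (\<kappa> * \<epsilon>) ^ k) (inverse P ^ Suc k * Q ^ k)"
      unfolding \<kappa>_def using A c \<epsilon>
      by (intro wt_bdd_mult wt_bdd_power bdP bdQ q) auto
    also have "inverse P ^ Suc k * Q ^ k = inverse P * U ^ k"
      by (simp add: U_def power_mult_distrib)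
    also have "\<kappa> * (A * (4 / c) ^ Suc k) * (\<kappa> * \<epsilon>) ^ k = \<kappa> * A * (4 / c) * ((4 / c) * (\<kappa> * \<epsilon>)) ^ k"
      by (simp only: power_mult_distrib power_Suc mult_ac)
    also have "(4 / c) * (\<kappa> * \<epsilon>) = 1 / 2" using c \<kappa> by (simp add: \<epsilon>_def)
    finally show ?thesis .
  qed
  have "wt_bdd q (\<kappa> * A * (4 / c) * 2) (inverse G)"
    unfolding wt_bdd_def
  proof
    fix n
    \<comment> \<open>\<open>U\<close> has no constant term, so the remainder of the Neumann series
      does not reach coefficient \<open>n\<close>: the finite sum is exact there and no convergence
      is involved.\<close>
    have "fps_nth (U ^ Suc n) i = 0" if "i \<le> n" for i
      using startsby_zero_power_prefix[OF U0, of "Suc n"] that by (simp del: power_Suc)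
    then have "fps_nth (inverse G * U ^ Suc n) n = 0"
      by (simp add: fps_mult_nth del: power_Suc)
    then have "fps_nth (inverse G) n = fps_nth (\<Sum>k\<le>n. inverse P * U ^ k) n"
      by (subst ident[of n]) (simp add: sum_distrib_left del: power_Suc)
    also have "norm \<dots> \<le> (\<Sum>k\<le>n. \<kappa> * A * (4 / c) * (1 / 2) ^ k) * wt q n"
      using wt_bdd_sum[of "{..n}" q "\<lambda>k. \<kappa> * A * (4 / c) * (1 / 2) ^ k" "\<lambda>k. inverse P * U ^ k"] bdk
      unfolding wt_bdd_def by blast
    also have "(\<Sum>k\<le>n. \<kappa> * A * (4 / c) * (1 / 2) ^ k) = \<kappa> * A * (4 / c) * (\<Sum>k\<le>n. (1 / 2) ^ k)"
      by (simp add: sum_distrib_left)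
    also have "\<dots> * wt q n \<le> \<kappa> * A * (4 / c) * 2 * wt q n"
    proof (intro mult_right_mono mult_left_mono)
      have "(\<Sum>k\<le>n. (1 / 2 :: real) ^ k) \<le> (\<Sum>k. (1 / 2) ^ k)"
        by (intro sum_le_suminf summable_geometric) auto
      then show "(\<Sum>k\<le>n. (1 / 2 :: real) ^ k) \<le> 2" by (simp add: suminf_geometric)
    qed (use c \<kappa> A in auto)
    finally show "norm (fps_nth (inverse G) n) \<le> \<kappa> * A * (4 / c) * 2 * wt q n" .
  qed
  then show ?thesis unfolding G_def by blast
qed

lemma wt_bdd_inverse:
  fixes F :: "nat \<Rightarrow> real"
  assumes "decseq F" "F 0 = 1" "F 1 < 1" "1 < q" "q < q0" "\<And>n. F n \<ge> 0" "\<And>n. F n \<le> C * wt q0 n"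
  shows "\<exists>A. wt_bdd q A (inverse (Abs_fps F))"
proof -
  define d where "d = inverse (Abs_fps F)"
  have "Abs_fps F * d = 1"
    unfolding d_def using assms(2) inverse_mult_eq_1[of "Abs_fps F"] by (simp add: mult.commute)
  then have *: "(\<Sum>i=0..n. F i * fps_nth d (n - i)) = (if n = 0 then 1 else 0)" for n
    by (metis (mono_tags, lifting) fps_mult_nth fps_nth_Abs_fps fps_one_nth sum.cong)
  have "Abs_fps (\<lambda>n. complex_of_real (F n)) * Abs_fps (\<lambda>n. of_real (fps_nth d n)) = 1"
  proof (rule fps_ext)
    fix n
    have "fps_nth (Abs_fps (\<lambda>n. complex_of_real (F n)) * Abs_fps (\<lambda>n. of_real (fps_nth d n))) n =
      of_real (\<Sum>i=0..n. F i * fps_nth d (n - i))"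
      by (simp add: fps_mult_nth)
    then show "fps_nth (Abs_fps (\<lambda>n. complex_of_real (F n)) * Abs_fps (\<lambda>n. of_real (fps_nth d n))) n =
      fps_nth 1 n"
      by (simp add: *)
  qed
  then have "inverse (Abs_fps (\<lambda>n. complex_of_real (F n))) = Abs_fps (\<lambda>n. of_real (fps_nth d n))"
    using assms(2) by (metis fps_inverse_unique)
  then have "wt_bdd q A (inverse (Abs_fps (\<lambda>n. complex_of_real (F n)))) = wt_bdd q A d" for A
    by (simp add: wt_bdd_def)
  then show ?thesis
    using wt_bdd_inverse_complex[OF assms] by (simp add: d_def)
qed

subsection \<open>Renewal sequences\<close>

lemma sum_triangle:
  fixes y :: "nat \<Rightarrow> real"
  shows "(\<Sum>i<m. \<Sum>j\<in>{Suc i..m}. y j) = (\<Sum>j\<le>m. real j * y j)"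
proof (induction m)
  case 0
  show ?case by simp
next
  case (Suc m)
  have "(\<Sum>j\<in>{Suc i..Suc m}. y j) = (\<Sum>j\<in>{Suc i..m}. y j) + y (Suc m)" if "i < m" for i
    using that by simp
  then have "(\<Sum>i<Suc m. \<Sum>j\<in>{Suc i..Suc m}. y j) =
      (\<Sum>i<m. (\<Sum>j\<in>{Suc i..m}. y j) + y (Suc m)) + y (Suc m)"
    by simp
  then show ?case
    by (simp add: sum.distrib Suc algebra_simps)
qed

text \<open>Decay is imposed on tails, not on single terms: terms of order \<open>wt q\<close> have
  in general only tails of order \<open>wt (q - 1)\<close>, and a power of \<open>n\<close> would be
  lost in \<open>conv_increment\<close>.\<close>

definition tail_bdd :: "real \<Rightarrow> real \<Rightarrow> (nat \<Rightarrow> real) \<Rightarrow> bool" where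
  "tail_bdd q A x \<longleftrightarrow> (\<forall>n m. (\<Sum>j=n..<m. \<bar>x j\<bar>) \<le> A * wt q n)"

lemma tail_bdd_abs_le: "tail_bdd q A x \<Longrightarrow> \<bar>x n\<bar> \<le> A * wt q n"
  unfolding tail_bdd_def by (drule spec[of _ n], drule spec[of _ "Suc n"]) simp

lemma tail_bdd_nonneg: "tail_bdd q A x \<Longrightarrow> A \<ge> 0"
  using tail_bdd_abs_le[of q A x 0] by simp

lemma tail_bdd_summable:
  assumes "tail_bdd q A x" shows "summable (\<lambda>n. \<bar>x n\<bar>)"
proof (rule summableI_nonneg_bounded)
  show "(\<Sum>i<n. \<bar>x i\<bar>) \<le> A * wt q 0" for n
    using assms unfolding tail_bdd_def lessThan_atLeast0 by blast
qed simp

lemma tail_bdd_partial_sum: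
  assumes x: "tail_bdd q A x" and "x sums X" and "q \<ge> 0"
  shows "\<bar>X - (\<Sum>j\<le>n. x j)\<bar> \<le> A * wt q n"
proof (rule LIMSEQ_le_const2)
  show "(\<lambda>m. \<bar>(\<Sum>j<m. x j) - (\<Sum>j\<le>n. x j)\<bar>) \<longlonglongrightarrow> \<bar>X - (\<Sum>j\<le>n. x j)\<bar>"
    using assms(2) unfolding sums_def by (intro tendsto_intros)
  show "\<exists>M. \<forall>m\<ge>M. \<bar>(\<Sum>j<m. x j) - (\<Sum>j\<le>n. x j)\<bar> \<le> A * wt q n"
  proof (intro exI allI impI)
    fix m assume "Suc n \<le> m"
    then have "(\<Sum>j<m. x j) - (\<Sum>j\<le>n. x j) = (\<Sum>j=Suc n..<m. x j)"
      unfolding lessThan_Suc_atMost[symmetric] lessThan_atLeast0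
      using sum_diff_nat_ivl[of 0 "Suc n" m x] by simp
    also have "\<bar>\<dots>\<bar> \<le> (\<Sum>j=Suc n..<m. \<bar>x j\<bar>)" by (rule sum_abs)
    also have "\<dots> \<le> A * wt q (Suc n)" using x by (simp add: tail_bdd_def)
    also have "\<dots> \<le> A * wt q n"
      using tail_bdd_nonneg[OF x] assms(3) by (intro mult_left_mono wt_antimono) auto
    finally show "\<bar>(\<Sum>j<m. x j) - (\<Sum>j\<le>n. x j)\<bar> \<le> A * wt q n" .
  qed
qed

lemma tail_bdd_first_moment:
  assumes x: "tail_bdd q A x" and "q > 1"
  shows "(\<Sum>j\<le>m. real j * \<bar>x j\<bar>) \<le> A * suminf (wt q)"
proof -
  have A: "A \<ge> 0" using x by (rule tail_bdd_nonneg)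
  have "(\<Sum>j\<in>{Suc i..m}. \<bar>x j\<bar>) \<le> A * wt q (Suc i)" for i
    using x unfolding tail_bdd_def by (metis atLeastLessThanSuc_atLeastAtMost)
  then have "(\<Sum>j\<le>m. real j * \<bar>x j\<bar>) \<le> (\<Sum>i<m. A * wt q (Suc i))"
    unfolding sum_triangle[symmetric] by (intro sum_mono)
  also have "\<dots> = A * sum (wt q) (Suc ` {..<m})"
    by (simp add: sum_distrib_left sum.reindex)
  also have "\<dots> \<le> A * suminf (wt q)"
    using A assms(2) by (intro mult_left_mono sum_wt_le) auto
  finally show ?thesis .
qed

lemma increment_bound:
  fixes g :: "nat \<Rightarrow> real"
  assumes "\<And>k. \<bar>g (Suc k) - g k\<bar> \<le> b (Suc k)" "i \<le> n"
  shows "\<bar>g i - g n\<bar> \<le> (\<Sum>k\<in>{Suc i..n}. b k)"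
  using \<open>i \<le> n\<close>
proof (induction n rule: dec_induct)
  case (step n)
  then show ?case using assms(1)[of n] by simp
qed simp

lemma increment_half:
  fixes g :: "nat \<Rightarrow> real"
  assumes g: "\<And>k. \<bar>g (Suc k) - g k\<bar> \<le> B * wt q (Suc k)" and B: "B \<ge> 0" "q \<ge> 0"
    and j: "j \<le> n div 2"
  shows "\<bar>g (n - j) - g n\<bar> \<le> real j * (B * (2 powr q * wt q n))"
proof -
  have "\<bar>g (n - j) - g n\<bar> \<le> (\<Sum>k\<in>{Suc (n - j)..n}. B * wt q k)"
    using g by (rule increment_bound) simp
  also have "\<dots> \<le> (\<Sum>k\<in>{Suc (n - j)..n}. B * (2 powr q * wt q n))"
    using B j by (intro sum_mono mult_left_mono wt_half) auto
  finally show ?thesis using j by simp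
qed

lemma split_half: "{..n} = {..n div 2} \<union> {Suc (n div 2)..n}" "{..n div 2} \<inter> {Suc (n div 2)..n} = {}"
  by auto

text \<open>Split at \<open>n div 2\<close>. For small \<open>j\<close> the change of
  \<open>g\<close> over the last \<open>j\<close> steps is at most \<open>j\<close> times a weight
  of order \<open>wt q n\<close>, and the first moment of \<open>x\<close> is finite; for large
  \<open>j\<close> the tail of \<open>x\<close> is itself of order \<open>wt q n\<close> and
  \<open>g\<close> is bounded.\<close>

lemma conv_increment:
  fixes g x :: "nat \<Rightarrow> real"
  assumes q: "q > 1" and x: "tail_bdd q A x" and X: "x sums X"
    and g: "\<And>k. \<bar>g (Suc k) - g k\<bar> \<le> B * wt q (Suc k)" and B: "B \<ge> 0"
    and g0: "\<And>k. \<bar>g k\<bar> \<le> B0"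
  shows "\<exists>C. \<forall>n. \<bar>(\<Sum>j\<le>n. x j * g (n - j)) - X * g n\<bar> \<le> C * wt q n"
proof (intro exI allI)
  fix n
  have A: "A \<ge> 0" using x by (rule tail_bdd_nonneg)
  have B0: "B0 \<ge> 0" using g0[of 0] by auto
  let ?t = "\<lambda>j. \<bar>x j\<bar> * \<bar>g (n - j) - g n\<bar>"
  have "sum ?t {..n div 2} \<le> (\<Sum>j\<le>n div 2. \<bar>x j\<bar> * (real j * (B * (2 powr q * wt q n))))"
    using increment_half[OF g B] q by (intro sum_mono mult_left_mono) auto
  also have "\<dots> = (\<Sum>j\<le>n div 2. real j * \<bar>x j\<bar>) * (B * (2 powr q * wt q n))"
    by (simp add: sum_distrib_left mult_ac)
  also have "\<dots> \<le> (A * suminf (wt q)) * (B * (2 powr q * wt q n))"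
    using B by (intro mult_right_mono tail_bdd_first_moment x q) auto
  finally have 1: "sum ?t {..n div 2} \<le> (A * suminf (wt q) * B * 2 powr q) * wt q n"
    by (simp add: mult_ac)
  have "\<bar>g (n - j) - g n\<bar> \<le> 2 * B0" for j
    using g0[of "n - j"] g0[of n] by linarith
  then have "sum ?t {Suc (n div 2)..n} \<le> (\<Sum>j\<in>{Suc (n div 2)..n}. \<bar>x j\<bar> * (2 * B0))"
    by (intro sum_mono mult_left_mono) auto
  also have "\<dots> = (\<Sum>j=Suc (n div 2)..<Suc n. \<bar>x j\<bar>) * (2 * B0)"
    by (simp add: sum_distrib_right atLeastLessThanSuc_atLeastAtMost)
  also have "\<dots> \<le> (A * wt q (Suc (n div 2))) * (2 * B0)"
    using x B0 by (intro mult_right_mono) (auto simp: tail_bdd_def simp del: sum.op_ivl_Suc)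
  also have "\<dots> \<le> (A * (2 powr q * wt q n)) * (2 * B0)"
    using A B0 q by (intro mult_right_mono mult_left_mono wt_half) auto
  finally have 2: "sum ?t {Suc (n div 2)..n} \<le> (2 * A * B0 * 2 powr q) * wt q n"
    by (simp add: mult_ac)
  have 3: "\<bar>X - (\<Sum>j\<le>n. x j)\<bar> * \<bar>g n\<bar> \<le> (A * wt q n) * B0"
    using q A by (intro mult_mono tail_bdd_partial_sum[OF x X] g0) auto
  have "(\<Sum>j\<le>n. x j * g (n - j)) - X * g n =
      (\<Sum>j\<le>n. x j * (g (n - j) - g n)) - (X - (\<Sum>j\<le>n. x j)) * g n"
    by (simp add: algebra_simps sum_subtractf sum_distrib_left)
  also have "\<bar>\<dots>\<bar> \<le> \<bar>\<Sum>j\<le>n. x j * (g (n - j) - g n)\<bar> + \<bar>X - (\<Sum>j\<le>n. x j)\<bar> * \<bar>g n\<bar>"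
    by (simp add: abs_mult[symmetric])
  also have "\<bar>\<Sum>j\<le>n. x j * (g (n - j) - g n)\<bar> \<le> sum ?t {..n}"
    using sum_abs[of "\<lambda>j. x j * (g (n - j) - g n)" "{..n}"] by (simp add: abs_mult)
  also have "sum ?t {..n} = sum ?t {..n div 2} + sum ?t {Suc (n div 2)..n}"
    by (subst split_half(1), rule sum.union_disjoint) auto
  finally show "\<bar>(\<Sum>j\<le>n. x j * g (n - j)) - X * g n\<bar> \<le>
      (A * suminf (wt q) * B * 2 powr q + 2 * A * B0 * 2 powr q + A * B0) * wt q n"
    using 1 2 3 by (simp add: algebra_simps)
qed

text \<open>The sum is, up to a constant, the truncated first moment of a tail of order
  \<open>wt q\<close>. The product has order \<open>n powr - q\<close> for \<open>q > 2\<close> and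
  \<open>n powr (2 - 2 * q)\<close> for \<open>q < 2\<close>.\<close>

definition renewal_err :: "real \<Rightarrow> nat \<Rightarrow> real" where
  "renewal_err q n = wt q n * (\<Sum>k\<le>n. wt (q - 1) k)"

lemma wt_le_renewal_err: "wt q n \<le> renewal_err q n"
proof -
  have "1 \<le> (\<Sum>k\<le>n. wt (q - 1) k)"
    using member_le_sum[of 0 "{..n}" "wt (q - 1)"] by simp
  then show ?thesis
    unfolding renewal_err_def using mult_left_mono[of 1 _ "wt q n"] by simp
qed

lemma renewal_err_nonneg [simp]: "renewal_err q n \<ge> 0"
  unfolding renewal_err_def by (intro mult_nonneg_nonneg sum_nonneg) auto

lemma Suc_mult_wt: "(real k + 1) * wt q k = wt (q - 1) k"
  by (simp add: wt_def powr_mult_base powr_diff powr_minus field_simps)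

lemma mult_wt_le: "real k * wt q k \<le> wt (q - 1) k"
proof -
  have "wt (q - 1) k = real k * wt q k + wt q k"
    by (simp add: Suc_mult_wt[symmetric] distrib_right)
  then show ?thesis using wt_nonneg[of q k] by linarith
qed

text \<open>The sequence \<open>u\<close> is the renewal sequence with waiting time tail \<open>F\<close>, and \<open>d\<close> are its increments.\<close>

lemma renewal_sequence_estimate:
  fixes F :: "nat \<Rightarrow> real"
  assumes dec: "decseq F" and F0: "F 0 = 1" and F1: "F 1 < 1" and q: "1 < q" "q < q0"
    and nn: "\<And>n. F n \<ge> 0" and bd: "\<And>n. F n \<le> C * wt q0 n"
  defines "d \<equiv> inverse (Abs_fps F)"
  defines "u \<equiv> \<lambda>n. \<Sum>i\<le>n. fps_nth d i"
  shows "\<exists>C. \<forall>n. \<bar>u n - 1 / (\<Sum>k\<le>n. F k)\<bar> \<le> C * renewal_err q n"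
proof -
  obtain A where A: "wt_bdd q A d"
    using wt_bdd_inverse[OF dec F0 F1 q nn bd] unfolding d_def by blast
  then have dA: "\<bar>fps_nth d n\<bar> \<le> A * wt q n" for n by (simp add: wt_bdd_def)
  have A0: "A \<ge> 0" using dA[of 0] by simp
  have C0: "C \<ge> 0" using bd[of 0] F0 by simp
  have bd': "F n \<le> C * wt q n" for n
  proof -
    have "wt q0 n \<le> wt q n" unfolding wt_def using q by (intro powr_mono) auto
    then show ?thesis using bd[of n] C0 by (meson mult_left_mono order.trans)
  qed
  have inc: "\<bar>u (Suc k) - u k\<bar> \<le> A * wt q (Suc k)" for k
    using dA[of "Suc k"] by (simp add: u_def)
  have "Abs_fps F * d = 1"
    unfolding d_def using F0 inverse_mult_eq_1[of "Abs_fps F"] by (simp add: mult.commute)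
  moreover have "Abs_fps u = d * Abs_fps (\<lambda>_. 1)"
    by (rule fps_ext) (simp add: u_def fps_mult_nth atLeast0AtMost)
  ultimately have "Abs_fps F * Abs_fps u = Abs_fps (\<lambda>_. 1)"
    by (simp add: mult.assoc[symmetric])
  then have ren: "(\<Sum>k\<le>n. F k * u (n - k)) = 1" for n
    by (metis (mono_tags, lifting) atLeast0AtMost fps_mult_nth fps_nth_Abs_fps sum.cong)
  show ?thesis
  proof (intro exI allI)
    fix n
    define s where "s = (\<Sum>k\<le>n. F k)"
    define Z where "Z = (\<Sum>k\<le>n. wt (q - 1) k)"
    have Z0: "Z \<ge> 0" unfolding Z_def by (intro sum_nonneg) auto
    have s1: "s \<ge> 1"
      using member_le_sum[of 0 "{..n}" F] nn F0 by (simp add: s_def)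
    \<comment> \<open>By the renewal identity \<open>ren\<close>, these terms bound
      \<open>1 - s * u n\<close>. Below \<open>n div 2\<close> the increments of \<open>u\<close>
      are small; above it \<open>F k\<close> is of order \<open>wt q n\<close>, and the differences
      of \<open>u\<close> add up to at most a truncated first moment of its increments.\<close>
    let ?t = "\<lambda>k. F k * \<bar>u (n - k) - u n\<bar>"
    have "sum ?t {..n div 2} \<le> (\<Sum>k\<le>n div 2. (C * wt q k) * (real k * (A * (2 powr q * wt q n))))"
      using q nn bd' C0 by (intro sum_mono mult_mono increment_half[OF inc A0]) auto
    also have "\<dots> = C * A * 2 powr q * wt q n * (\<Sum>k\<le>n div 2. real k * wt q k)"
      by (simp add: sum_distrib_left sum_distrib_right mult_ac)
    also have "(\<Sum>k\<le>n div 2. real k * wt q k) \<le> (\<Sum>k\<le>n div 2. wt (q - 1) k)"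
      by (intro sum_mono mult_wt_le)
    also have "\<dots> \<le> Z"
      unfolding Z_def by (intro sum_mono2) auto
    finally have 1: "sum ?t {..n div 2} \<le> C * A * 2 powr q * wt q n * Z"
      using C0 A0 by (simp add: mult_left_mono)
    have "sum ?t {Suc (n div 2)..n} \<le> (\<Sum>k\<in>{Suc (n div 2)..n}. (C * (2 powr q * wt q n)) * \<bar>u (n - k) - u n\<bar>)"
    proof (intro sum_mono mult_right_mono)
      fix k assume k: "k \<in> {Suc (n div 2)..n}"
      have "F k \<le> C * wt q k" by (rule bd')
      also have "\<dots> \<le> C * (2 powr q * wt q n)"
        using C0 q k by (intro mult_left_mono wt_half) auto
      finally show "F k \<le> C * (2 powr q * wt q n)" .
    qed auto
    also have "\<dots> = (C * (2 powr q * wt q n)) * (\<Sum>k\<in>{Suc (n div 2)..n}. \<bar>u (n - k) - u n\<bar>)"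
      by (simp add: sum_distrib_left)
    also have "(\<Sum>k\<in>{Suc (n div 2)..n}. \<bar>u (n - k) - u n\<bar>) \<le> (\<Sum>k\<in>{1..n}. \<bar>u (n - k) - u n\<bar>)"
      by (intro sum_mono2) auto
    also have "(\<Sum>k\<in>{1..n}. \<bar>u (n - k) - u n\<bar>) = (\<Sum>i<n. \<bar>u i - u n\<bar>)"
      by (rule sum.reindex_bij_witness[of _ "\<lambda>i. n - i" "\<lambda>i. n - i"]) auto
    also have "\<dots> \<le> (\<Sum>i<n. \<Sum>j\<in>{Suc i..n}. A * wt q j)"
      by (intro sum_mono increment_bound inc) auto
    also have "\<dots> = A * (\<Sum>j\<le>n. real j * wt q j)"
      by (simp add: sum_triangle sum_distrib_left mult_ac)
    also have "(\<Sum>j\<le>n. real j * wt q j) \<le> Z"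
      unfolding Z_def by (intro sum_mono mult_wt_le)
    finally have 2: "sum ?t {Suc (n div 2)..n} \<le> (C * (2 powr q * wt q n)) * (A * Z)"
      using C0 A0 by (simp add: mult_left_mono)
    have "1 - s * u n = (\<Sum>k\<le>n. F k * (u (n - k) - u n))"
      using ren[of n] by (simp add: s_def algebra_simps sum_subtractf sum_distrib_left)
    then have "\<bar>1 - s * u n\<bar> \<le> sum ?t {..n}"
      using sum_abs[of "\<lambda>k. F k * (u (n - k) - u n)" "{..n}"] nn by (simp add: abs_mult)
    also have "sum ?t {..n} = sum ?t {..n div 2} + sum ?t {Suc (n div 2)..n}"
      by (subst split_half(1), rule sum.union_disjoint) auto
    also have "\<dots> \<le> 2 * C * A * 2 powr q * renewal_err q n"
      using 1 2 by (simp add: renewal_err_def Z_def mult_ac)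
    finally have 3: "\<bar>1 - s * u n\<bar> \<le> 2 * C * A * 2 powr q * renewal_err q n" .
    have "\<bar>u n - 1 / s\<bar> = \<bar>1 - s * u n\<bar> / s"
      using s1 by (simp add: field_simps abs_if split: if_splits)
    also have "\<dots> \<le> \<bar>1 - s * u n\<bar> / 1"
      using s1 by (intro divide_left_mono) auto
    finally show "\<bar>u n - 1 / (\<Sum>k\<le>n. F k)\<bar> \<le> 2 * C * A * 2 powr q * renewal_err q n"
      using 3 by (simp add: s_def)
  qed
qed

text \<open>A delayed renewal equation: \<open>e\<close> is the convolution of the forcing
  \<open>w\<close> with \<open>u\<close>, and \<open>E\<close> starts after a delay distributed like
  \<open>a\<close>. Each convolution is replaced by the sum of its first factor via
  \<open>conv_increment\<close>, which needs increments of order \<open>wt q\<close>: those of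
  \<open>u\<close> are \<open>d\<close>, those of \<open>e\<close> are the convolution of
  \<open>w\<close> and \<open>d\<close>.\<close>

theorem renewal_equation_estimate:
  fixes F w e a W E :: "nat \<Rightarrow> real"
  assumes dec: "decseq F" and F0: "F 0 = 1" and F1: "F 1 < 1" and q: "1 < q" "q < q0"
    and nn: "\<And>n. F n \<ge> 0" and bd: "\<And>n. F n \<le> C * wt q0 n"
    and w: "tail_bdd q Aw w" "w sums w1"
    and e: "\<And>n. e n = w n + (\<Sum>i=1..n. (F (i - 1) - F i) * e (n - i))"
    and a: "tail_bdd q Aa a" "a sums m" "a 0 = 0"
    and W: "\<And>n. \<bar>W n\<bar> \<le> AW * wt q n"
    and E: "\<And>n. E n = W n + (\<Sum>i=1..n. a i * e (n - i))"
  shows "\<exists>C. \<forall>n. \<bar>E n - m * w1 * (1 / (\<Sum>k\<le>n. F k))\<bar> \<le> C * renewal_err q n"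
proof -
  define d where "d = inverse (Abs_fps F)"
  define u where "u n = (\<Sum>i\<le>n. fps_nth d i)" for n
  obtain A where A: "wt_bdd q A d"
    using wt_bdd_inverse[OF dec F0 F1 q nn bd] unfolding d_def by blast
  then have dA: "\<bar>fps_nth d n\<bar> \<le> A * wt q n" for n by (simp add: wt_bdd_def)
  have A0: "A \<ge> 0" using dA[of 0] by simp
  obtain C1 where C1: "\<And>n. \<bar>u n - 1 / (\<Sum>k\<le>n. F k)\<bar> \<le> C1 * renewal_err q n"
    using renewal_sequence_estimate[OF dec F0 F1 q nn bd] unfolding u_def d_def by blast
  have partial_bdd: "\<exists>B. \<forall>n. \<bar>\<Sum>i\<le>n. fps_nth X i\<bar> \<le> B" if X: "wt_bdd q A' X" for X :: "real fps" and A'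
  proof (intro exI allI)
    fix n
    have X': "\<bar>fps_nth X i\<bar> \<le> A' * wt q i" for i using X by (simp add: wt_bdd_def)
    have "\<bar>\<Sum>i\<le>n. fps_nth X i\<bar> \<le> (\<Sum>i\<le>n. A' * wt q i)"
      using X' by (intro order.trans[OF sum_abs] sum_mono)
    also have "\<dots> \<le> A' * suminf (wt q)"
      unfolding sum_distrib_left[symmetric] using q X'[of 0]
      by (intro mult_left_mono sum_wt_le) auto
    finally show "\<bar>\<Sum>i\<le>n. fps_nth X i\<bar> \<le> A' * suminf (wt q)" .
  qed
  have X1: "Abs_fps (\<lambda>_. 1) * (1 - fps_X) = (1 :: real fps)"
    by (rule fps_ext) (auto simp: algebra_simps)
  \<comment> \<open>Turns the renewal equation into division by the series of \<open>F\<close>; the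
    remaining factor \<open>1 - fps_X\<close> is undone by the series with all coefficients
    \<open>1\<close>, that is by partial sums.\<close>
  have fX: "1 - Abs_fps (\<lambda>i. if i = 0 then 0 else F (i - 1) - F i) = Abs_fps F * (1 - fps_X)" (is "1 - ?f = _")
    by (rule fps_ext) (auto simp: algebra_simps F0)
  have "Abs_fps e = Abs_fps w + ?f * Abs_fps e"
  proof (rule fps_ext)
    fix n
    have "(\<Sum>i=1..n. (F (i - 1) - F i) * e (n - i)) = (\<Sum>i=0..n. fps_nth ?f i * e (n - i))"
      by (intro sum.mono_neutral_cong_left) auto
    then show "fps_nth (Abs_fps e) n = fps_nth (Abs_fps w + ?f * Abs_fps e) n"
      using e[of n] by (simp add: fps_mult_nth)
  qed
  then have "Abs_fps w = (1 - ?f) * Abs_fps e"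
    by (simp add: algebra_simps)
  then have "Abs_fps w * d * Abs_fps (\<lambda>_. 1) = (Abs_fps F * d) * (Abs_fps (\<lambda>_. 1) * (1 - fps_X)) * Abs_fps e"
    unfolding fX by (simp only: mult_ac)
  also have "Abs_fps F * d = 1"
    unfolding d_def using F0 inverse_mult_eq_1[of "Abs_fps F"] by (simp add: mult.commute)
  finally have eq: "Abs_fps e = Abs_fps w * d * Abs_fps (\<lambda>_. 1)"
    by (simp add: X1)
  have e_sum: "e n = (\<Sum>i\<le>n. fps_nth (Abs_fps w * d) i)" for n
    using arg_cong[OF eq, of "\<lambda>X. fps_nth X n"] by (simp add: fps_mult_nth atLeast0AtMost)
  have "Abs_fps u = d * Abs_fps (\<lambda>_. 1)"
    by (rule fps_ext) (simp add: u_def fps_mult_nth atLeast0AtMost)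
  then have "Abs_fps e = Abs_fps w * Abs_fps u"
    using eq by (simp add: mult.assoc)
  from arg_cong[OF this, of "\<lambda>X. fps_nth X n" for n]
  have e_conv: "e n = (\<Sum>j\<le>n. w j * u (n - j))" for n
    by (simp add: fps_mult_nth atLeast0AtMost)
  obtain B0 where B0: "\<And>n. \<bar>u n\<bar> \<le> B0"
    using partial_bdd[OF A] unfolding u_def by blast
  have uinc: "\<bar>u (Suc k) - u k\<bar> \<le> A * wt q (Suc k)" for k
    using dA[of "Suc k"] by (simp add: u_def)
  obtain C2 where C2: "\<And>n. \<bar>e n - w1 * u n\<bar> \<le> C2 * wt q n"
    using conv_increment[OF q(1) w uinc A0 B0] unfolding e_conv by blast
  have "wt_bdd q Aw (Abs_fps w)"
    using tail_bdd_abs_le[OF w(1)] by (simp add: wt_bdd_def)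
  then have wd: "wt_bdd q (wt_conv_const q * Aw * A) (Abs_fps w * d)"
    by (rule wt_bdd_mult[OF q(1) _ A tail_bdd_nonneg[OF w(1)]])
  have einc: "\<bar>e (Suc k) - e k\<bar> \<le> (wt_conv_const q * Aw * A) * wt q (Suc k)" for k
    using wd by (simp add: e_sum wt_bdd_def)
  have nonneg: "wt_conv_const q * Aw * A \<ge> 0"
    using wt_conv_const_ge_1[OF q(1)] tail_bdd_nonneg[OF w(1)] A0 by simp
  obtain B1 where B1: "\<And>n. \<bar>e n\<bar> \<le> B1"
    using partial_bdd[OF wd] unfolding e_sum by blast
  obtain C3 where C3: "\<And>n. \<bar>(\<Sum>j\<le>n. a j * e (n - j)) - m * e n\<bar> \<le> C3 * wt q n"
    using conv_increment[OF q(1) a(1,2) einc nonneg B1] by blast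
  show ?thesis
  proof (intro exI allI)
    fix n
    have "(\<Sum>i=1..n. a i * e (n - i)) = (\<Sum>j\<le>n. a j * e (n - j))"
      using a(3) by (intro sum.mono_neutral_cong_left) (auto simp: not_le)
    then have 1: "\<bar>E n - m * e n\<bar> \<le> (AW + C3) * wt q n"
      using E[of n] W[of n] C3[of n] by (simp add: algebra_simps)
    have 2: "\<bar>m * e n - m * w1 * u n\<bar> \<le> (\<bar>m\<bar> * C2) * wt q n"
    proof -
      have "m * e n - m * w1 * u n = m * (e n - w1 * u n)" by (simp add: algebra_simps)
      then show ?thesis using C2[of n] by (simp add: abs_mult mult_left_mono mult.assoc)
    qed
    have 3: "\<bar>m * w1 * u n - m * w1 * (1 / (\<Sum>k\<le>n. F k))\<bar> \<le> (\<bar>m * w1\<bar> * C1) * renewal_err q n"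
    proof -
      have "m * w1 * u n - m * w1 * (1 / (\<Sum>k\<le>n. F k)) = m * w1 * (u n - 1 / (\<Sum>k\<le>n. F k))"
        by (simp add: algebra_simps)
      then show ?thesis using C1[of n] by (simp only: abs_mult mult_left_mono mult.assoc abs_ge_zero)
    qed
    have "AW + C3 \<le> \<bar>AW + C3\<bar>" "\<bar>m\<bar> * C2 \<le> \<bar>m\<bar> * \<bar>C2\<bar>" by (auto intro: mult_left_mono)
    then have "(AW + C3) * wt q n \<le> \<bar>AW + C3\<bar> * renewal_err q n"
       "(\<bar>m\<bar> * C2) * wt q n \<le> (\<bar>m\<bar> * \<bar>C2\<bar>) * renewal_err q n"
      by (auto intro!: mult_mono wt_le_renewal_err)
    then show "\<bar>E n - m * w1 * (1 / (\<Sum>k\<le>n. F k))\<bar> \<le>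
        (\<bar>AW + C3\<bar> + \<bar>m\<bar> * \<bar>C2\<bar> + \<bar>m * w1\<bar> * C1) * renewal_err q n"
      using 1 2 3 unfolding distrib_right by linarith
  qed
qed

subsection \<open>Regeneration\<close>

lemma sum_triangle_reindex:
  fixes \<phi> :: "nat \<Rightarrow> nat \<Rightarrow> real"
  shows "(\<Sum>i=1..n. \<Sum>j=1..n-i. \<phi> i j) = (\<Sum>k=1..n. \<Sum>i=1..<k. \<phi> i (k - i))"
  unfolding sum.Sigma[OF finite_atLeastAtMost ballI[OF finite_atLeastAtMost]]
    sum.Sigma[OF finite_atLeastAtMost ballI[OF finite_atLeastLessThan]]
  by (rule sum.reindex_bij_witness[of _ "\<lambda>(k, i). (i, k - i)" "\<lambda>(i, j). (i + j, i)"]) auto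

lemma sum_split_at:
  fixes g :: "nat \<Rightarrow> real"
  assumes "i \<le> n" shows "sum g {1..n} = sum g {1..i} + sum g {Suc i..n}"
proof -
  have "{1..n} = {1..i} \<union> {Suc i..n}" using assms by auto
  then show ?thesis by (simp add: sum.union_disjoint)
qed

text \<open>\<open>R i H\<close> is the density, at time \<open>i\<close>, of the part of \<open>H\<close> that first returns at time \<open>i\<close>, and \<open>Q i H\<close>
  is what remains after a fraction \<open>\<delta>\<close> of its mass has been replaced by the reference density \<open>one\<close>.
  Below, \<open>T n H\<close> is the mass not yet replaced at time \<open>n\<close> and \<open>regen n H\<close> the mass replaced at time \<open>n\<close>.\<close>

locale regeneration =
  fixes C :: "'h set" and mass :: "'h \<Rightarrow> real" and R Q :: "nat \<Rightarrow> 'h \<Rightarrow> 'h" and one :: 'h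
    and \<delta> q0 q C1 :: real
  assumes one: "one \<in> C" "mass one = 1"
    and mass_nonneg: "\<And>H. H \<in> C \<Longrightarrow> mass H \<ge> 0"
    and R_nonneg: "\<And>H i. H \<in> C \<Longrightarrow> mass (R i H) \<ge> 0"
    and Q_closed: "\<And>H i. H \<in> C \<Longrightarrow> Q i H \<in> C"
    and Q_mass: "\<And>H i. H \<in> C \<Longrightarrow> mass (Q i H) = (1 - \<delta>) * mass (R i H)"
    and \<delta>: "0 < \<delta>" "\<delta> < 1"
    and q: "1 < q" "q < q0"
    and R_sum: "\<And>H n. H \<in> C \<Longrightarrow> (\<Sum>i=1..n. mass (R i H)) \<le> mass H"
    and R_tail: "\<And>H n. H \<in> C \<Longrightarrow> mass H - (\<Sum>i=1..n. mass (R i H)) \<le> C1 * mass H * wt q0 n"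
    and R_one: "mass (R 1 one) > 0"
begin

definition return_tail :: "nat \<Rightarrow> 'h \<Rightarrow> real" where
  "return_tail n H = mass H - (\<Sum>i=1..n. mass (R i H))"

function T :: "nat \<Rightarrow> 'h \<Rightarrow> real" where
  "T n H = return_tail n H + (\<Sum>i=1..n. T (n - i) (Q i H))"
  by auto
termination by (relation "inv_image less_than fst") auto

declare T.simps [simp del]

definition regen :: "nat \<Rightarrow> 'h \<Rightarrow> real" where
  "regen n H = (if n = 0 then 0 else T (n - 1) H - T n H)"

lemma regen_0 [simp]: "regen 0 H = 0"
  by (simp add: regen_def)

lemma regen_Suc: "regen (Suc n) H = T n H - T (Suc n) H"
  by (simp add: regen_def)

lemma return_tail_nonneg: "H \<in> C \<Longrightarrow> return_tail n H \<ge> 0"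
  using R_sum by (simp add: return_tail_def)

lemma T_0 [simp]: "T 0 H = mass H"
  by (subst T.simps) (simp add: return_tail_def)

lemma T_nonneg: "H \<in> C \<Longrightarrow> T n H \<ge> 0"
proof (induction n arbitrary: H rule: less_induct)
  case (less n)
  show ?case
    by (subst T.simps, intro add_nonneg_nonneg return_tail_nonneg sum_nonneg less.IH)
       (auto simp: less.prems Q_closed)
qed

lemma return_tail_le_T: "H \<in> C \<Longrightarrow> return_tail n H \<le> T n H"
  by (subst T.simps) (auto intro!: sum_nonneg T_nonneg Q_closed)

lemma Q_mass_le: "H \<in> C \<Longrightarrow> mass (Q i H) \<le> mass (R i H)"
  using Q_mass R_nonneg \<delta> by (simp add: mult_left_le_one_le)

lemma T_le_mass: "H \<in> C \<Longrightarrow> T n H \<le> mass H"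
proof (induction n arbitrary: H rule: less_induct)
  case (less n)
  have "(\<Sum>i=1..n. T (n - i) (Q i H)) \<le> (\<Sum>i=1..n. mass (R i H))"
  proof (rule sum_mono)
    fix i assume "i \<in> {1..n}"
    then have "T (n - i) (Q i H) \<le> mass (Q i H)"
      using less.prems by (intro less.IH Q_closed) auto
    also have "\<dots> \<le> mass (R i H)" using less.prems by (rule Q_mass_le)
    finally show "T (n - i) (Q i H) \<le> mass (R i H)" .
  qed
  then show ?case by (subst T.simps) (simp add: return_tail_def)
qed

text \<open>Regeneration at \<open>Suc n\<close> happens at a first return at that very time or
  after an earlier first return at \<open>i\<close>. The factor \<open>\<delta>\<close> is what
  \<open>Q_mass\<close> removes from the term \<open>i = Suc n\<close>, where \<open>T 0\<close> is
  the mass.\<close>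

lemma regen_rec:
  assumes "H \<in> C"
  shows "regen (Suc n) H = \<delta> * mass (R (Suc n) H) + (\<Sum>i=1..n. regen (Suc n - i) (Q i H))"
proof -
  have "(\<Sum>i=1..n. regen (Suc n - i) (Q i H)) = (\<Sum>i=1..n. T (n - i) (Q i H) - T (Suc n - i) (Q i H))"
    by (intro sum.cong) (auto simp: regen_def)
  also have "\<dots> = (\<Sum>i=1..n. T (n - i) (Q i H)) - (\<Sum>i=1..n. T (Suc n - i) (Q i H))"
    by (rule sum_subtractf)
  finally show ?thesis
    using Q_mass[OF assms, of "Suc n"] T.simps[of n H] T.simps[of "Suc n" H]
    by (simp add: regen_Suc return_tail_def algebra_simps)
qed

lemma regen_nonneg: "H \<in> C \<Longrightarrow> regen n H \<ge> 0"
proof (induction n arbitrary: H rule: less_induct)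
  case (less n)
  show ?case
  proof (cases n)
    case (Suc m)
    show ?thesis
      unfolding Suc regen_rec[OF less.prems] using \<delta> less.prems Suc
      by (intro add_nonneg_nonneg mult_nonneg_nonneg R_nonneg sum_nonneg less.IH) (auto intro: Q_closed)
  qed simp
qed

lemma sum_regen: "n \<le> m \<Longrightarrow> (\<Sum>j=Suc n..<Suc m. regen j H) = T n H - T m H"
proof (induction m rule: dec_induct)
  case (step m)
  have "(\<Sum>j=Suc n..<Suc (Suc m). regen j H) = (\<Sum>j=Suc n..<Suc m. regen j H) + regen (Suc m) H"
    using step by (subst sum.atLeastLessThan_Suc) auto
  then show ?case using step by (simp add: regen_Suc)
qed simp

text \<open>The number of returns before regeneration is dominated by a geometric one, so the tail
  order \<open>q0\<close> of one return survives. Induction on \<open>n\<close> with a single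
  constant \<open>A\<close>: a first return before time \<open>(1 - k) * (n + 1)\<close> leaves at
  least the fraction \<open>k\<close> of the time, a later one is already counted by the tail of the
  return time.\<close>

lemma T_tail: "\<exists>A\<ge>0. \<forall>H\<in>C. \<forall>n. T n H \<le> A * mass H * wt q0 n"
proof -
  have C1: "C1 \<ge> 1" using R_tail[of one 0] one by simp
  \<comment> \<open>Chosen so that
    \<open>(1 - \<delta>) * (1 / k) powr q0 = 1 - \<delta> / 2 < 1\<close>: the loss from the
    shorter remaining time stays below the gain from regeneration.\<close>
  define k where "k = ((1 - \<delta>) / (1 - \<delta> / 2)) powr (1 / q0)"
  have base: "0 < (1 - \<delta>) / (1 - \<delta> / 2)" "(1 - \<delta>) / (1 - \<delta> / 2) < 1"
    using \<delta> by (auto simp: divide_simps)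
  have k: "0 < k" "k < 1"
    using base q powr_less_mono2[of "1 / q0" "(1 - \<delta>) / (1 - \<delta> / 2)" 1] by (auto simp: k_def)
  have kq: "k powr q0 = (1 - \<delta>) / (1 - \<delta> / 2)"
    using \<delta> q by (simp add: k_def powr_powr)
  have kq': "(1 - \<delta>) * (1 / k) powr q0 = 1 - \<delta> / 2"
    using \<delta> k by (simp add: powr_divide kq)
  \<comment> \<open>The solution of the fixed point equation \<open>Aeq\<close>, whose left side
    adds up the three contributions estimated below.\<close>
  define A where "A = 2 / \<delta> * (C1 + C1 * (1 / (1 - k)) powr q0)"
  have A: "A \<ge> 0" using C1 \<delta> by (simp add: A_def)
  have Aeq: "C1 + (1 - \<delta> / 2) * A + C1 * (1 / (1 - k)) powr q0 = A"
    using \<delta> by (simp add: A_def field_simps)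
  have "T n H \<le> A * mass H * wt q0 n" if "H \<in> C" for n H
    using that
  proof (induction n arbitrary: H rule: less_induct)
    case (less n)
    note H = less.prems
    define i0 where "i0 = nat \<lfloor>(1 - k) * (real n + 1)\<rfloor>"
    have i0: "real i0 \<le> (1 - k) * (real n + 1)" "(1 - k) * (real n + 1) < real i0 + 1"
      using k unfolding i0_def by (auto simp: of_nat_nat)
    have "0 < k * (real n + 1)" using k by (intro mult_pos_pos) auto
    then have "(1 - k) * (real n + 1) < real n + 1" by (simp add: algebra_simps)
    then have i0n: "i0 \<le> n" using i0 by linarith
    have m: "mass H \<ge> 0" using H by (rule mass_nonneg)
    have 1: "(\<Sum>i=1..i0. T (n - i) (Q i H)) \<le> (1 - \<delta> / 2) * A * mass H * wt q0 n"
    proof -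
      have "(\<Sum>i=1..i0. T (n - i) (Q i H)) \<le>
          (\<Sum>i=1..i0. A * ((1 - \<delta>) * mass (R i H)) * ((1 / k) powr q0 * wt q0 n))"
      proof (rule sum_mono)
        fix i assume i: "i \<in> {1..i0}"
        then have "T (n - i) (Q i H) \<le> A * mass (Q i H) * wt q0 (n - i)"
          using i0n H by (intro less.IH Q_closed) auto
        also have "\<dots> \<le> A * mass (Q i H) * ((1 / k) powr q0 * wt q0 n)"
        proof (intro mult_left_mono wt_scale)
          have "k * (real n + 1) \<le> real (n - i) + 1"
            using i i0 i0n by (simp add: of_nat_diff algebra_simps)
          then show "real n + 1 \<le> 1 / k * (real (n - i) + 1)"
            using k by (simp add: field_simps)
          show "0 \<le> A * mass (Q i H)" using A mass_nonneg[OF Q_closed[OF H]] by simp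
        qed (use k q in auto)
        finally show "T (n - i) (Q i H) \<le> A * ((1 - \<delta>) * mass (R i H)) * ((1 / k) powr q0 * wt q0 n)"
          by (simp only: Q_mass[OF H])
      qed
      also have "\<dots> = ((1 - \<delta>) * (1 / k) powr q0) * A * (\<Sum>i=1..i0. mass (R i H)) * wt q0 n"
        by (simp add: sum_distrib_left sum_distrib_right mult_ac)
      also have "\<dots> \<le> (1 - \<delta> / 2) * A * mass H * wt q0 n"
        unfolding kq' using A \<delta> by (intro mult_right_mono mult_left_mono R_sum H) auto
      finally show ?thesis .
    qed
    have 2: "(\<Sum>i=Suc i0..n. T (n - i) (Q i H)) \<le> C1 * (1 / (1 - k)) powr q0 * mass H * wt q0 n"
    proof -
      have "(\<Sum>i=Suc i0..n. T (n - i) (Q i H)) \<le> (\<Sum>i=Suc i0..n. mass (R i H))"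
        using H by (intro sum_mono order.trans[OF T_le_mass] Q_closed Q_mass_le)
      also have "\<dots> = (\<Sum>i=1..n. mass (R i H)) - (\<Sum>i=1..i0. mass (R i H))"
        using sum_split_at[OF i0n, of "\<lambda>i. mass (R i H)"] by simp
      also have "\<dots> \<le> return_tail i0 H"
        using R_sum[OF H, of n] by (simp add: return_tail_def)
      also have "\<dots> \<le> C1 * mass H * wt q0 i0"
        unfolding return_tail_def by (rule R_tail[OF H])
      also have "\<dots> \<le> C1 * mass H * ((1 / (1 - k)) powr q0 * wt q0 n)"
      proof (intro mult_left_mono wt_scale)
        show "real n + 1 \<le> 1 / (1 - k) * (real i0 + 1)"
          using k i0 by (simp add: field_simps)
      qed (use k q C1 m in auto)
      finally show ?thesis by (simp add: mult_ac)
    qed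
    have 3: "return_tail n H \<le> C1 * mass H * wt q0 n"
      unfolding return_tail_def by (rule R_tail[OF H])
    have "(\<Sum>i=1..n. T (n - i) (Q i H)) =
        (\<Sum>i=1..i0. T (n - i) (Q i H)) + (\<Sum>i=Suc i0..n. T (n - i) (Q i H))"
      by (rule sum_split_at[OF i0n])
    then have "T n H \<le> C1 * mass H * wt q0 n + ((1 - \<delta> / 2) * A * mass H * wt q0 n +
        C1 * (1 / (1 - k)) powr q0 * mass H * wt q0 n)"
      using 1 2 3 by (subst T.simps) linarith
    also have "\<dots> = (C1 + (1 - \<delta> / 2) * A + C1 * (1 / (1 - k)) powr q0) * mass H * wt q0 n"
      by (simp add: algebra_simps)
    finally show ?case by (simp only: Aeq)
  qed
  with A show ?thesis by blast
qed

lemma T_tail':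
  obtains A where "A \<ge> 0" "\<And>H n. H \<in> C \<Longrightarrow> T n H \<le> A * mass H * wt q0 n"
    "\<And>H n. H \<in> C \<Longrightarrow> T n H \<le> A * mass H * wt q n"
proof -
  obtain A where A: "A \<ge> 0" "\<And>H n. H \<in> C \<Longrightarrow> T n H \<le> A * mass H * wt q0 n"
    using T_tail by blast
  have "T n H \<le> A * mass H * wt q n" if "H \<in> C" for H n
  proof -
    have "wt q0 n \<le> wt q n" unfolding wt_def using q by (intro powr_mono) auto
    then have "A * mass H * wt q0 n \<le> A * mass H * wt q n"
      using A(1) mass_nonneg[OF that] by (intro mult_left_mono) auto
    then show ?thesis using A(2)[OF that, of n] by linarith
  qed
  with A that show thesis by blast
qed

lemma regen_sums:
  assumes H: "H \<in> C"
  shows "(\<lambda>n. regen n H) sums mass H"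
proof -
  obtain A where A: "A \<ge> 0" "\<And>n. T n H \<le> A * mass H * wt q n"
    using T_tail' H by metis
  have "(\<lambda>n. A * mass H * wt q n) \<longlonglongrightarrow> A * mass H * 0"
    using summable_LIMSEQ_zero[OF summable_wt[OF q(1)]] by (intro tendsto_intros)
  then have "(\<lambda>n. T n H) \<longlonglongrightarrow> 0"
    by (intro tendsto_sandwich[of "\<lambda>_. 0" "\<lambda>n. T n H" _ "\<lambda>n. A * mass H * wt q n"])
       (auto intro!: always_eventually A T_nonneg H)
  then have "(\<lambda>n. T n H - T (Suc n) H) sums (mass H - 0)"
    using telescope_sums' by fastforce
  then have "(\<lambda>n. regen (Suc n) H) sums mass H"
    by (simp add: regen_Suc)
  then show ?thesis using sums_Suc_iff[of "\<lambda>n. regen n H" "mass H"] by simp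
qed

lemma regen_tail_bdd:
  assumes H: "H \<in> C"
  shows "\<exists>A. tail_bdd q A (\<lambda>n. regen n H)"
proof -
  obtain A where A: "A \<ge> 0" "\<And>n. T n H \<le> A * mass H * wt q n"
    using T_tail' H by metis
  have "(\<Sum>j=n..<m. \<bar>regen j H\<bar>) \<le> A * mass H * 2 powr q * wt q n" for n m
  proof -
    have "(\<Sum>j=n..<m. \<bar>regen j H\<bar>) = (\<Sum>j=n..<m. regen j H)"
      using regen_nonneg[OF H] by simp
    also have "\<dots> = (\<Sum>j\<in>{n..<m} - {0}. regen j H)"
      by (rule sum.mono_neutral_right) auto
    also have "\<dots> \<le> (\<Sum>j=Suc (n - 1)..<Suc (max m n). regen j H)"
      using regen_nonneg[OF H] by (intro sum_mono2) auto
    also have "\<dots> = T (n - 1) H - T (max m n) H"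
      by (rule sum_regen) simp
    also have "\<dots> \<le> T (n - 1) H" using T_nonneg[OF H] by simp
    also have "\<dots> \<le> A * mass H * wt q (n - 1)" by (rule A)
    also have "\<dots> \<le> A * mass H * (2 powr q * wt q n)"
      using A(1) q mass_nonneg[OF H] by (intro mult_left_mono wt_scale) (auto simp: of_nat_diff)
    finally show ?thesis by (simp add: mult_ac)
  qed
  then show ?thesis unfolding tail_bdd_def by blast
qed

text \<open>Split at the first regeneration: \<open>W\<close> is what is collected before it, and by
  \<open>ER\<close> the evolution restarts from \<open>one\<close> at each regeneration.\<close>

lemma renewal_decomposition:
  fixes E W D :: "nat \<Rightarrow> 'h \<Rightarrow> real"
  assumes E: "\<And>H n. H \<in> C \<Longrightarrow> E n H = D n H + (\<Sum>i=1..n. E (n - i) (R i H))"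
    and ER: "\<And>H i n. H \<in> C \<Longrightarrow> E n (R i H) = E n (Q i H) + \<delta> * mass (R i H) * E n one"
    and W: "\<And>H n. H \<in> C \<Longrightarrow> W n H = D n H + (\<Sum>i=1..n. W (n - i) (Q i H))"
    and H: "H \<in> C"
  shows "E n H = W n H + (\<Sum>i=1..n. regen i H * E (n - i) one)"
  using H
proof (induction n arbitrary: H rule: less_induct)
  case (less n)
  note H = less.prems
  have "E (n - i) (R i H) = W (n - i) (Q i H) + (\<Sum>j=1..n-i. regen j (Q i H) * E (n - i - j) one)
      + \<delta> * mass (R i H) * E (n - i) one" if "i \<in> {1..n}" for i
    using that less.IH[of "n - i" "Q i H"] H by (simp add: ER Q_closed)
  then have "(\<Sum>i=1..n. E (n - i) (R i H)) = (\<Sum>i=1..n. W (n - i) (Q i H)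
     + (\<Sum>j=1..n-i. regen j (Q i H) * E (n - i - j) one) + \<delta> * mass (R i H) * E (n - i) one)"
    by (intro sum.cong) auto
  also have "\<dots> = (\<Sum>i=1..n. W (n - i) (Q i H)) + (\<Sum>i=1..n. \<Sum>j=1..n-i. regen j (Q i H) * E (n - i - j) one)
     + (\<Sum>i=1..n. \<delta> * mass (R i H) * E (n - i) one)"
    by (simp add: sum.distrib)
  also have "(\<Sum>i=1..n. \<Sum>j=1..n-i. regen j (Q i H) * E (n - i - j) one) =
      (\<Sum>k=1..n. \<Sum>i=1..<k. regen (k - i) (Q i H) * E (n - i - (k - i)) one)"
    by (rule sum_triangle_reindex)
  also have "\<dots> = (\<Sum>k=1..n. (\<Sum>i=1..<k. regen (k - i) (Q i H)) * E (n - k) one)"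
    by (auto simp: sum_distrib_right intro!: sum.cong)
  finally have "E n H = W n H + (\<Sum>k=1..n. ((\<Sum>i=1..<k. regen (k - i) (Q i H)) + \<delta> * mass (R k H)) * E (n - k) one)"
    unfolding E[OF H] W[OF H] by (simp add: distrib_right sum.distrib)
  also have "(\<Sum>k=1..n. ((\<Sum>i=1..<k. regen (k - i) (Q i H)) + \<delta> * mass (R k H)) * E (n - k) one) =
      (\<Sum>k=1..n. regen k H * E (n - k) one)"
  proof (intro sum.cong refl arg_cong2[of _ _ _ _ "(*)"])
    fix k assume "k \<in> {1..n}"
    then obtain k' where "k = Suc k'" by (cases k) auto
    then show "(\<Sum>i=1..<k. regen (k - i) (Q i H)) + \<delta> * mass (R k H) = regen k H"
      by (simp add: regen_rec[OF H] atLeastLessThanSuc_atLeastAtMost)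
  qed
  finally show ?case .
qed

text \<open>The term \<open>D n H\<close> is bounded by the mass returning at the next time, and a
  fraction \<open>\<delta>\<close> of that mass regenerates then. So the recursion of
  \<open>W\<close> is dominated by the one of \<open>regen\<close>, shifted by one and scaled by
  \<open>K / \<delta>\<close>.\<close>

lemma W_le_regen:
  fixes W D :: "nat \<Rightarrow> 'h \<Rightarrow> real"
  assumes W: "\<And>H n. H \<in> C \<Longrightarrow> W n H = D n H + (\<Sum>i=1..n. W (n - i) (Q i H))"
    and D: "\<And>H n. H \<in> C \<Longrightarrow> \<bar>D n H\<bar> \<le> K * mass (R (Suc n) H)"
    and H: "H \<in> C"
  shows "\<bar>W n H\<bar> \<le> K / \<delta> * regen (Suc n) H"
  using H
proof (induction n arbitrary: H rule: less_induct)
  case (less n)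
  note H = less.prems
  have "\<bar>W n H\<bar> \<le> \<bar>D n H\<bar> + (\<Sum>i=1..n. \<bar>W (n - i) (Q i H)\<bar>)"
    unfolding W[OF H] by (intro order.trans[OF abs_triangle_ineq] add_mono sum_abs order.refl)
  also have "\<dots> \<le> K * mass (R (Suc n) H) + (\<Sum>i=1..n. K / \<delta> * regen (Suc (n - i)) (Q i H))"
    using H by (intro add_mono D sum_mono less.IH Q_closed) auto
  also have "(\<Sum>i=1..n. K / \<delta> * regen (Suc (n - i)) (Q i H)) = K / \<delta> * (\<Sum>i=1..n. regen (Suc n - i) (Q i H))"
    unfolding sum_distrib_left by (intro sum.cong) (auto simp: Suc_diff_le)
  also have "K * mass (R (Suc n) H) + \<dots> = K / \<delta> * regen (Suc n) H"
    unfolding regen_rec[OF H] using \<delta> by (simp add: field_simps)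
  finally show ?case .
qed

lemma W_tail_bdd:
  fixes W D :: "nat \<Rightarrow> 'h \<Rightarrow> real"
  assumes W: "\<And>H n. H \<in> C \<Longrightarrow> W n H = D n H + (\<Sum>i=1..n. W (n - i) (Q i H))"
    and D: "\<And>H n. H \<in> C \<Longrightarrow> \<bar>D n H\<bar> \<le> K * mass (R (Suc n) H)"
    and H: "H \<in> C"
  shows "\<exists>A. tail_bdd q A (\<lambda>n. W n H)"
proof -
  obtain A where A: "A \<ge> 0" "\<And>n. T n H \<le> A * mass H * wt q n"
    using T_tail' H by metis
  have "\<bar>D 0 one\<bar> \<le> K * mass (R 1 one)" using D[OF one(1), of 0] by simp
  then have K: "K \<ge> 0" using R_one by (metis abs_ge_zero order.trans zero_le_mult_iff not_less)
  have "(\<Sum>j=n..<m. \<bar>W j H\<bar>) \<le> K / \<delta> * (A * mass H) * wt q n" for n m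
  proof (cases "n \<le> m")
    case True
    have "(\<Sum>j=n..<m. \<bar>W j H\<bar>) \<le> (\<Sum>j=n..<m. K / \<delta> * regen (Suc j) H)"
      by (intro sum_mono W_le_regen[OF W D H])
    also have "\<dots> = K / \<delta> * (\<Sum>j=Suc n..<Suc m. regen j H)"
      by (simp add: sum_distrib_left sum.shift_bounds_Suc_ivl del: sum.op_ivl_Suc)
    also have "\<dots> = K / \<delta> * (T n H - T m H)"
      by (simp only: sum_regen[OF True])
    also have "\<dots> \<le> K / \<delta> * (A * mass H * wt q n)"
      using A(2)[of n] T_nonneg[OF H, of m] K \<delta> by (intro mult_left_mono) auto
    finally show ?thesis by (simp add: mult_ac)
  next
    case False
    then show ?thesis using K \<delta> A mass_nonneg[OF H] by simp
  qed
  then show ?thesis unfolding tail_bdd_def by blast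
qed

text \<open>The scalar renewal process has waiting time tail \<open>T n one\<close>, delay
  distribution \<open>regen i H\<close> and forcing \<open>W n one\<close>. It is aperiodic because
  \<open>R_one\<close> gives \<open>T 1 one < 1\<close>.\<close>

theorem regeneration_estimate:
  fixes E W D :: "nat \<Rightarrow> 'h \<Rightarrow> real"
  assumes E: "\<And>H n. H \<in> C \<Longrightarrow> E n H = D n H + (\<Sum>i=1..n. E (n - i) (R i H))"
    and ER: "\<And>H i n. H \<in> C \<Longrightarrow> E n (R i H) = E n (Q i H) + \<delta> * mass (R i H) * E n one"
    and W: "\<And>H n. H \<in> C \<Longrightarrow> W n H = D n H + (\<Sum>i=1..n. W (n - i) (Q i H))"
    and D: "\<And>H n. H \<in> C \<Longrightarrow> \<bar>D n H\<bar> \<le> K * mass (R (Suc n) H)"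
    and H: "H \<in> C"
  shows "\<exists>A. \<forall>n. \<bar>E n H - mass H * (\<Sum>n. W n one) * (1 / (\<Sum>k\<le>n. T k one))\<bar> \<le> A * renewal_err q n"
proof -
  obtain A where A: "A \<ge> 0" "\<And>n. T n one \<le> A * mass one * wt q0 n"
    using T_tail' one(1) by metis
  obtain A1 where A1: "tail_bdd q A1 (\<lambda>n. W n one)"
    using W_tail_bdd[OF W D one(1)] by blast
  obtain A2 where A2: "tail_bdd q A2 (\<lambda>n. W n H)"
    using W_tail_bdd[OF W D H] by blast
  obtain A3 where A3: "tail_bdd q A3 (\<lambda>n. regen n H)"
    using regen_tail_bdd[OF H] by blast
  show ?thesis
  proof (rule renewal_equation_estimate)
    show "decseq (\<lambda>n. T n one)"
      using regen_nonneg[OF one(1), of "Suc n" for n] by (simp add: decseq_Suc_iff regen_Suc)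
    show "T 1 one < 1"
      using regen_rec[OF one(1), of 0] mult_pos_pos[OF \<delta>(1) R_one] one by (simp add: regen_Suc)
    show "T 0 one = 1" using one by simp
    show "1 < q" "q < q0" by (rule q)+
    show "0 \<le> T n one" for n by (rule T_nonneg[OF one(1)])
    show "T n one \<le> (A * mass one) * wt q0 n" for n by (rule A(2))
    show "tail_bdd q A1 (\<lambda>n. W n one)" by (rule A1)
    show "(\<lambda>n. W n one) sums (\<Sum>n. W n one)"
      using summable_rabs_cancel[OF tail_bdd_summable[OF A1]] by (rule summable_sums)
    show "E n one = W n one + (\<Sum>i=1..n. (T (i - 1) one - T i one) * E (n - i) one)" for n
      by (rule trans[OF renewal_decomposition[OF E ER W one(1)]]) (auto intro!: sum.cong simp: regen_def)
    show "tail_bdd q A3 (\<lambda>n. regen n H)" by (rule A3)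
    show "(\<lambda>n. regen n H) sums mass H" by (rule regen_sums[OF H])
    show "\<bar>W n H\<bar> \<le> A2 * wt q n" for n using A2 by (rule tail_bdd_abs_le)
    show "E n H = W n H + (\<Sum>i=1..n. regen i H * E (n - i) one)" for n
      by (rule renewal_decomposition[OF E ER W H])
  qed simp
qed

end

subsection \<open>Integration over symbol sequences and the unit interval\<close>

text \<open>Bounded at every point of the space and not only almost everywhere, so that the class is
  stable under composition with measurable maps and integrable for every probability
  measure.\<close>

definition bmeas :: "'a measure \<Rightarrow> ('a \<Rightarrow> real) \<Rightarrow> bool" where
  "bmeas M \<Phi> \<longleftrightarrow> \<Phi> \<in> borel_measurable M \<and> (\<exists>c. \<forall>z\<in>space M. \<bar>\<Phi> z\<bar> \<le> c)"

lemma bmeasI: "\<Phi> \<in> borel_measurable M \<Longrightarrow> (\<And>z. z \<in> space M \<Longrightarrow> \<bar>\<Phi> z\<bar> \<le> c) \<Longrightarrow> bmeas M \<Phi>"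
  by (auto simp: bmeas_def)

lemma bmeas_measurable: "bmeas M \<Phi> \<Longrightarrow> \<Phi> \<in> borel_measurable M"
  by (simp add: bmeas_def)

lemma bmeasE:
  assumes "bmeas M \<Phi>"
  obtains c where "c \<ge> 0" "\<And>z. z \<in> space M \<Longrightarrow> \<bar>\<Phi> z\<bar> \<le> c" "\<Phi> \<in> borel_measurable M"
proof -
  obtain c where c: "\<And>z. z \<in> space M \<Longrightarrow> \<bar>\<Phi> z\<bar> \<le> c" "\<Phi> \<in> borel_measurable M"
    using assms by (auto simp: bmeas_def)
  then show ?thesis using that[of "max c 0"] by (simp add: le_max_iff_disj)
qed

lemma bmeas_const [simp, intro]: "bmeas M (\<lambda>_. c)"
  by (rule bmeasI[where c = "\<bar>c\<bar>"]) auto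

lemma bmeas_add [intro]:
  assumes "bmeas M f" "bmeas M g" shows "bmeas M (\<lambda>x. f x + g x)"
proof -
  from assms obtain c d where "\<And>z. z \<in> space M \<Longrightarrow> \<bar>f z\<bar> \<le> c" "\<And>z. z \<in> space M \<Longrightarrow> \<bar>g z\<bar> \<le> d"
    by (auto simp: bmeas_def)
  then show ?thesis
    using bmeas_measurable[OF assms(1)] bmeas_measurable[OF assms(2)]
    by (intro bmeasI[where c = "c + d"] order.trans[OF abs_triangle_ineq] add_mono borel_measurable_add)
qed

lemma bmeas_mult [intro]:
  assumes "bmeas M f" "bmeas M g" shows "bmeas M (\<lambda>x. f x * g x)"
proof -
  from assms obtain c d where *: "c \<ge> 0" "\<And>z. z \<in> space M \<Longrightarrow> \<bar>f z\<bar> \<le> c" "\<And>z. z \<in> space M \<Longrightarrow> \<bar>g z\<bar> \<le> d"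
    by (metis bmeasE)
  show ?thesis
    using bmeas_measurable[OF assms(1)] bmeas_measurable[OF assms(2)] *
    by (intro bmeasI[where c = "c * d"] borel_measurable_times) (auto simp: abs_mult intro!: mult_mono)
qed

lemma bmeas_cmult [intro]: "bmeas M f \<Longrightarrow> bmeas M (\<lambda>x. c * f x)"
  by (rule bmeas_mult) auto

lemma bmeas_diff [intro]: "bmeas M f \<Longrightarrow> bmeas M g \<Longrightarrow> bmeas M (\<lambda>x. f x - g x)"
  using bmeas_add[of M f "\<lambda>x. -1 * g x"] bmeas_cmult[of M g "-1"] by simp

lemma bmeas_sum [intro]: "(\<And>i. i \<in> I \<Longrightarrow> bmeas M (f i)) \<Longrightarrow> bmeas M (\<lambda>x. \<Sum>i\<in>I. f i x)"
  by (induction I rule: infinite_finite_induct) auto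

lemma bmeas_comp:
  assumes "bmeas M f" "g \<in> measurable L M" shows "bmeas L (\<lambda>x. f (g x))"
proof -
  from assms(1) obtain c where "\<And>z. z \<in> space M \<Longrightarrow> \<bar>f z\<bar> \<le> c" by (auto simp: bmeas_def)
  then show ?thesis
    using measurable_compose[OF assms(2) bmeas_measurable[OF assms(1)]] measurable_space[OF assms(2)]
    by (intro bmeasI[where c = c]) auto
qed

lemma (in prob_space) bmeas_integrable: "bmeas M f \<Longrightarrow> integrable M f"
  by (erule bmeasE, rule integrable_const_bound) auto

lemma bmeas_integrable: "prob_space M \<Longrightarrow> bmeas M f \<Longrightarrow> integrable M f"
  by (rule prob_space.bmeas_integrable)

text \<open>The open interval keeps \<open>u powr s\<close> and both inverse branches strictly
  between \<open>0\<close> and \<open>1\<close>, where \<open>powr\<close> and \<open>ln\<close>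
  behave.\<close>

definition U :: "real measure" where
  "U = restrict_space lborel {0<..<1}"

lemma space_U [simp]: "space U = {0<..<1}"
  by (simp add: U_def space_restrict_space)

lemma sets_U: "sets U = sets (restrict_space borel {0<..<1::real})"
  unfolding U_def by (rule sets_restrict_space_cong) simp

lemma measurable_U1 [measurable_dest]: "f \<in> borel_measurable borel \<Longrightarrow> f \<in> borel_measurable U"
  by (simp add: U_def measurable_restrict_space1)

lemma measurable_to_U:
  "f \<in> borel_measurable M \<Longrightarrow> (\<And>x. x \<in> space M \<Longrightarrow> f x \<in> {0<..<1}) \<Longrightarrow> f \<in> measurable M U"
  unfolding U_def by (intro measurable_restrict_space2) auto

lemma measurable_id_U_borel [measurable]: "(\<lambda>x. x) \<in> borel_measurable U"
  by (rule measurable_U1) simp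

interpretation U: prob_space U
  unfolding U_def by (rule prob_space_restrict_space) auto

lemma U_integral:
  fixes g :: "real \<Rightarrow> real"
  assumes "g \<in> borel_measurable U"
  shows "(\<integral>x. g x \<partial>U) = (\<integral>x. indicator {0<..<1} x * g x \<partial>lborel)"
  unfolding U_def by (subst Bochner_Integration.integral_restrict_space) auto

lemma U_extend_measurable:
  fixes g :: "real \<Rightarrow> real"
  assumes "g \<in> borel_measurable U"
  shows "(\<lambda>x. indicator {0<..<1} x * g x) \<in> borel_measurable borel"
  using assms borel_measurable_restrict_space_iff[of "{0<..<1}" lborel g] by (simp add: U_def)

text \<open>For \<open>V = u powr s\<close>, these are the inverse branches of \<open>u \<mapsto> 2 * V\<close> on \<open>V < 1/2\<close>, rescaled so that
  \<open>2 * V\<close> is again an \<open>s\<close>-th power, and of \<open>u \<mapsto> 2 * V - 1\<close> on \<open>V > 1/2\<close>, the latter with its Jacobian.\<close>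

definition lower_half :: "real \<Rightarrow> real \<Rightarrow> real" where "lower_half s u = 2 powr (- 1 / s) * u"
definition upper_half :: "real \<Rightarrow> real \<Rightarrow> real" where "upper_half s u = ((1 + u) / 2) powr (1 / s)"
definition upper_jac :: "real \<Rightarrow> real \<Rightarrow> real" where "upper_jac s u = 1 / (2 * s) * ((1 + u) / 2) powr (1 / s - 1)"

lemma two_powr_neg_bounds:
  assumes "s \<ge> 1" shows "0 < 2 powr (- 1 / s)" "2 powr (- 1 / s) < (1::real)"
  using assms by (auto intro!: powr_less_one)

lemma lower_half_range:
  assumes "s \<ge> 1" "u \<in> {0<..<1}" shows "lower_half s u \<in> {0<..<1}"
proof -
  have "2 powr (- 1 / s) * u < 1 * 1"
    using two_powr_neg_bounds[OF assms(1)] assms(2) by (intro mult_strict_mono) auto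
  then show ?thesis using two_powr_neg_bounds[OF assms(1)] assms(2) by (simp add: lower_half_def)
qed

lemma upper_half_range: "s \<ge> 1 \<Longrightarrow> u \<in> {0<..<1} \<Longrightarrow> upper_half s u \<in> {0<..<1}"
  using powr_less_mono2[of "1 / s" "(1 + u) / 2" 1] by (auto simp: upper_half_def)

lemma lower_half_powr: "s \<ge> 1 \<Longrightarrow> u \<in> {0<..<1} \<Longrightarrow> lower_half s u powr s = u powr s / 2"
  by (simp add: lower_half_def powr_mult powr_powr)

lemma upper_half_powr: "s \<ge> 1 \<Longrightarrow> u \<in> {0<..<1} \<Longrightarrow> upper_half s u powr s = (1 + u) / 2"
  by (simp add: upper_half_def powr_powr)

lemma upper_jac_bounds:
  assumes "s \<ge> 1" "u \<in> {0<..<1}" shows "0 < upper_jac s u" "upper_jac s u \<le> 1"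
proof -
  show "0 < upper_jac s u" using assms by (auto simp: upper_jac_def intro!: mult_pos_pos)
  have "((1 + u) / 2) powr (1 / s - 1) \<le> (1 / 2) powr (1 / s - 1)"
    using assms by (intro powr_mono2') auto
  also have "\<dots> = 2 powr (1 - 1 / s)"
    by (simp add: powr_divide powr_diff powr_minus field_simps)
  also have "\<dots> \<le> 2 powr 1"
    using assms by (intro powr_mono) auto
  finally have "1 / (2 * s) * ((1 + u) / 2) powr (1 / s - 1) \<le> 1 / (2 * s) * 2"
    using assms by (intro mult_left_mono) auto
  also have "\<dots> \<le> 1" using assms by simp
  finally show "upper_jac s u \<le> 1" by (simp add: upper_jac_def)
qed

lemma lower_half_measurable: "s \<ge> 1 \<Longrightarrow> lower_half s \<in> measurable U U"
  using lower_half_range by (intro measurable_to_U measurable_U1) (auto simp: lower_half_def[abs_def])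

lemma upper_half_measurable: "s \<ge> 1 \<Longrightarrow> upper_half s \<in> measurable U U"
  using upper_half_range by (intro measurable_to_U measurable_U1) (auto simp: upper_half_def[abs_def])

lemma upper_jac_bmeas:
  assumes "s \<ge> 1" shows "bmeas U (upper_jac s)"
proof (rule bmeasI)
  show "upper_jac s \<in> borel_measurable U"
    by (rule measurable_U1) (simp add: upper_jac_def[abs_def])
  show "\<bar>upper_jac s u\<bar> \<le> 1" if "u \<in> space U" for u
    using upper_jac_bounds[OF assms, of u] that by simp
qed

text \<open>Cut at \<open>c = 2 powr (- 1 / s)\<close>, the point where
  \<open>u powr s = 1 / 2\<close>, and substitute the linear branch below and
  \<open>upper_half s\<close> above. The substitutions run over closed intervals, whose end points
  are null sets.\<close>

lemma U_change_of_variables: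
  assumes s: "s \<ge> 1" and g: "bmeas U g"
  shows "(\<integral>u. g u \<partial>U) = (\<integral>u. 2 powr (- 1 / s) * g (lower_half s u) \<partial>U) + (\<integral>u. g (upper_half s u) * upper_jac s u \<partial>U)"
proof -
  define c where "c = (2::real) powr (- 1 / s)"
  have c: "0 < c" "c < 1" using two_powr_neg_bounds[OF s] by (auto simp: c_def)
  define f where "f x = indicator {0<..<1} x * g x" for x
  have fm [measurable]: "f \<in> borel_measurable borel"
    unfolding f_def by (rule U_extend_measurable[OF bmeas_measurable[OF g]])
  obtain B where B: "B \<ge> 0" "\<And>u. u \<in> {0<..<1} \<Longrightarrow> \<bar>g u\<bar> \<le> B"
    using g by (auto elim: bmeasE)
  have fB: "\<bar>f x\<bar> \<le> B" for x using B by (auto simp: f_def indicator_def)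
  have si: "set_integrable lborel {a..b} f" for a b
    unfolding set_integrable_def
    by (rule integrableI_bounded_set_indicator[where B = B]) (auto simp: fB emeasure_lborel_Icc_eq)
  have fint: "(\<integral>u. h u \<partial>U) = (\<integral>x. h x * indicator {0..1} x \<partial>lborel)"
    if "h \<in> borel_measurable U" "(\<lambda>x. h x * indicator {0..1} x) \<in> borel_measurable borel" for h :: "real \<Rightarrow> real"
  proof -
    have "AE x in lborel. x \<noteq> (0::real) \<and> x \<noteq> 1"
      using AE_lborel_singleton[of "0::real"] AE_lborel_singleton[of "1::real"] by eventually_elim auto
    then have "AE x in lborel. indicator {0<..<1} x * h x = h x * indicator {0..1} x"
      by eventually_elim (auto simp: indicator_def)
    then show ?thesis
      unfolding U_integral[OF that(1)] using U_extend_measurable[OF that(1)] that(2)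
      by (intro integral_cong_AE) auto
  qed
  have 1: "(LBINT x. f x * indicator {0..c} x) = (LBINT x. f (c * x) * c * indicator {0..1} x)"
    using integral_substitution(2)[of "\<lambda>x. c * x" 0 1 f "\<lambda>_. c"] si c
    by (auto intro!: derivative_eq_intros)
  have d: "(upper_half s has_real_derivative upper_jac s x) (at x)" if "x \<in> {0..1}" for x
    unfolding upper_half_def[abs_def] upper_jac_def using that s
    by (auto intro!: derivative_eq_intros simp: field_simps)
  have cont: "continuous_on {0..1} (upper_jac s)"
    unfolding upper_jac_def[abs_def] by (intro continuous_intros) auto
  have jw0: "upper_jac s x \<ge> 0" if "x \<in> {0..1}" for x
    using that s by (simp add: upper_jac_def)
  have je: "upper_half s 0 = c" "upper_half s 1 = 1"
    by (auto simp: upper_half_def c_def powr_divide powr_minus field_simps)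
  have 2: "(LBINT x. f x * indicator {c..1} x) = (LBINT x. f (upper_half s x) * upper_jac s x * indicator {0..1} x)"
    using integral_substitution(2)[of "upper_half s" 0 1 f "upper_jac s"] si d cont jw0 by (simp add: je)
  have "(\<integral>u. g u \<partial>U) = (LBINT x. f x * indicator {0..1} x)"
  proof -
    have "(\<integral>u. g u \<partial>U) = (LBINT x. f x)"
      unfolding U_integral[OF bmeas_measurable[OF g]] f_def ..
    also have "\<dots> = (LBINT x. f x * indicator {0..1} x)"
      by (intro Bochner_Integration.integral_cong) (auto simp: f_def indicator_def)
    finally show ?thesis .
  qed
  also have "\<dots> = (LBINT x. f x * indicator {0..c} x + f x * indicator {c..1} x)"
  proof (rule integral_cong_AE)
    show "AE x in lborel. f x * indicator {0..1} x = f x * indicator {0..c} x + f x * indicator {c..1} x"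
      using AE_lborel_singleton[of c] by eventually_elim (use c in \<open>auto simp: indicator_def\<close>)
  qed auto
  also have "\<dots> = (LBINT x. f x * indicator {0..c} x) + (LBINT x. f x * indicator {c..1} x)"
    using si[of 0 c] si[of c 1] unfolding set_integrable_def
    by (intro Bochner_Integration.integral_add) (auto simp: mult.commute)
  also note 1
  also have "(LBINT x. f (c * x) * c * indicator {0..1} x) = (\<integral>u. f (c * u) * c \<partial>U)"
    by (rule fint[symmetric]) (auto intro: measurable_U1)
  also have "\<dots> = (\<integral>u. c * g (lower_half s u) \<partial>U)"
    using lower_half_range[OF s] by (intro Bochner_Integration.integral_cong) (auto simp: f_def lower_half_def c_def mult.commute)
  also note 2
  also have "(LBINT x. f (upper_half s x) * upper_jac s x * indicator {0..1} x) = (\<integral>u. f (upper_half s u) * upper_jac s u \<partial>U)"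
    unfolding upper_half_def upper_jac_def by (rule fint[symmetric]) (auto intro: measurable_U1)
  also have "\<dots> = (\<integral>u. g (upper_half s u) * upper_jac s u \<partial>U)"
    using upper_half_range[OF s] by (intro Bochner_Integration.integral_cong) (auto simp: f_def)
  finally show ?thesis by (simp add: c_def)
qed

section \<open>Bernoulli sequences and conditioning on the first letter\<close>

locale letters =
  fixes N :: nat and p :: "nat \<Rightarrow> real"
  assumes p_pos: "\<And>j. j \<in> {1..N} \<Longrightarrow> p j > 0" and p_sum: "(\<Sum>j\<in>{1..N}. p j) = 1"
begin

abbreviation "P1 \<equiv> point_measure {1..N} (\<lambda>j. ennreal (p j))"
abbreviation "BM \<equiv> bernoulli_measure N p"
abbreviation "SU \<equiv> BM \<Otimes>\<^sub>M U"

lemma prob_space_P1: "prob_space P1"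
proof (rule prob_space_point_measure)
  have "(\<Sum>j\<in>{1..N}. ennreal (p j)) = ennreal (\<Sum>j\<in>{1..N}. p j)"
    using p_pos by (intro sum_ennreal) (auto intro: less_imp_le)
  then show "(\<Sum>j\<in>{1..N}. ennreal (p j)) = 1" by (simp only: p_sum ennreal_1)
qed auto

sublocale seq: sequence_space P1
proof -
  interpret prob_space P1 by (rule prob_space_P1)
  show "sequence_space P1" by unfold_locales
qed

lemma BM_eq: "BM = seq.S" by (simp add: bernoulli_measure_def)

lemma prob_space_BM: "prob_space BM"
  unfolding BM_eq by (rule seq.P.prob_space_axioms)

lemma space_BM: "space BM = (UNIV \<rightarrow> {1..N})"
  by (auto simp: BM_eq space_PiM space_point_measure PiE_def extensional_def)

lemma prob_space_pair: "prob_space X \<Longrightarrow> prob_space (BM \<Otimes>\<^sub>M X)"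
  using prob_space_BM by (rule prob_space_pair)

lemma prob_space_SU: "prob_space SU"
  by (rule prob_space_pair) unfold_locales

lemma case_nat_measurable: "j \<in> {1..N} \<Longrightarrow> case_nat j \<in> measurable BM BM"
  unfolding BM_eq by (rule measurable_case_nat') (auto simp: space_point_measure)

lemma pre_measurable:
  "j \<in> {1..N} \<Longrightarrow> (\<lambda>z. (case_nat j (fst z), snd z)) \<in> measurable (BM \<Otimes>\<^sub>M X) (BM \<Otimes>\<^sub>M X)"
  by (intro measurable_Pair measurable_compose[OF measurable_fst case_nat_measurable] measurable_snd)

text \<open>\<open>BM\<close> is the image of \<open>P1 \<Otimes>\<^sub>M BM\<close> under
  prepending a letter; Fubini reduces the claim to this for fixed \<open>x\<close>.\<close>

lemma shift_integral:
  assumes X: "prob_space X" and \<Phi>: "bmeas (BM \<Otimes>\<^sub>M X) \<Phi>"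
  shows "(\<integral>z. \<Phi> z \<partial>(BM \<Otimes>\<^sub>M X)) = (\<Sum>j\<in>{1..N}. p j * (\<integral>z. \<Phi> (case_nat j (fst z), snd z) \<partial>(BM \<Otimes>\<^sub>M X)))"
proof -
  interpret X: prob_space X by fact
  interpret BM: prob_space BM by (rule prob_space_BM)
  interpret P1: prob_space P1 by (rule prob_space_P1)
  interpret BX: pair_prob_space BM X ..
  interpret PB: pair_prob_space P1 BM ..
  have int\<Phi>: "integrable (BM \<Otimes>\<^sub>M X) \<Phi>"
    using \<Phi> by (rule bmeas_integrable[OF BX.prob_space_axioms])
  have cn: "(\<lambda>(s, \<omega>). case_nat s \<omega>) \<in> measurable (P1 \<Otimes>\<^sub>M BM) BM"
    unfolding BM_eq by measurable
  have b: "bmeas (BM \<Otimes>\<^sub>M X) (\<lambda>z. \<Phi> (case_nat j (fst z), snd z))" if "j \<in> {1..N}" for j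
    by (rule bmeas_comp[OF \<Phi> pre_measurable[OF that]])
  have bx: "bmeas BM (\<lambda>\<omega>. \<Phi> (\<omega>, x))" if "x \<in> space X" for x
    using that by (intro bmeas_comp[OF \<Phi>]) measurable
  have one: "(\<integral>\<omega>. \<Phi> (\<omega>, x) \<partial>BM) = (\<Sum>j\<in>{1..N}. p j * (\<integral>\<omega>. \<Phi> (case_nat j \<omega>, x) \<partial>BM))"
    if x: "x \<in> space X" for x
  proof -
    have "(\<integral>\<omega>. \<Phi> (\<omega>, x) \<partial>BM) = (\<integral>\<omega>. \<Phi> (\<omega>, x) \<partial>distr (P1 \<Otimes>\<^sub>M BM) BM (\<lambda>(s, \<omega>). case_nat s \<omega>))"
      using seq.PiM_iter by (simp add: BM_eq)
    also have "\<dots> = (\<integral>(s, \<omega>). \<Phi> (case_nat s \<omega>, x) \<partial>(P1 \<Otimes>\<^sub>M BM))"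
      by (subst integral_distr[OF cn bmeas_measurable[OF bx[OF x]]]) (simp add: case_prod_unfold)
    also have "\<dots> = (\<integral>s. (\<integral>\<omega>. \<Phi> (case_nat s \<omega>, x) \<partial>BM) \<partial>P1)"
    proof -
      have "bmeas (P1 \<Otimes>\<^sub>M BM) (\<lambda>z. \<Phi> ((\<lambda>(s, \<omega>). case_nat s \<omega>) z, x))"
        by (rule bmeas_comp[OF bx[OF x] cn])
      then have "integrable (P1 \<Otimes>\<^sub>M BM) (\<lambda>(s, \<omega>). \<Phi> (case_nat s \<omega>, x))"
        using bmeas_integrable[OF PB.prob_space_axioms] by (simp add: case_prod_unfold)
      from PB.integral_fst'[OF this] show ?thesis by simp
    qed
    also have "\<dots> = (\<Sum>j\<in>{1..N}. p j * (\<integral>\<omega>. \<Phi> (case_nat j \<omega>, x) \<partial>BM))"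
      using p_pos by (subst lebesgue_integral_point_measure_finite) (auto simp: less_imp_le)
    finally show ?thesis .
  qed
  have "(\<integral>z. \<Phi> z \<partial>(BM \<Otimes>\<^sub>M X)) = (\<integral>x. (\<integral>\<omega>. \<Phi> (\<omega>, x) \<partial>BM) \<partial>X)"
    using BX.integral_snd[of "\<lambda>\<omega> x. \<Phi> (\<omega>, x)"] int\<Phi> by simp
  also have "\<dots> = (\<integral>x. (\<Sum>j\<in>{1..N}. p j * (\<integral>\<omega>. \<Phi> (case_nat j \<omega>, x) \<partial>BM)) \<partial>X)"
    by (intro Bochner_Integration.integral_cong one) auto
  also have "\<dots> = (\<Sum>j\<in>{1..N}. (\<integral>x. p j * (\<integral>\<omega>. \<Phi> (case_nat j \<omega>, x) \<partial>BM) \<partial>X))"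
  proof (rule Bochner_Integration.integral_sum)
    fix j assume "j \<in> {1..N}"
    then show "integrable X (\<lambda>x. p j * (\<integral>\<omega>. \<Phi> (case_nat j \<omega>, x) \<partial>BM))"
      using BX.integrable_snd[of "\<lambda>\<omega> x. \<Phi> (case_nat j \<omega>, x)"] bmeas_integrable[OF BX.prob_space_axioms b]
      by (simp add: case_prod_unfold)
  qed
  also have "\<dots> = (\<Sum>j\<in>{1..N}. p j * (\<integral>z. \<Phi> (case_nat j (fst z), snd z) \<partial>(BM \<Otimes>\<^sub>M X)))"
  proof (rule sum.cong[OF refl])
    fix j assume "j \<in> {1..N}"
    then have "(\<integral>x. (\<integral>\<omega>. \<Phi> (case_nat j \<omega>, x) \<partial>BM) \<partial>X) = (\<integral>z. \<Phi> (case_nat j (fst z), snd z) \<partial>(BM \<Otimes>\<^sub>M X))"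
      using BX.integral_snd[of "\<lambda>\<omega> x. \<Phi> (case_nat j \<omega>, x)"] bmeas_integrable[OF BX.prob_space_axioms b]
      by (simp add: case_prod_unfold)
    then show "(\<integral>x. p j * (\<integral>\<omega>. \<Phi> (case_nat j \<omega>, x) \<partial>BM) \<partial>X) = p j * (\<integral>z. \<Phi> (case_nat j (fst z), snd z) \<partial>(BM \<Otimes>\<^sub>M X))"
      by simp
  qed
  finally show ?thesis .
qed

lemma change_of_variables:
  assumes s: "s \<ge> 1" and \<Phi>: "bmeas SU \<Phi>"
  shows "(\<integral>z. \<Phi> z \<partial>SU) = (\<integral>z. 2 powr (- 1 / s) * \<Phi> (fst z, lower_half s (snd z)) \<partial>SU)
     + (\<integral>z. \<Phi> (fst z, upper_half s (snd z)) * upper_jac s (snd z) \<partial>SU)"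
proof -
  interpret BM: prob_space BM by (rule prob_space_BM)
  interpret BX: pair_prob_space BM U ..
  note lower_half_measurable[OF s, measurable] upper_half_measurable[OF s, measurable]
  have fub: "(\<integral>z. \<Psi> z \<partial>SU) = (\<integral>\<omega>. (\<integral>u. \<Psi> (\<omega>, u) \<partial>U) \<partial>BM)" "integrable BM (\<lambda>\<omega>. (\<integral>u. \<Psi> (\<omega>, u) \<partial>U))"
    if "bmeas SU \<Psi>" for \<Psi>
    using BX.integral_fst'[of \<Psi>] BX.integrable_fst'[of \<Psi>] bmeas_integrable[OF prob_space_SU that] by auto
  have b1: "bmeas SU (\<lambda>z. 2 powr (- 1 / s) * \<Phi> (fst z, lower_half s (snd z)))"
    by (intro bmeas_cmult bmeas_comp[OF \<Phi>]) measurable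
  have b2: "bmeas SU (\<lambda>z. \<Phi> (fst z, upper_half s (snd z)) * upper_jac s (snd z))"
    by (intro bmeas_mult bmeas_comp[OF \<Phi>] bmeas_comp[OF upper_jac_bmeas[OF s]]) measurable
  have "(\<integral>z. \<Phi> z \<partial>SU) = (\<integral>\<omega>. (\<integral>u. \<Phi> (\<omega>, u) \<partial>U) \<partial>BM)"
    by (rule fub(1)[OF \<Phi>])
  also have "\<dots> = (\<integral>\<omega>. (\<integral>u. 2 powr (- 1 / s) * \<Phi> (\<omega>, lower_half s u) \<partial>U) + (\<integral>u. \<Phi> (\<omega>, upper_half s u) * upper_jac s u \<partial>U) \<partial>BM)"
    by (intro Bochner_Integration.integral_cong refl U_change_of_variables s bmeas_comp[OF \<Phi>]) measurable
  also have "\<dots> = (\<integral>\<omega>. (\<integral>u. 2 powr (- 1 / s) * \<Phi> (\<omega>, lower_half s u) \<partial>U) \<partial>BM) + (\<integral>\<omega>. (\<integral>u. \<Phi> (\<omega>, upper_half s u) * upper_jac s u \<partial>U) \<partial>BM)"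
    using fub(2)[OF b1] fub(2)[OF b2] by (intro Bochner_Integration.integral_add) auto
  finally show ?thesis using fub(1)[OF b1] fub(1)[OF b2] by simp
qed

end

subsection \<open>Excursions from the left half\<close>

context letters
begin

definition pre :: "nat \<Rightarrow> ((nat \<Rightarrow> nat) \<times> real \<Rightarrow> real) \<Rightarrow> (nat \<Rightarrow> nat) \<times> real \<Rightarrow> real" where
  "pre j H = (\<lambda>z. H (case_nat j (fst z), snd z))"

text \<open>\<open>K s\<close> and \<open>J s\<close> are the transfer operators of the lower and
  the upper branch; \<open>2 powr (- 1 / s)\<close> is the Jacobian of
  \<open>lower_half s\<close>.\<close>

definition K :: "real \<Rightarrow> ((nat \<Rightarrow> nat) \<times> real \<Rightarrow> real) \<Rightarrow> (nat \<Rightarrow> nat) \<times> real \<Rightarrow> real" where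
  "K s H = (\<lambda>z. 2 powr (- 1 / s) * H (fst z, lower_half s (snd z)))"

definition J :: "real \<Rightarrow> ((nat \<Rightarrow> nat) \<times> real \<Rightarrow> real) \<Rightarrow> (nat \<Rightarrow> nat) \<times> real \<Rightarrow> real" where
  "J s H = (\<lambda>z. H (fst z, upper_half s (snd z)) * upper_jac s (snd z))"

definition Nn :: "((nat \<Rightarrow> nat) \<times> real \<Rightarrow> real) \<Rightarrow> (nat \<Rightarrow> nat) \<times> real \<Rightarrow> real" where
  "Nn H = (\<lambda>z. \<Sum>j\<in>{1..N}. p j * pre j H z)"

text \<open>One step inside the right half, where all maps agree: the letter used is averaged out
  and only the doubling is left.\<close>

definition KN :: "real \<Rightarrow> ((nat \<Rightarrow> nat) \<times> real \<Rightarrow> real) \<Rightarrow> (nat \<Rightarrow> nat) \<times> real \<Rightarrow> real" where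
  "KN s H = Nn (K s H)"

definition I :: "((nat \<Rightarrow> nat) \<times> real \<Rightarrow> real) \<Rightarrow> real" where
  "I H = (\<integral>z. H z \<partial>SU)"

lemma space_SU: "space SU = (UNIV \<rightarrow> {1..N}) \<times> {0<..<1}"
  by (simp add: space_pair_measure space_BM)

lemma case_nat_space: "j \<in> {1..N} \<Longrightarrow> \<omega> \<in> UNIV \<rightarrow> {1..N} \<Longrightarrow> case_nat j \<omega> \<in> UNIV \<rightarrow> {1..N}"
  by (auto split: nat.split simp: Pi_iff)

lemma snd_map_measurable:
  "g \<in> measurable U X \<Longrightarrow> (\<lambda>z. (fst z, g (snd z))) \<in> measurable SU (BM \<Otimes>\<^sub>M X)"
  by (intro measurable_Pair measurable_fst measurable_compose[OF measurable_snd])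

lemma lower_half_map: "s \<ge> 1 \<Longrightarrow> (\<lambda>z. (fst z, lower_half s (snd z))) \<in> measurable SU SU"
  by (rule snd_map_measurable[OF lower_half_measurable])

lemma upper_half_map: "s \<ge> 1 \<Longrightarrow> (\<lambda>z. (fst z, upper_half s (snd z))) \<in> measurable SU SU"
  by (rule snd_map_measurable[OF upper_half_measurable])

lemma bmeas_pre: "bmeas SU H \<Longrightarrow> j \<in> {1..N} \<Longrightarrow> bmeas SU (pre j H)"
  unfolding pre_def by (rule bmeas_comp[OF _ pre_measurable])

lemma bmeas_K: "bmeas SU H \<Longrightarrow> s \<ge> 1 \<Longrightarrow> bmeas SU (K s H)"
  unfolding K_def by (intro bmeas_cmult bmeas_comp[OF _ lower_half_map])

lemma bmeas_J: "bmeas SU H \<Longrightarrow> s \<ge> 1 \<Longrightarrow> bmeas SU (J s H)"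
  unfolding J_def
  by (intro bmeas_mult bmeas_comp[OF _ upper_half_map] bmeas_comp[OF upper_jac_bmeas measurable_snd])

lemma bmeas_Nn: "bmeas SU H \<Longrightarrow> bmeas SU (Nn H)"
  unfolding Nn_def by (intro bmeas_sum bmeas_cmult bmeas_pre)

lemma bmeas_KN: "bmeas SU H \<Longrightarrow> s \<ge> 1 \<Longrightarrow> bmeas SU (KN s H)"
  unfolding KN_def by (intro bmeas_Nn bmeas_K)

lemma bmeas_KN_pow: "bmeas SU H \<Longrightarrow> s \<ge> 1 \<Longrightarrow> bmeas SU ((KN s ^^ i) H)"
  by (induction i) (auto intro: bmeas_KN)

lemma I_add: "bmeas SU f \<Longrightarrow> bmeas SU g \<Longrightarrow> I (\<lambda>z. f z + g z) = I f + I g"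
  unfolding I_def by (intro Bochner_Integration.integral_add bmeas_integrable prob_space_SU)

lemma I_diff: "bmeas SU f \<Longrightarrow> bmeas SU g \<Longrightarrow> I (\<lambda>z. f z - g z) = I f - I g"
  unfolding I_def by (intro Bochner_Integration.integral_diff bmeas_integrable prob_space_SU)

lemma I_cmult: "I (\<lambda>z. c * f z) = c * I f"
  unfolding I_def by simp

lemma I_sum: "(\<And>i. i \<in> A \<Longrightarrow> bmeas SU (f i)) \<Longrightarrow> I (\<lambda>z. \<Sum>i\<in>A. f i z) = (\<Sum>i\<in>A. I (f i))"
  unfolding I_def by (intro Bochner_Integration.integral_sum bmeas_integrable prob_space_SU)

lemma I_const [simp]: "I (\<lambda>z. c) = c"
  unfolding I_def using prob_space.prob_space[OF prob_space_SU] by simp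

lemma I_cong: "(\<And>z. z \<in> space SU \<Longrightarrow> f z = g z) \<Longrightarrow> I f = I g"
  unfolding I_def by (rule Bochner_Integration.integral_cong) auto

lemma I_mono: "bmeas SU f \<Longrightarrow> bmeas SU g \<Longrightarrow> (\<And>z. z \<in> space SU \<Longrightarrow> f z \<le> g z) \<Longrightarrow> I f \<le> I g"
  unfolding I_def by (intro Bochner_Integration.integral_mono bmeas_integrable prob_space_SU)

lemma I_nonneg: "(\<And>z. z \<in> space SU \<Longrightarrow> 0 \<le> f z) \<Longrightarrow> 0 \<le> I f"
  unfolding I_def by (intro Bochner_Integration.integral_nonneg)

lemma I_mult_bound:
  assumes "bmeas SU H" "bmeas SU f" "\<And>z. z \<in> space SU \<Longrightarrow> 0 \<le> H z" "\<And>z. z \<in> space SU \<Longrightarrow> \<bar>f z\<bar> \<le> c"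
  shows "\<bar>I (\<lambda>z. H z * f z)\<bar> \<le> c * I H"
proof -
  have "I (\<lambda>z. H z * f z) \<le> I (\<lambda>z. c * H z)"
    using assms by (intro I_mono bmeas_mult bmeas_cmult) (auto simp: mult.commute[of c] abs_le_iff intro!: mult_left_mono)
  moreover have "I (\<lambda>z. - c * H z) \<le> I (\<lambda>z. H z * f z)"
  proof (intro I_mono bmeas_mult bmeas_cmult assms)
    fix z assume z: "z \<in> space SU"
    then have "H z * (- c) \<le> H z * f z" using assms(3)[OF z] assms(4)[OF z] by (intro mult_left_mono) auto
    then show "- c * H z \<le> H z * f z" by (simp add: mult.commute)
  qed auto
  moreover have "I (\<lambda>z. c * H z) = c * I H" "I (\<lambda>z. - c * H z) = - (c * I H)"
    by (subst I_cmult, simp)+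
  ultimately show ?thesis by linarith
qed

lemma I_shift: "bmeas SU \<Phi> \<Longrightarrow> I \<Phi> = (\<Sum>j\<in>{1..N}. p j * I (pre j \<Phi>))"
  unfolding I_def pre_def by (rule shift_integral[OF U.prob_space_axioms])

lemma I_change: "s \<ge> 1 \<Longrightarrow> bmeas SU \<Phi> \<Longrightarrow> I \<Phi> = I (K s \<Phi>) + I (J s \<Phi>)"
  unfolding I_def K_def J_def by (rule change_of_variables)

lemma I_Nn: "bmeas SU H \<Longrightarrow> I (Nn H) = I H"
  unfolding Nn_def by (subst I_sum) (auto simp: I_cmult I_shift[of H] intro!: bmeas_cmult bmeas_pre)

lemma J_Nn: "J s (Nn H) = Nn (J s H)"
  by (simp only: J_def Nn_def pre_def sum_distrib_right mult.assoc fst_conv snd_conv)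

lemma I_KN: "bmeas SU H \<Longrightarrow> s \<ge> 1 \<Longrightarrow> I (KN s H) = I H - I (J s H)"
  using I_change[of s H] by (simp add: KN_def I_Nn bmeas_K)

end

section \<open>The random map in the coordinate u\<close>

locale random_map = letters +
  fixes B :: "nat set" and l r :: "nat \<Rightarrow> real" and T :: "nat \<Rightarrow> real \<Rightarrow> real"
  assumes B_sub: "B \<subseteq> {1..N}"
    and bad: "\<And>b. b \<in> B \<Longrightarrow> bad_map (l b) (T b)"
    and good: "\<And>g. g \<in> {1..N} - B \<Longrightarrow> good_map (r g) (T g)"
begin

definition G where "G = {1..N} - B"

lemma finite_B [simp]: "finite B" using B_sub finite_subset by blast
lemma finite_G [simp]: "finite G" by (simp add: G_def)

lemma sum_letters: "(\<Sum>j\<in>{1..N}. F j) = (\<Sum>b\<in>B. F b) + (\<Sum>g\<in>G. F g)" for F :: "nat \<Rightarrow> real"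
  using sum.subset_diff[OF B_sub, of F] by (simp add: G_def add.commute)

lemma letter_B: "b \<in> B \<Longrightarrow> b \<in> {1..N}" using B_sub by blast
lemma letter_G: "g \<in> G \<Longrightarrow> g \<in> {1..N}" by (simp add: G_def)

lemma l_gt_1: "b \<in> B \<Longrightarrow> l b > 1" using bad by (auto simp: bad_map_def)
lemma r_ge_1: "g \<in> G \<Longrightarrow> r g \<ge> 1" using good by (auto simp: good_map_def G_def)

lemma s_l_ge_1: "s \<ge> 1 \<Longrightarrow> b \<in> B \<Longrightarrow> s * l b \<ge> 1"
  using l_gt_1[of b] mult_mono[of 1 s 1 "l b"] by auto
lemma s_r_ge_1: "s \<ge> 1 \<Longrightarrow> g \<in> G \<Longrightarrow> s * r g \<ge> 1"
  using r_ge_1[of g] mult_mono[of 1 s 1 "r g"] by auto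

lemma T_right: "j \<in> {1..N} \<Longrightarrow> x \<in> {1/2..1} \<Longrightarrow> T j x = 2 * x - 1"
  using bad[of j] good[of j] by (cases "j \<in> B") (auto simp: bad_map_def good_map_def)

lemma T_bad:
  assumes "b \<in> B" "u \<in> {0<..1}" shows "T b ((1 - u) / 2) = (1 - u powr l b) / 2"
proof -
  have "(1 - u) / 2 \<in> {0..<1/2}" using assms by auto
  then have "T b ((1 - u) / 2) = 1/2 - 2 powr (l b - 1) * (1/2 - (1 - u) / 2) powr l b"
    using bad[OF assms(1)] unfolding bad_map_def by blast
  also have "1/2 - (1 - u) / 2 = u / 2" by (simp add: field_simps)
  finally show ?thesis using assms by (simp add: powr_divide powr_diff field_simps)
qed

lemma T_good:
  assumes "g \<in> G" "u \<in> {0<..1}" shows "T g ((1 - u) / 2) = 1 - u powr r g"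
proof -
  have "(1 - u) / 2 \<in> {0..<1/2}" using assms by auto
  then have "T g ((1 - u) / 2) = 1 - 2 powr r g * (1/2 - (1 - u) / 2) powr r g"
    using good[OF assms(1)[unfolded G_def]] unfolding good_map_def by blast
  also have "1/2 - (1 - u) / 2 = u / 2" by (simp add: field_simps)
  finally show ?thesis using assms by (simp add: powr_divide field_simps)
qed

abbreviation "X01 \<equiv> restrict_space borel {0..1::real}"
abbreviation "SX \<equiv> BM \<Otimes>\<^sub>M X01"
abbreviation "F \<equiv> skew_map T"

lemma space_X01 [simp]: "space X01 = {0..1}"
  by (simp add: space_restrict_space)

lemma space_SX: "space SX = phase_space N"
  by (simp add: space_pair_measure space_BM phase_space_def)

lemma T_range: assumes "j \<in> {1..N}" "x \<in> {0..1}" shows "T j x \<in> {0..1}"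
proof (cases "x < 1/2")
  case False
  then show ?thesis using assms T_right[of j x] by auto
next
  case True
  define u where "u = 1 - 2 * x"
  have u: "u \<in> {0<..1}" "x = (1 - u) / 2" using True assms by (auto simp: u_def)
  have "u powr a \<le> 1" if "a \<ge> 0" for a using u that powr_mono2[of a u 1] by auto
  note le1 = this
  show ?thesis
  proof (cases "j \<in> B")
    case True
    have le: "0 \<le> (1 - u powr l j) / 2" using le1 l_gt_1[OF True] by simp
    have "(1 - u powr l j) / 2 \<le> 1 / 2" by simp
    also have "\<dots> \<le> 1" by simp
    finally show ?thesis using le unfolding u(2) T_bad[OF True u(1)] by simp
  next
    case False
    then have g: "j \<in> G" using assms(1) by (simp add: G_def)
    have le: "0 \<le> 1 - u powr r j" using le1 r_ge_1[OF g] by simp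
    have "1 - u powr r j \<le> 1" by simp
    then show ?thesis using le unfolding u(2) T_good[OF g u(1)] by simp
  qed
qed

lemma T_measurable: assumes "j \<in> {1..N}" shows "T j \<in> measurable X01 X01"
proof (rule measurable_restrict_space2)
  show "T j \<in> space X01 \<rightarrow> {0..1}" using T_range[OF assms] by auto
  show "T j \<in> borel_measurable X01"
  proof (cases "j \<in> B")
    case True
    have "(\<lambda>x. if x < 1/2 then 1/2 - 2 powr (l j - 1) * (1/2 - x) powr l j else 2 * x - 1) \<in> borel_measurable X01"
      by (rule measurable_restrict_space1) measurable
    then show ?thesis
      by (rule measurable_cong[THEN iffD1, rotated]) (use bad[OF True] in \<open>auto simp: bad_map_def\<close>)
  next
    case False
    have "(\<lambda>x. if x < 1/2 then 1 - 2 powr r j * (1/2 - x) powr r j else 2 * x - 1) \<in> borel_measurable X01"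
      by (rule measurable_restrict_space1) measurable
    then show ?thesis
      by (rule measurable_cong[THEN iffD1, rotated]) (use good[of j] False assms in \<open>auto simp: good_map_def\<close>)
  qed
qed

lemma skew_measurable: "F \<in> measurable SX SX"
proof -
  have 1: "(\<lambda>z. \<lambda>n. fst z (Suc n)) \<in> measurable SX BM"
    unfolding BM_eq
  proof (rule measurable_PiM_single')
    show "(\<lambda>z. fst z (Suc n)) \<in> measurable (seq.S \<Otimes>\<^sub>M X01) P1" for n
      by (rule measurable_compose[OF measurable_fst measurable_component_singleton]) simp
  qed (auto simp: space_pair_measure space_PiM PiE_iff)
  have c: "(\<lambda>z. fst z 0) \<in> measurable SX P1"
    unfolding BM_eq by measurable
  have 2: "(\<lambda>z. T (fst z 0) (snd z)) \<in> measurable SX X01"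
  proof (rule measurable_compose_countable'[where I = "{1..N}" and f = "\<lambda>j z. T j (snd z)"])
    show "(\<lambda>z. T j (snd z)) \<in> measurable SX X01" if "j \<in> {1..N}" for j
      by (rule measurable_compose[OF measurable_snd T_measurable[OF that]])
    show "(\<lambda>z. fst z 0) \<in> measurable SX (count_space {1..N})"
      using c by (simp add: measurable_def sets_point_measure space_point_measure)
  qed auto
  show ?thesis
    using measurable_Pair[OF 1 2] by (simp add: skew_map_def case_prod_unfold)
qed

definition psi :: "((nat \<Rightarrow> nat) \<times> real \<Rightarrow> real) \<Rightarrow> nat \<Rightarrow> (nat \<Rightarrow> nat) \<times> real \<Rightarrow> real" where
  "psi f n z = f ((F ^^ n) z)"

lemma psi_0 [simp]: "psi f 0 = f" by (simp add: psi_def fun_eq_iff)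

lemma psi_Suc: "psi f (Suc n) z = psi f n (F z)"
  by (simp add: psi_def funpow_swap1)

lemma psi_case_nat: "psi f (Suc n) (case_nat j \<omega>, x) = psi f n (\<omega>, T j x)"
  by (simp add: psi_Suc skew_map_def)

lemma psi_bmeas: "bmeas SX f \<Longrightarrow> bmeas SX (psi f n)"
proof (induction n)
  case (Suc n)
  have "bmeas SX (\<lambda>z. psi f n (F z))"
    by (rule bmeas_comp[OF Suc.IH[OF Suc.prems] skew_measurable])
  then show ?case by (simp add: psi_Suc[abs_def])
qed simp

lemma psi_bound:
  assumes "\<And>z. z \<in> space SX \<Longrightarrow> \<bar>f z\<bar> \<le> c" "z \<in> space SX" shows "\<bar>psi f n z\<bar> \<le> c"
  using assms(2)
proof (induction n arbitrary: z)
  case (Suc n)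
  then show ?case using measurable_space[OF skew_measurable] by (simp add: psi_Suc)
qed (use assms in simp)

lemma point_measurable:
  assumes "\<phi> \<in> borel_measurable borel" "\<And>u. u \<in> {0<..<1} \<Longrightarrow> \<phi> u \<in> {0..1}"
  shows "(\<lambda>z. (fst z, \<phi> (snd z))) \<in> measurable SU SX"
  using assms by (intro snd_map_measurable measurable_restrict_space2 measurable_U1) auto

lemma powr_unit: "s \<ge> 1 \<Longrightarrow> u \<in> {0<..<1} \<Longrightarrow> u powr s \<in> {0<..<1}" for u s :: real
  using powr_less_mono2[of s u 1] by auto

definition xI :: "real \<Rightarrow> real \<Rightarrow> real" where "xI s u = (1 - u powr s) / 2"
definition xR :: "real \<Rightarrow> real \<Rightarrow> real" where "xR s u = 1 - u powr s"

lemma xI_measurable: "s \<ge> 1 \<Longrightarrow> (\<lambda>z. (fst z, xI s (snd z))) \<in> measurable SU SX"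
  using powr_unit by (intro point_measurable)
    (auto simp: xI_def[abs_def] less_imp_le intro: order.trans[of "- 1" 0])

lemma xR_measurable: "s \<ge> 1 \<Longrightarrow> (\<lambda>z. (fst z, xR s (snd z))) \<in> measurable SU SX"
  using powr_unit by (intro point_measurable) (auto simp: xR_def[abs_def] less_imp_le)

lemma xY_measurable: "(\<lambda>z. (fst z, (3 - snd z) / 4)) \<in> measurable SU SX"
  by (intro point_measurable) auto

text \<open>A pair \<open>(s, H)\<close> stands for the density \<open>H\<close> of \<open>(\<omega>, u)\<close>, the actual point being \<open>u powr s\<close>: this keeps
  the density regular along strings of bad letters. In \<open>A\<close> the point lies in the left half at \<open>x = (1 - u powr s) / 2\<close>, in \<open>Bf\<close>
  it is \<open>x = 1 - u powr s\<close>, reached by a good letter. The set \<open>(1/2, 3/4)\<close> carries the coordinate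
  \<open>x = (3 - u) / 4\<close>, from which every letter leads to the left half with the same \<open>u\<close>.\<close>

definition A :: "((nat \<Rightarrow> nat) \<times> real \<Rightarrow> real) \<Rightarrow> nat \<Rightarrow> real \<Rightarrow> ((nat \<Rightarrow> nat) \<times> real \<Rightarrow> real) \<Rightarrow> real" where
  "A f n s H = I (\<lambda>z. H z * psi f n (fst z, xI s (snd z)))"

definition Bf :: "((nat \<Rightarrow> nat) \<times> real \<Rightarrow> real) \<Rightarrow> nat \<Rightarrow> real \<Rightarrow> ((nat \<Rightarrow> nat) \<times> real \<Rightarrow> real) \<Rightarrow> real" where
  "Bf f n s H = I (\<lambda>z. H z * psi f n (fst z, xR s (snd z)))"

definition fY :: "((nat \<Rightarrow> nat) \<times> real \<Rightarrow> real) \<Rightarrow> (nat \<Rightarrow> nat) \<times> real \<Rightarrow> real" where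
  "fY f z = f (fst z, (3 - snd z) / 4)"

lemma fY_bmeas: "bmeas SX f \<Longrightarrow> bmeas SU (fY f)"
  using bmeas_comp[OF _ xY_measurable] by (simp add: fY_def[abs_def])

lemma A_integrand: "bmeas SX f \<Longrightarrow> bmeas SU H \<Longrightarrow> s \<ge> 1 \<Longrightarrow> bmeas SU (\<lambda>z. H z * psi f n (fst z, xI s (snd z)))"
  by (intro bmeas_mult bmeas_comp[OF psi_bmeas xI_measurable])

lemma Bf_integrand: "bmeas SX f \<Longrightarrow> bmeas SU H \<Longrightarrow> s \<ge> 1 \<Longrightarrow> bmeas SU (\<lambda>z. H z * psi f n (fst z, xR s (snd z)))"
  by (intro bmeas_mult bmeas_comp[OF psi_bmeas xR_measurable])

lemma A_diff: "bmeas SX f \<Longrightarrow> s \<ge> 1 \<Longrightarrow> bmeas SU H1 \<Longrightarrow> bmeas SU H2 \<Longrightarrow>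
    A f n s (\<lambda>z. H1 z - H2 z) = A f n s H1 - A f n s H2"
  unfolding A_def left_diff_distrib by (intro I_diff A_integrand)

lemma A_cmult: "A f n s (\<lambda>z. c * H z) = c * A f n s H"
  unfolding A_def mult.assoc by (rule I_cmult)

lemma I_letters:
  assumes "\<And>b. b \<in> B \<Longrightarrow> bmeas SU (X b)" "\<And>g. g \<in> G \<Longrightarrow> bmeas SU (Y g)"
  shows "I (\<lambda>z. (\<Sum>b\<in>B. p b * X b z) + (\<Sum>g\<in>G. p g * Y g z)) =
    (\<Sum>b\<in>B. p b * I (X b)) + (\<Sum>g\<in>G. p g * I (Y g))"
proof -
  have "I (\<lambda>z. (\<Sum>b\<in>B. p b * X b z) + (\<Sum>g\<in>G. p g * Y g z)) =
      I (\<lambda>z. \<Sum>b\<in>B. p b * X b z) + I (\<lambda>z. \<Sum>g\<in>G. p g * Y g z)"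
    by (intro I_add bmeas_sum bmeas_cmult assms)
  also have "I (\<lambda>z. \<Sum>b\<in>B. p b * X b z) = (\<Sum>b\<in>B. I (\<lambda>z. p b * X b z))"
    by (intro I_sum bmeas_cmult assms)
  also have "I (\<lambda>z. \<Sum>g\<in>G. p g * Y g z) = (\<Sum>g\<in>G. I (\<lambda>z. p g * Y g z))"
    by (intro I_sum bmeas_cmult assms)
  finally show ?thesis by (simp only: I_cmult)
qed

lemma A_letters:
  assumes "\<And>b. b \<in> B \<Longrightarrow> bmeas SU (X b)" "\<And>g. g \<in> G \<Longrightarrow> bmeas SU (Y g)" "bmeas SX f" "s \<ge> 1"
  shows "A f n s (\<lambda>z. (\<Sum>b\<in>B. p b * X b z) + (\<Sum>g\<in>G. p g * Y g z)) =
    (\<Sum>b\<in>B. p b * A f n s (X b)) + (\<Sum>g\<in>G. p g * A f n s (Y g))"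
  unfolding A_def distrib_right sum_distrib_right mult.assoc
  by (intro I_letters A_integrand assms)

text \<open>A bad letter keeps the point in the left half and turns the exponent \<open>s\<close>
  into \<open>s * l b\<close>; a good one leads to \<open>1 - u powr (s * r g)\<close>. The density
  is merely conditioned on the letter, which is the benefit of carrying the exponent
  separately.\<close>

lemma A_Suc:
  assumes f: "bmeas SX f" and H: "bmeas SU H" and s: "s \<ge> 1"
  shows "A f (Suc n) s H = (\<Sum>b\<in>B. p b * A f n (s * l b) (pre b H)) + (\<Sum>g\<in>G. p g * Bf f n (s * r g) (pre g H))"
proof -
  have "I (pre b (\<lambda>z. H z * psi f (Suc n) (fst z, xI s (snd z)))) = A f n (s * l b) (pre b H)" if b: "b \<in> B" for b
    unfolding A_def
  proof (rule I_cong)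
    fix z assume "z \<in> space SU"
    then have "snd z \<in> {0<..<1}" by (auto simp: space_SU)
    then have "T b (xI s (snd z)) = xI (s * l b) (snd z)"
      unfolding xI_def using T_bad[OF b, of "snd z powr s"] powr_unit[OF s, of "snd z"] by (simp add: powr_powr)
    then show "pre b (\<lambda>z. H z * psi f (Suc n) (fst z, xI s (snd z))) z =
        pre b H z * psi f n (fst z, xI (s * l b) (snd z))"
      by (simp add: pre_def psi_case_nat)
  qed
  moreover have "I (pre g (\<lambda>z. H z * psi f (Suc n) (fst z, xI s (snd z)))) = Bf f n (s * r g) (pre g H)" if g: "g \<in> G" for g
    unfolding Bf_def
  proof (rule I_cong)
    fix z assume "z \<in> space SU"
    then have "snd z \<in> {0<..<1}" by (auto simp: space_SU)
    then have "T g (xI s (snd z)) = xR (s * r g) (snd z)"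
      unfolding xI_def xR_def using T_good[OF g, of "snd z powr s"] powr_unit[OF s, of "snd z"] by (simp add: powr_powr)
    then show "pre g (\<lambda>z. H z * psi f (Suc n) (fst z, xI s (snd z))) z =
        pre g H z * psi f n (fst z, xR (s * r g) (snd z))"
      by (simp add: pre_def psi_case_nat)
  qed
  ultimately show ?thesis
    unfolding A_def[of f "Suc n"] I_shift[OF A_integrand[OF f H s]] sum_letters by simp
qed

text \<open>If \<open>u powr s > 1/2\<close>, the point is already in the left half, at
  \<open>(1 - w) / 2\<close> with \<open>w = 2 * u powr s - 1\<close>, and no time passes. Otherwise
  one step doubles \<open>u powr s\<close>, and \<open>lower_half\<close> makes the result an
  \<open>s\<close>-th power again.\<close>

lemma Bf_Suc:
  assumes f: "bmeas SX f" and H: "bmeas SU H" and s: "s \<ge> 1"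
  shows "Bf f (Suc n) s H = A f (Suc n) 1 (J s H) + Bf f n s (KN s H)"
proof -
  let ?\<Phi> = "\<lambda>z. H z * psi f (Suc n) (fst z, xR s (snd z))"
  have \<Phi>: "bmeas SU ?\<Phi>" by (rule Bf_integrand[OF f H s])
  have 1: "I (J s ?\<Phi>) = A f (Suc n) 1 (J s H)"
    unfolding A_def
  proof (rule I_cong)
    fix z assume "z \<in> space SU"
    then have "snd z \<in> {0<..<1}" by (auto simp: space_SU)
    then have "xR s (upper_half s (snd z)) = xI 1 (snd z)"
      using upper_half_powr[OF s] by (auto simp: xR_def xI_def field_simps)
    then show "J s ?\<Phi> z = J s H z * psi f (Suc n) (fst z, xI 1 (snd z))"
      by (simp add: J_def)
  qed
  have 2: "I (pre j (K s ?\<Phi>)) = I (\<lambda>z. pre j (K s H) z * psi f n (fst z, xR s (snd z)))" if j: "j \<in> {1..N}" for j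
  proof (rule I_cong)
    fix z assume "z \<in> space SU"
    then have u: "snd z \<in> {0<..<1}" by (auto simp: space_SU)
    then have "T j (xR s (lower_half s (snd z))) = xR s (snd z)"
      using lower_half_powr[OF s, of "snd z"] powr_unit[OF s u] T_right[OF j, of "xR s (lower_half s (snd z))"]
      by (auto simp: xR_def)
    then show "pre j (K s ?\<Phi>) z = pre j (K s H) z * psi f n (fst z, xR s (snd z))"
      by (simp add: pre_def K_def psi_case_nat)
  qed
  have "I (K s ?\<Phi>) = (\<Sum>j\<in>{1..N}. p j * I (\<lambda>z. pre j (K s H) z * psi f n (fst z, xR s (snd z))))"
    by (subst I_shift[OF bmeas_K[OF \<Phi> s]]) (simp add: 2)
  also have "\<dots> = I (\<lambda>z. \<Sum>j\<in>{1..N}. p j * (pre j (K s H) z * psi f n (fst z, xR s (snd z))))"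
    by (subst I_sum) (auto simp: I_cmult intro!: bmeas_cmult Bf_integrand f s bmeas_pre bmeas_K H)
  also have "\<dots> = Bf f n s (KN s H)"
    unfolding Bf_def KN_def Nn_def by (simp add: sum_distrib_right mult.assoc)
  finally show ?thesis
    unfolding Bf_def[of f "Suc n"] by (subst I_change[OF s \<Phi>]) (simp add: 1)
qed

definition suppY :: "((nat \<Rightarrow> nat) \<times> real \<Rightarrow> real) \<Rightarrow> bool" where
  "suppY f \<longleftrightarrow> (\<forall>\<omega>\<in>UNIV \<rightarrow> {1..N}. \<forall>x\<in>{0..1/2} \<union> {3/4..1}. f (\<omega>, x) = 0)"

lemma suppYD: "suppY f \<Longrightarrow> \<omega> \<in> UNIV \<rightarrow> {1..N} \<Longrightarrow> x \<in> {0..1/2} \<union> {3/4..1} \<Longrightarrow> f (\<omega>, x) = 0"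
  by (simp add: suppY_def)

lemma A_0:
  assumes f0: "suppY f" and s: "s \<ge> 1"
  shows "A f 0 s H = 0"
proof -
  have "A f 0 s H = I (\<lambda>z. 0)"
    unfolding A_def
  proof (rule I_cong)
    fix z assume "z \<in> space SU"
    then have "fst z \<in> UNIV \<rightarrow> {1..N}" "snd z \<in> {0<..<1}" by (auto simp: space_SU)
    then show "H z * psi f 0 (fst z, xI s (snd z)) = 0"
      using powr_unit[OF s, of "snd z"] by (auto simp: xI_def intro!: disjI2 suppYD[OF f0])
  qed
  then show ?thesis by simp
qed

text \<open>Only \<open>x\<close> between \<open>1/2\<close> and \<open>3/4\<close> counts, that is
  \<open>u powr s\<close> between \<open>1/4\<close> and \<open>1/2\<close>: the lower branch
  followed by the upper one. The other two pieces vanish by \<open>suppY\<close>.\<close>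

lemma Bf_0:
  assumes f: "bmeas SX f" and H: "bmeas SU H" and s: "s \<ge> 1"
    and f0: "suppY f"
  shows "Bf f 0 s H = I (\<lambda>z. J s (K s H) z * fY f z)"
proof -
  let ?\<Phi> = "\<lambda>z. H z * psi f 0 (fst z, xR s (snd z))"
  have \<Phi>: "bmeas SU ?\<Phi>" by (rule Bf_integrand[OF f H s])
  have sp: "fst z \<in> UNIV \<rightarrow> {1..N}" "snd z \<in> {0<..<1}" if "z \<in> space SU" for z
    using that by (auto simp: space_SU)
  have 1: "I (J s ?\<Phi>) = I (\<lambda>z. 0)"
  proof (rule I_cong)
    fix z assume z: "z \<in> space SU"
    then have "xR s (upper_half s (snd z)) = (1 - snd z) / 2"
      using upper_half_powr[OF s] sp[OF z] by (simp add: xR_def field_simps)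
    then have "f (fst z, xR s (upper_half s (snd z))) = 0"
      using sp[OF z] by (intro suppYD[OF f0]) auto
    then show "J s ?\<Phi> z = 0" by (simp add: J_def)
  qed
  have 2: "I (K s (K s ?\<Phi>)) = I (\<lambda>z. 0)"
  proof (rule I_cong)
    fix z assume z: "z \<in> space SU"
    then have "lower_half s (lower_half s (snd z)) powr s = snd z powr s / 4"
      using lower_half_powr[OF s lower_half_range[OF s]] lower_half_powr[OF s] sp[OF z] by simp
    then have "f (fst z, xR s (lower_half s (lower_half s (snd z)))) = 0"
      using sp[OF z] powr_unit[OF s, of "snd z"] by (intro suppYD[OF f0]) (auto simp: xR_def)
    then show "K s (K s ?\<Phi>) z = 0" by (simp add: K_def)
  qed
  have 3: "I (J s (K s ?\<Phi>)) = I (\<lambda>z. J s (K s H) z * fY f z)"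
  proof (rule I_cong)
    fix z assume z: "z \<in> space SU"
    then have "xR s (lower_half s (upper_half s (snd z))) = (3 - snd z) / 4"
      using lower_half_powr[OF s upper_half_range[OF s sp(2)[OF z]]] upper_half_powr[OF s sp(2)[OF z]] by (simp add: xR_def field_simps)
    then show "J s (K s ?\<Phi>) z = J s (K s H) z * fY f z"
      by (simp only: J_def K_def fY_def fst_conv snd_conv psi_0 mult_ac)
  qed
  have "Bf f 0 s H = I (K s ?\<Phi>) + I (J s ?\<Phi>)"
    unfolding Bf_def by (rule I_change[OF s \<Phi>])
  also have "I (K s ?\<Phi>) = I (K s (K s ?\<Phi>)) + I (J s (K s ?\<Phi>))"
    by (rule I_change[OF s bmeas_K[OF \<Phi> s]])
  finally show ?thesis using 1 2 3 by simp
qed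

text \<open>Densities at the return to the left half (\<open>RB\<close>, \<open>RA\<close>) and at the visit of \<open>(1/2, 3/4)\<close> just before
  it (\<open>YB\<close>, \<open>YA\<close>), indexed by the time elapsed.\<close>

definition RB :: "nat \<Rightarrow> real \<Rightarrow> ((nat \<Rightarrow> nat) \<times> real \<Rightarrow> real) \<Rightarrow> (nat \<Rightarrow> nat) \<times> real \<Rightarrow> real" where
  "RB i s H = J s ((KN s ^^ i) H)"

definition YB :: "nat \<Rightarrow> real \<Rightarrow> ((nat \<Rightarrow> nat) \<times> real \<Rightarrow> real) \<Rightarrow> (nat \<Rightarrow> nat) \<times> real \<Rightarrow> real" where
  "YB i s H = J s (K s ((KN s ^^ i) H))"

primrec RA :: "nat \<Rightarrow> real \<Rightarrow> ((nat \<Rightarrow> nat) \<times> real \<Rightarrow> real) \<Rightarrow> (nat \<Rightarrow> nat) \<times> real \<Rightarrow> real" where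
  "RA 0 s H = (\<lambda>z. 0)"
| "RA (Suc n) s H = (\<lambda>z. (\<Sum>b\<in>B. p b * RA n (s * l b) (pre b H) z) + (\<Sum>g\<in>G. p g * RB n (s * r g) (pre g H) z))"

primrec YA :: "nat \<Rightarrow> real \<Rightarrow> ((nat \<Rightarrow> nat) \<times> real \<Rightarrow> real) \<Rightarrow> (nat \<Rightarrow> nat) \<times> real \<Rightarrow> real" where
  "YA 0 s H = (\<lambda>z. 0)"
| "YA (Suc n) s H = (\<lambda>z. (\<Sum>b\<in>B. p b * YA n (s * l b) (pre b H) z) + (\<Sum>g\<in>G. p g * YB n (s * r g) (pre g H) z))"

lemma RB_bmeas: "bmeas SU H \<Longrightarrow> s \<ge> 1 \<Longrightarrow> bmeas SU (RB i s H)"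
  unfolding RB_def by (intro bmeas_J bmeas_KN_pow)

lemma YB_bmeas: "bmeas SU H \<Longrightarrow> s \<ge> 1 \<Longrightarrow> bmeas SU (YB i s H)"
  unfolding YB_def by (intro bmeas_J bmeas_K bmeas_KN_pow)

lemma RA_bmeas: "bmeas SU H \<Longrightarrow> s \<ge> 1 \<Longrightarrow> bmeas SU (RA n s H)"
proof (induction n arbitrary: s H)
  case (Suc n)
  show ?case unfolding RA.simps
    by (intro bmeas_add bmeas_sum bmeas_cmult Suc.IH RB_bmeas bmeas_pre Suc.prems letter_B letter_G
        s_l_ge_1 s_r_ge_1)
qed simp

lemma YA_bmeas: "bmeas SU H \<Longrightarrow> s \<ge> 1 \<Longrightarrow> bmeas SU (YA n s H)"
proof (induction n arbitrary: s H)
  case (Suc n)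
  show ?case unfolding YA.simps
    by (intro bmeas_add bmeas_sum bmeas_cmult Suc.IH YB_bmeas bmeas_pre Suc.prems letter_B letter_G
        s_l_ge_1 s_r_ge_1)
qed simp

lemma Bf_decomp:
  assumes f: "bmeas SX f" and s: "s \<ge> 1"
    and f0: "suppY f"
    and H: "bmeas SU H"
  shows "Bf f n s H = I (\<lambda>z. YB n s H z * fY f z) + (\<Sum>i\<le>n. A f (n - i) 1 (RB i s H))"
  using H
proof (induction n arbitrary: H)
  case 0
  then show ?case
    using Bf_0[OF f _ s f0] A_0[OF f0] by (simp add: YB_def)
next
  case (Suc n)
  have "RB i s (KN s H) = RB (Suc i) s H" for i
    by (simp add: RB_def funpow_swap1)
  moreover have "YB n s (KN s H) = YB (Suc n) s H"
    by (simp add: YB_def funpow_swap1)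
  moreover have "RB 0 s H = J s H" by (simp add: RB_def)
  ultimately show ?case
    unfolding Bf_Suc[OF f Suc.prems s] Suc.IH[OF bmeas_KN[OF Suc.prems s]] sum.atMost_Suc_shift
    by simp
qed

text \<open>Renewal over the first return to the left half. Before it, the orbit can meet the
  support of \<open>f\<close> only in the last step, which gives the term with \<open>YA\<close>; at
  the return the exponent is reset to \<open>1\<close>.\<close>

theorem A_decomp:
  assumes f: "bmeas SX f"
    and f0: "suppY f"
    and H: "bmeas SU H" and s: "s \<ge> 1"
  shows "A f n s H = I (\<lambda>z. YA n s H z * fY f z) + (\<Sum>i=1..n. A f (n - i) 1 (RA i s H))"
  using H s
proof (induction n arbitrary: s H)
  case 0
  then show ?case using A_0[OF f0] by simp
next
  case (Suc n)
  note H = Suc.prems(1) and s = Suc.prems(2)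
  have fY: "bmeas SU (fY f)" by (rule fY_bmeas[OF f])
  have pb: "bmeas SU (pre b H)" "s * l b \<ge> 1" if "b \<in> B" for b
    using that by (auto intro: bmeas_pre H letter_B s_l_ge_1 s)
  have pg: "bmeas SU (pre g H)" "s * r g \<ge> 1" if "g \<in> G" for g
    using that by (auto intro: bmeas_pre H letter_G s_r_ge_1 s)
  have IY: "I (\<lambda>z. YA (Suc n) s H z * fY f z) =
      (\<Sum>b\<in>B. p b * I (\<lambda>z. YA n (s * l b) (pre b H) z * fY f z)) +
      (\<Sum>g\<in>G. p g * I (\<lambda>z. YB n (s * r g) (pre g H) z * fY f z))"
    unfolding YA.simps distrib_right sum_distrib_right mult.assoc
    by (intro I_letters bmeas_mult YA_bmeas YB_bmeas pb pg fY)
  have AR: "A f m 1 (RA (Suc i) s H) =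
      (\<Sum>b\<in>B. p b * A f m 1 (RA i (s * l b) (pre b H))) +
      (\<Sum>g\<in>G. p g * A f m 1 (RB i (s * r g) (pre g H)))" for m i
    unfolding RA.simps
    by (intro A_letters RA_bmeas RB_bmeas pb pg f order.refl)
  have z: "(\<Sum>i\<le>n. A f (n - i) 1 (RA i s' H')) = (\<Sum>i=1..n. A f (n - i) 1 (RA i s' H'))" for s' H'
    by (rule sum.mono_neutral_cong_right) (auto simp: A_def Suc_le_eq)
  have "(\<Sum>i=1..Suc n. A f (Suc n - i) 1 (RA i s H)) = (\<Sum>i\<le>n. A f (n - i) 1 (RA (Suc i) s H))"
    by (rule sum.reindex_bij_witness[of _ Suc "\<lambda>i. i - 1"]) auto
  also have "\<dots> = (\<Sum>i\<le>n. \<Sum>b\<in>B. p b * A f (n - i) 1 (RA i (s * l b) (pre b H))) +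
      (\<Sum>i\<le>n. \<Sum>g\<in>G. p g * A f (n - i) 1 (RB i (s * r g) (pre g H)))"
    unfolding AR by (rule sum.distrib)
  also have "\<dots> = (\<Sum>b\<in>B. p b * (\<Sum>i=1..n. A f (n - i) 1 (RA i (s * l b) (pre b H)))) +
      (\<Sum>g\<in>G. p g * (\<Sum>i\<le>n. A f (n - i) 1 (RB i (s * r g) (pre g H))))"
    unfolding z[symmetric] sum_distrib_left by (simp add: sum.swap[of _ B] sum.swap[of _ G])
  finally have S: "(\<Sum>i=1..Suc n. A f (Suc n - i) 1 (RA i s H)) = \<dots>" .
  have "A f (Suc n) s H = (\<Sum>b\<in>B. p b * A f n (s * l b) (pre b H)) + (\<Sum>g\<in>G. p g * Bf f n (s * r g) (pre g H))"
    by (rule A_Suc[OF f H s])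
  also have "(\<Sum>b\<in>B. p b * A f n (s * l b) (pre b H)) = (\<Sum>b\<in>B. p b * (I (\<lambda>z. YA n (s * l b) (pre b H) z * fY f z) +
       (\<Sum>i=1..n. A f (n - i) 1 (RA i (s * l b) (pre b H)))))"
    using Suc.IH pb by (intro sum.cong refl) simp
  also have "(\<Sum>g\<in>G. p g * Bf f n (s * r g) (pre g H)) = (\<Sum>g\<in>G. p g * (I (\<lambda>z. YB n (s * r g) (pre g H) z * fY f z) +
       (\<Sum>i\<le>n. A f (n - i) 1 (RB i (s * r g) (pre g H)))))"
    using Bf_decomp[OF f _ f0] pg by (intro sum.cong refl) simp
  finally show ?case
    unfolding S IY by (simp add: distrib_left sum.distrib)
qed

text \<open>From \<open>(1/2, 3/4)\<close> every letter leads into the left half, and averaging over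
  that letter preserves mass.\<close>

lemma I_RB_Suc: "bmeas SU H \<Longrightarrow> s \<ge> 1 \<Longrightarrow> I (RB (Suc i) s H) = I (YB i s H)"
  using I_Nn[OF YB_bmeas, of H s i] by (simp add: RB_def YB_def KN_def J_Nn)

lemma I_RA_Suc: "bmeas SU H \<Longrightarrow> s \<ge> 1 \<Longrightarrow> I (RA (Suc n) s H) =
    (\<Sum>b\<in>B. p b * I (RA n (s * l b) (pre b H))) + (\<Sum>g\<in>G. p g * I (RB n (s * r g) (pre g H)))"
  unfolding RA.simps
  by (intro I_letters RA_bmeas RB_bmeas bmeas_pre s_l_ge_1 s_r_ge_1 letter_B letter_G)

lemma I_YA_Suc: "bmeas SU H \<Longrightarrow> s \<ge> 1 \<Longrightarrow> I (YA (Suc n) s H) =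
    (\<Sum>b\<in>B. p b * I (YA n (s * l b) (pre b H))) + (\<Sum>g\<in>G. p g * I (YB n (s * r g) (pre g H)))"
  unfolding YA.simps
  by (intro I_letters YA_bmeas YB_bmeas bmeas_pre s_l_ge_1 s_r_ge_1 letter_B letter_G)

text \<open>For \<open>s = 1\<close> this becomes the \<open>return_tail\<close> of the regeneration
  scheme; general \<open>s\<close> is needed because the recursion over bad letters changes the
  exponent.\<close>

definition tail_mass :: "nat \<Rightarrow> real \<Rightarrow> ((nat \<Rightarrow> nat) \<times> real \<Rightarrow> real) \<Rightarrow> real" where
  "tail_mass n s H = I H - (\<Sum>i=1..n. I (RA i s H))"

lemma sum_I_RB:
  assumes "bmeas SU H" "s \<ge> 1"
  shows "(\<Sum>i\<le>n. I (RB i s H)) = I H - I ((KN s ^^ Suc n) H)"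
proof -
  have "I (RB i s H) = I ((KN s ^^ i) H) - I ((KN s ^^ Suc i) H)" for i
    using I_KN[OF bmeas_KN_pow[OF assms, of i] assms(2)] by (simp add: RB_def)
  then have "(\<Sum>i<Suc n. I (RB i s H)) = (\<Sum>i<Suc n. I ((KN s ^^ i) H) - I ((KN s ^^ Suc i) H))"
    by simp
  also have "\<dots> = I ((KN s ^^ 0) H) - I ((KN s ^^ Suc n) H)"
    by (rule sum_lessThan_telescope')
  finally show ?thesis by (simp add: lessThan_Suc_atMost)
qed

lemma tail_mass_Suc:
  assumes "bmeas SU H" "s \<ge> 1"
  shows "tail_mass (Suc n) s H = (\<Sum>b\<in>B. p b * tail_mass n (s * l b) (pre b H)) +
    (\<Sum>g\<in>G. p g * I ((KN (s * r g) ^^ Suc n) (pre g H)))"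
proof -
  have pg: "bmeas SU (pre g H)" "s * r g \<ge> 1" if "g \<in> G" for g
    using that assms by (auto intro: bmeas_pre letter_G s_r_ge_1)
  have z: "(\<Sum>i\<le>n. I (RA i s' H')) = (\<Sum>i=1..n. I (RA i s' H'))" for s' H'
    by (rule sum.mono_neutral_cong_right) (auto simp: Suc_le_eq)
  have "(\<Sum>i=1..Suc n. I (RA i s H)) = (\<Sum>i\<le>n. I (RA (Suc i) s H))"
    by (rule sum.reindex_bij_witness[of _ Suc "\<lambda>i. i - 1"]) auto
  also have "\<dots> = (\<Sum>b\<in>B. p b * (\<Sum>i=1..n. I (RA i (s * l b) (pre b H)))) +
      (\<Sum>g\<in>G. p g * (\<Sum>i\<le>n. I (RB i (s * r g) (pre g H))))"
    unfolding I_RA_Suc[OF assms] sum.distrib z[symmetric] sum_distrib_left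
    by (simp add: sum.swap[of _ B] sum.swap[of _ G])
  also have "(\<Sum>g\<in>G. p g * (\<Sum>i\<le>n. I (RB i (s * r g) (pre g H)))) =
      (\<Sum>g\<in>G. p g * (I (pre g H) - I ((KN (s * r g) ^^ Suc n) (pre g H))))"
    by (intro sum.cong refl) (simp only: sum_I_RB[OF pg])
  finally show ?thesis
    unfolding tail_mass_def I_shift[OF assms(1)] sum_letters
    by (simp add: right_diff_distrib sum_subtractf)
qed

end

subsection \<open>The tail of the return time\<close>

text \<open>This is \<open>ln y \<le> y - 1\<close> at \<open>y = x * (ln 2 / q)\<close>,
  exponentiated. It converts the exponential decay along the right half, at rate
  \<open>1 / s\<close>, into \<open>(s / n) powr q\<close>.\<close>

lemma powr_le_two_powr:
  assumes q: "q > 0"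
  shows "\<exists>C>0. \<forall>x>0. x powr q \<le> C * 2 powr (x::real)"
proof (intro exI conjI allI impI)
  define C where "C = exp (- q - q * ln (ln 2 / q))"
  show "C > 0" by (simp add: C_def)
  fix x :: real assume x: "x > 0"
  have "ln (x * (ln 2 / q)) \<le> x * (ln 2 / q) - 1"
    using x q by (intro ln_le_minus_one) auto
  then have "q * (ln x + ln (ln 2 / q)) \<le> q * (x * (ln 2 / q) - 1)"
    using x q by (intro mult_left_mono) (auto simp: ln_mult_pos[of x "ln 2 / q", symmetric] simp del: times_divide_eq_right)
  then have "q * ln x \<le> (- q - q * ln (ln 2 / q)) + x * ln 2"
    using q by (simp add: algebra_simps)
  then have "exp (q * ln x) \<le> exp (- q - q * ln (ln 2 / q)) * exp (x * ln 2)"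
    by (simp flip: exp_add)
  then show "x powr q \<le> C * 2 powr x"
    using x by (simp add: powr_def C_def)
qed

lemma two_powr_power: "(2 powr (- 1 / s)) ^ m = 2 powr (- (real m / s))"
  by (simp add: powr_realpow[symmetric] powr_powr)

context random_map
begin

lemma pre_space: "j \<in> {1..N} \<Longrightarrow> z \<in> space SU \<Longrightarrow> (case_nat j (fst z), snd z) \<in> space SU"
  using measurable_space[OF pre_measurable] .

lemma lower_half_space: "s \<ge> 1 \<Longrightarrow> z \<in> space SU \<Longrightarrow> (fst z, lower_half s (snd z)) \<in> space SU"
  using measurable_space[OF lower_half_map] .

lemma p_nonneg: "j \<in> {1..N} \<Longrightarrow> p j \<ge> 0" using p_pos by (simp add: less_imp_le)
lemma p_B: "b \<in> B \<Longrightarrow> p b \<ge> 0" using p_nonneg letter_B by blast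
lemma p_G: "g \<in> G \<Longrightarrow> p g \<ge> 0" using p_nonneg letter_G by blast

definition nonneg :: "((nat \<Rightarrow> nat) \<times> real \<Rightarrow> real) \<Rightarrow> bool" where
  "nonneg H \<longleftrightarrow> (\<forall>z\<in>space SU. 0 \<le> H z)"

lemma nonneg_pre: "nonneg H \<Longrightarrow> j \<in> {1..N} \<Longrightarrow> nonneg (pre j H)"
  using case_nat_space by (auto simp: nonneg_def space_SU pre_def)

lemma nonneg_K: "nonneg H \<Longrightarrow> s \<ge> 1 \<Longrightarrow> nonneg (K s H)"
  using lower_half_range by (auto simp: nonneg_def space_SU K_def)

lemma nonneg_J: "nonneg H \<Longrightarrow> s \<ge> 1 \<Longrightarrow> nonneg (J s H)"
  using upper_half_range upper_jac_bounds(1) by (auto simp: nonneg_def space_SU J_def less_imp_le)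

lemma nonneg_Nn: "nonneg H \<Longrightarrow> nonneg (Nn H)"
  using nonneg_pre p_nonneg unfolding nonneg_def Nn_def by (auto intro!: sum_nonneg mult_nonneg_nonneg)

lemma nonneg_KN: "nonneg H \<Longrightarrow> s \<ge> 1 \<Longrightarrow> nonneg (KN s H)"
  unfolding KN_def by (intro nonneg_Nn nonneg_K)

lemma nonneg_KN_pow: "nonneg H \<Longrightarrow> s \<ge> 1 \<Longrightarrow> nonneg ((KN s ^^ i) H)"
  by (induction i) (auto intro: nonneg_KN)

lemma nonneg_RB: "nonneg H \<Longrightarrow> s \<ge> 1 \<Longrightarrow> nonneg (RB i s H)"
  unfolding RB_def by (intro nonneg_J nonneg_KN_pow)

lemma nonneg_YB: "nonneg H \<Longrightarrow> s \<ge> 1 \<Longrightarrow> nonneg (YB i s H)"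
  unfolding YB_def by (intro nonneg_J nonneg_K nonneg_KN_pow)

lemma nonneg_letters:
  assumes "\<And>b. b \<in> B \<Longrightarrow> nonneg (X b)" "\<And>g. g \<in> G \<Longrightarrow> nonneg (Y g)"
  shows "nonneg (\<lambda>z. (\<Sum>b\<in>B. p b * X b z) + (\<Sum>g\<in>G. p g * Y g z))"
  using assms p_B p_G unfolding nonneg_def
  by (auto intro!: add_nonneg_nonneg sum_nonneg mult_nonneg_nonneg)

lemma nonneg_RA: "nonneg H \<Longrightarrow> s \<ge> 1 \<Longrightarrow> nonneg (RA n s H)"
proof (induction n arbitrary: s H)
  case 0
  show ?case by (simp add: nonneg_def)
next
  case (Suc n)
  show ?case unfolding RA.simps
    by (intro nonneg_letters Suc.IH nonneg_RB nonneg_pre Suc.prems s_l_ge_1 s_r_ge_1 letter_B letter_G)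
qed

lemma I_nonneg': "nonneg H \<Longrightarrow> I H \<ge> 0"
  by (rule I_nonneg) (simp add: nonneg_def)

text \<open>The two recursions agree except for returns that skip \<open>(1/2, 3/4)\<close>, where a
  good letter leads straight back to the left half; these enter at the base of the
  induction.\<close>

lemma I_YA_le_RA: "bmeas SU H \<Longrightarrow> nonneg H \<Longrightarrow> s \<ge> 1 \<Longrightarrow> I (YA n s H) \<le> I (RA (Suc n) s H)"
proof (induction n arbitrary: s H)
  case 0
  then show ?case using I_nonneg'[OF nonneg_RA[of H s "Suc 0"]] by simp
next
  case (Suc n)
  note H = Suc.prems
  have pg: "bmeas SU (pre g H)" "s * r g \<ge> 1" if "g \<in> G" for g
    using that H by (auto intro: bmeas_pre letter_G s_r_ge_1)
  have pb: "bmeas SU (pre b H)" "nonneg (pre b H)" "s * l b \<ge> 1" if "b \<in> B" for b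
    using that H by (auto intro: bmeas_pre nonneg_pre letter_B s_l_ge_1)
  show ?case
    unfolding I_YA_Suc[OF H(1,3)] I_RA_Suc[OF H(1,3), of "Suc n"]
    by (intro add_mono sum_mono mult_left_mono p_B p_G Suc.IH pb) (auto simp: I_RB_Suc pg)
qed

lemma tail_mass_0 [simp]: "tail_mass 0 s H = I H" by (simp add: tail_mass_def)

lemma tail_mass_nonneg: "bmeas SU H \<Longrightarrow> nonneg H \<Longrightarrow> s \<ge> 1 \<Longrightarrow> tail_mass n s H \<ge> 0"
proof (induction n arbitrary: s H)
  case 0
  then show ?case using I_nonneg' by simp
next
  case (Suc n)
  show ?case unfolding tail_mass_Suc[OF Suc.prems(1,3)]
  proof (intro add_nonneg_nonneg sum_nonneg mult_nonneg_nonneg)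
    show "0 \<le> tail_mass n (s * l b) (pre b H)" if "b \<in> B" for b
      by (intro Suc.IH bmeas_pre nonneg_pre s_l_ge_1 that letter_B Suc.prems)
    show "0 \<le> I ((KN (s * r g) ^^ (Suc n)) (pre g H))" if "g \<in> G" for g
      by (intro I_nonneg' nonneg_KN_pow nonneg_pre s_r_ge_1 that letter_G Suc.prems)
  qed (auto intro: p_B p_G)
qed

lemma tail_mass_le_I: "nonneg H \<Longrightarrow> s \<ge> 1 \<Longrightarrow> tail_mass n s H \<le> I H"
  unfolding tail_mass_def by (auto intro!: sum_nonneg I_nonneg' nonneg_RA)

lemma KN_apply: "KN s X z = (\<Sum>j\<in>{1..N}. p j * pre j (K s X) z)"
  by (simp add: KN_def Nn_def)

lemma KN_pow_bound:
  assumes H: "nonneg H" "\<And>z. z \<in> space SU \<Longrightarrow> H z \<le> c" and s: "s \<ge> 1" and z: "z \<in> space SU"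
  shows "(KN s ^^ m) H z \<le> (2 powr (- 1 / s)) ^ m * c"
  using z
proof (induction m arbitrary: z)
  case 0
  then show ?case using H by simp
next
  case (Suc m)
  have "KN s ((KN s ^^ m) H) z \<le> (\<Sum>j\<in>{1..N}. p j * ((2 powr (- 1 / s)) ^ Suc m * c))"
  proof (subst KN_apply, rule sum_mono)
    fix j assume j: "j \<in> {1..N}"
    have "(case_nat j (fst z), lower_half s (snd z)) \<in> space SU"
      using pre_space[OF j lower_half_space[OF s Suc.prems]] by simp
    from Suc.IH[OF this] have "pre j (K s ((KN s ^^ m) H)) z \<le> (2 powr (- 1 / s)) ^ Suc m * c"
      by (simp add: pre_def K_def mult.assoc)
    then show "p j * pre j (K s ((KN s ^^ m) H)) z \<le> p j * ((2 powr (- 1 / s)) ^ Suc m * c)"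
      by (rule mult_left_mono[OF _ p_nonneg[OF j]])
  qed
  also have "\<dots> = (2 powr (- 1 / s)) ^ Suc m * c"
    unfolding sum_distrib_right[symmetric] p_sum by simp
  finally show ?case by simp
qed

lemma I_KN_pow_bound:
  assumes "bmeas SU H" "nonneg H" "\<And>z. z \<in> space SU \<Longrightarrow> H z \<le> c" "s \<ge> 1"
  shows "I ((KN s ^^ m) H) \<le> (2 powr (- 1 / s)) ^ m * c"
proof -
  have "I ((KN s ^^ m) H) \<le> I (\<lambda>z. (2 powr (- 1 / s)) ^ m * c)"
    by (intro I_mono bmeas_KN_pow bmeas_const KN_pow_bound assms)
  then show ?thesis by simp
qed

text \<open>Induction on \<open>n\<close> for all exponents \<open>s\<close> at once. A bad letter
  multiplies \<open>s\<close> by \<open>l b\<close>, so \<open>s powr q\<close> reproduces with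
  total factor \<open>(\<Sum>b\<in>B. p b * l b powr q) < 1\<close>; a good letter leaves
  exponential decay. Each letter uses one unit of time, which costs the ratio of consecutive weights
  and is affordable once \<open>n\<close> is large.\<close>

theorem tail_mass_upper:
  assumes q: "q > 1" and \<kappa>: "(\<Sum>b\<in>B. p b * l b powr q) < 1"
  shows "\<exists>C>0. \<forall>n s H c. s \<ge> 1 \<longrightarrow> bmeas SU H \<longrightarrow> nonneg H \<longrightarrow> (\<forall>z\<in>space SU. H z \<le> c) \<longrightarrow>
    tail_mass n s H \<le> c * C * s powr q * wt q n"
proof -
  obtain C2 where C2: "C2 > 0" "\<And>x. x > 0 \<Longrightarrow> x powr q \<le> C2 * 2 powr x"
    using powr_le_two_powr[of q] q by auto
  define \<kappa>' where "\<kappa>' = (\<Sum>b\<in>B. p b * l b powr q)"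
  define C3 where "C3 = C2 * (\<Sum>g\<in>G. p g * r g powr q)"
  have \<kappa>0: "\<kappa>' \<ge> 0" unfolding \<kappa>'_def by (intro sum_nonneg mult_nonneg_nonneg p_B) auto
  have C30: "C3 \<ge> 0" unfolding C3_def using C2 by (intro mult_nonneg_nonneg sum_nonneg p_G) auto
  \<comment> \<open>A number above \<open>1\<close> with \<open>lam * \<kappa>' < 1\<close>; from
    \<open>n0\<close> on it bounds the ratio \<open>wt q n / wt q (Suc n)\<close>.\<close>
  define lam where "lam = 2 / (1 + \<kappa>')"
  have lam: "lam > 1" "lam * \<kappa>' < 1" using \<kappa> \<kappa>0 by (auto simp: lam_def \<kappa>'_def[symmetric] field_simps)
  have "(\<lambda>n. ((real n + 2) / (real n + 1)) powr q) \<longlonglongrightarrow> 1"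
    by real_asymp
  then have "eventually (\<lambda>n. ((real n + 2) / (real n + 1)) powr q < lam) sequentially"
    using lam by (intro order_tendstoD)
  then obtain n0 where n0: "\<And>n. n \<ge> n0 \<Longrightarrow> ((real n + 2) / (real n + 1)) powr q < lam"
    by (auto simp: eventually_sequentially)
  \<comment> \<open>The first summand settles \<open>n \<le> n0\<close> by the trivial bound
    \<open>tail_mass n s H \<le> c\<close>; the second yields
    \<open>lam * (\<kappa>' * C + C3) \<le> C\<close>.\<close>
  define C where "C = 1 / wt q n0 + lam * C3 / (1 - lam * \<kappa>')"
  have C: "C > 0" "C \<ge> 1 / wt q n0"
    using lam C30 by (auto simp: C_def intro!: add_pos_nonneg divide_nonneg_pos)
  have Crec: "lam * (\<kappa>' * C + C3) \<le> C"
  proof -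
    have "lam * C3 = (1 - lam * \<kappa>') * (lam * C3 / (1 - lam * \<kappa>'))" using lam by simp
    also have "\<dots> \<le> (1 - lam * \<kappa>') * C" using lam by (intro mult_left_mono) (auto simp: C_def)
    finally show ?thesis by (simp add: algebra_simps)
  qed
    have c_nonneg: "c \<ge> 0" if "nonneg H" "\<And>z. z \<in> space SU \<Longrightarrow> H z \<le> c" for H c
      using that prob_space.not_empty[OF prob_space_SU] unfolding nonneg_def by (metis ex_in_conv order.trans)
    have triv: "tail_mass n s H \<le> c * C * s powr q * wt q n" if "n \<le> n0" "s \<ge> 1"
      "bmeas SU H" "nonneg H" "\<And>z. z \<in> space SU \<Longrightarrow> H z \<le> c" for n s H c
    proof -
      have "tail_mass n s H \<le> I H" using that by (intro tail_mass_le_I)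
      also have "\<dots> \<le> I (\<lambda>z. c)" using that by (intro I_mono) auto
      also have "\<dots> = c * 1" by simp
      also have "c * 1 \<le> c * (C * wt q n)"
      proof (rule mult_left_mono[OF _ c_nonneg[OF that(4,5)]])
        have "1 = 1 / wt q n0 * wt q n0" using wt_pos[of q n0] by simp
        also have "\<dots> \<le> C * wt q n"
          using C that(1) q by (intro mult_mono wt_antimono) auto
        finally show "1 \<le> C * wt q n" .
      qed
      also have "c * (C * wt q n) \<le> c * (C * wt q n) * s powr q"
        using c_nonneg[OF that(4,5)] C q that(2) mult_left_mono[of 1 "s powr q" "c * (C * wt q n)"]
        by (simp add: ge_one_powr_ge_zero)
      finally show ?thesis by (simp add: mult_ac)
    qed
  have "tail_mass n s H \<le> c * C * s powr q * wt q n"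
    if "s \<ge> 1" "bmeas SU H" "nonneg H" "\<And>z. z \<in> space SU \<Longrightarrow> H z \<le> c" for n s H c
    using that
  proof (induction n arbitrary: s H)
      case 0
      then show ?case by (intro triv) auto
    next
      case (Suc n)
      note s = Suc.prems(1) and H = Suc.prems(2-4)
      have c: "c \<ge> 0" using c_nonneg H by blast
      show ?case
      proof (cases "Suc n \<le> n0")
        case True
        then show ?thesis using Suc.prems by (intro triv)
      next
        case False
        have pH: "bmeas SU (pre j H)" "nonneg (pre j H)" "\<And>z. z \<in> space SU \<Longrightarrow> pre j H z \<le> c"
          if "j \<in> {1..N}" for j
          using H(3)[OF pre_space[OF that]] bmeas_pre[OF H(1) that] nonneg_pre[OF H(2) that]
          by (simp_all add: pre_def)
        have 1: "(\<Sum>b\<in>B. p b * tail_mass n (s * l b) (pre b H)) \<le> c * s powr q * wt q n * (\<kappa>' * C)"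
        proof -
          have "(\<Sum>b\<in>B. p b * tail_mass n (s * l b) (pre b H)) \<le> (\<Sum>b\<in>B. p b * (c * C * (s * l b) powr q * wt q n))"
            by (intro sum_mono mult_left_mono Suc.IH p_B s_l_ge_1 s pH letter_B)
          also have "\<dots> = (\<Sum>b\<in>B. (c * s powr q * wt q n * C) * (p b * l b powr q))"
            using s l_gt_1 by (intro sum.cong) (auto simp: powr_mult mult_ac less_imp_le)
          also have "\<dots> = c * s powr q * wt q n * (\<kappa>' * C)"
            unfolding sum_distrib_left[symmetric] \<kappa>'_def by (simp add: mult_ac)
          finally show ?thesis .
        qed
        have 2: "(\<Sum>g\<in>G. p g * I ((KN (s * r g) ^^ Suc n) (pre g H))) \<le> c * s powr q * wt q n * C3"
        proof -
          have "(\<Sum>g\<in>G. p g * I ((KN (s * r g) ^^ Suc n) (pre g H))) \<le>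
              (\<Sum>g\<in>G. p g * (C2 * ((s * r g) powr q * wt q n) * c))"
          proof (intro sum_mono mult_left_mono p_G)
            fix g assume g: "g \<in> G"
            define s' where "s' = s * r g"
            have s': "s' \<ge> 1" unfolding s'_def by (rule s_r_ge_1[OF s g])
            have "I ((KN s' ^^ Suc n) (pre g H)) \<le> (2 powr (- 1 / s')) ^ Suc n * c"
              by (intro I_KN_pow_bound pH letter_G g s')
            also have "(2 powr (- 1 / s')) ^ Suc n = 2 powr (- ((real n + 1) / s'))"
              unfolding two_powr_power by (simp add: add.commute)
            also have "\<dots> \<le> C2 * (s' powr q * wt q n)"
            proof -
              have "((real n + 1) / s') powr q \<le> C2 * 2 powr ((real n + 1) / s')"
                using s' by (intro C2) auto
              then show ?thesis
                using s' by (simp add: powr_minus powr_divide wt_def field_simps)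
            qed
            finally show "I ((KN (s * r g) ^^ Suc n) (pre g H)) \<le> C2 * ((s * r g) powr q * wt q n) * c"
              using c by (simp add: s'_def mult_right_mono)
          qed
          also have "\<dots> = (\<Sum>g\<in>G. (c * s powr q * wt q n * C2) * (p g * r g powr q))"
            using s r_ge_1 by (intro sum.cong) (auto simp: powr_mult mult_ac)
          also have "\<dots> = c * s powr q * wt q n * C3"
            unfolding sum_distrib_left[symmetric] C3_def by (simp add: mult_ac)
          finally show ?thesis .
        qed
        have w: "wt q n \<le> lam * wt q (Suc n)"
        proof -
          have "wt q n = ((real n + 2) / (real n + 1)) powr q * wt q (Suc n)"
            by (simp add: wt_def powr_divide powr_minus field_simps)
          also have "\<dots> \<le> lam * wt q (Suc n)"
            using n0[of n] False by (intro mult_right_mono) auto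
          finally show ?thesis .
        qed
        have "tail_mass (Suc n) s H \<le> c * s powr q * wt q n * (\<kappa>' * C) + c * s powr q * wt q n * C3"
          unfolding tail_mass_Suc[OF H(1) s] by (intro add_mono 1 2)
        also have "\<dots> = c * s powr q * (\<kappa>' * C + C3) * wt q n" by (simp add: algebra_simps)
        also have "\<dots> \<le> c * s powr q * (\<kappa>' * C + C3) * (lam * wt q (Suc n))"
          using c \<kappa>0 C C30 by (intro mult_left_mono w mult_nonneg_nonneg) auto
        also have "\<dots> = c * s powr q * wt q (Suc n) * (lam * (\<kappa>' * C + C3))" by (simp add: mult_ac)
        also have "\<dots> \<le> c * s powr q * wt q (Suc n) * C"
          using c by (intro mult_left_mono Crec) auto
        finally show ?thesis by (simp add: mult_ac)
      qed
  qed
  with C(1) show ?thesis by blast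
qed

lemma pre_const [simp]: "pre j (\<lambda>_. c) = (\<lambda>_. c)" by (simp add: pre_def)

lemma KN_pow_const: "(KN s ^^ m) (\<lambda>_. c) = (\<lambda>_. (2 powr (- 1 / s)) ^ m * c)"
proof (induction m)
  case (Suc m)
  have "KN s (\<lambda>_. d) = (\<lambda>_. 2 powr (- 1 / s) * d)" for d
    by (simp add: KN_def Nn_def K_def pre_def sum_distrib_right[symmetric] p_sum[simplified])
  then show ?case by (simp add: Suc mult.assoc)
qed simp

text \<open>While the exponent is small compared with the time left, follow bad letters with
  \<open>l j \<ge> l b\<close>: by \<open>L\<close> their probability times the gain
  \<open>l b powr a\<close> is \<open>1\<close>, so the bound reproduces exactly. Once
  \<open>n + 1 \<le> s * l b\<close>, a single good letter keeps a fixed fraction of the mass from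
  returning.\<close>

theorem tail_mass_lower:
  assumes b: "b \<in> B" and a: "a > 0" and L: "(\<Sum>j\<in>{j\<in>B. l j \<ge> l b}. p j) * l b powr a = 1" and G: "G \<noteq> {}"
  shows "\<exists>c>0. \<forall>n s. s \<ge> 1 \<longrightarrow> c * min 1 ((s / (real n + 1)) powr a) \<le> tail_mass n s (\<lambda>_. 1)"
proof -
  define \<pi> where "\<pi> = (\<Sum>j\<in>{j\<in>B. l j \<ge> l b}. p j)"
  define PG where "PG = (\<Sum>g\<in>G. p g)"
  have PG: "PG > 0" unfolding PG_def using G p_pos letter_G by (intro sum_pos) auto
  have "PG \<le> (\<Sum>j\<in>{1..N}. p j)" unfolding PG_def using p_nonneg letter_G by (intro sum_mono2) auto
  then have PG1: "PG \<le> 1" using p_sum by simp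
  have lb: "l b > 1" using l_gt_1[OF b] .
  \<comment> \<open>A good letter occurs with probability \<open>PG\<close>; when
    \<open>n + 1 \<le> s * l b\<close> it retains at least \<open>2 powr (- l b)\<close> of the
    mass, because \<open>r g \<ge> 1\<close>.\<close>
  define c where "c = PG * 2 powr (- l b)"
  have c: "c > 0" using PG by (simp add: c_def)
  have c1: "c \<le> 1"
    unfolding c_def using PG PG1 lb by (intro mult_le_one) (auto simp: powr_le_one_le powr_minus divide_simps ge_one_powr_ge_zero)
  have one: "bmeas SU (\<lambda>_. 1)" "nonneg (\<lambda>_. 1)" by (auto simp: nonneg_def)
  have "c * min 1 ((s / (real n + 1)) powr a) \<le> tail_mass n s (\<lambda>_. 1)" if "s \<ge> 1" for n s
    using that
  proof (induction n arbitrary: s)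
    case 0
    have "c * min 1 ((s / (real 0 + 1)) powr a) \<le> 1 * 1"
      using c c1 by (intro mult_mono) auto
    then show ?case by simp
  next
    case (Suc n)
    note s = Suc.prems
    have eq: "tail_mass (Suc n) s (\<lambda>_. 1) = (\<Sum>b\<in>B. p b * tail_mass n (s * l b) (\<lambda>_. 1)) +
        (\<Sum>g\<in>G. p g * (2 powr (- 1 / (s * r g))) ^ Suc n)"
      unfolding tail_mass_Suc[OF one(1) s] pre_const KN_pow_const by simp
    show ?case
    proof (cases "real n + 1 \<le> s * l b")
      case True
      have "c * min 1 ((s / (real (Suc n) + 1)) powr a) \<le> c * 1"
        using c by (intro mult_left_mono) auto
      also have "\<dots> = (\<Sum>g\<in>G. p g * 2 powr (- l b))" by (simp add: c_def PG_def sum_distrib_right)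
      also have "\<dots> \<le> (\<Sum>g\<in>G. p g * (2 powr (- 1 / (s * r g))) ^ Suc n)"
      proof (intro sum_mono mult_left_mono p_G)
        fix g assume g: "g \<in> G"
        have "(real n + 1) / (s * r g) \<le> (s * l b) / (s * r g)"
          using True s r_ge_1[OF g] by (intro divide_right_mono) auto
        also have "\<dots> = l b / r g" using s by simp
        also have "\<dots> \<le> l b / 1" using r_ge_1[OF g] lb by (intro divide_left_mono) auto
        finally have "2 powr (- l b) \<le> 2 powr (- ((real n + 1) / (s * r g)))" by simp
        also have "\<dots> = (2 powr (- 1 / (s * r g))) ^ Suc n"
          unfolding two_powr_power by (simp add: add.commute)
        finally show "2 powr (- l b) \<le> (2 powr (- 1 / (s * r g))) ^ Suc n" .
      qed
      also have "\<dots> \<le> tail_mass (Suc n) s (\<lambda>_. 1)"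
        unfolding eq using s by (auto intro!: sum_nonneg mult_nonneg_nonneg p_B tail_mass_nonneg one s_l_ge_1)
      finally show ?thesis .
    next
      case False
      let ?m = "(s * l b / (real n + 1)) powr a"
      have m1: "?m \<le> 1" using False s lb a by (intro powr_le1) auto
      have "c * min 1 ((s / (real (Suc n) + 1)) powr a) \<le> c * (s / (real n + 1)) powr a"
      proof (intro mult_left_mono)
        have "(s / (real (Suc n) + 1)) powr a \<le> (s / (real n + 1)) powr a"
          using s a by (intro powr_mono2 divide_left_mono) auto
        then show "min 1 ((s / (real (Suc n) + 1)) powr a) \<le> (s / (real n + 1)) powr a" by simp
      qed (use c in auto)
      also have "\<dots> = c * (\<pi> * l b powr a) * (s / (real n + 1)) powr a"
        using L by (simp add: \<pi>_def)
      also have "\<dots> = \<pi> * (c * ?m)"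
        using s lb by (simp add: powr_mult powr_divide mult_ac)
      also have "\<dots> = (\<Sum>j\<in>{j\<in>B. l j \<ge> l b}. p j * (c * ?m))"
        by (simp add: \<pi>_def sum_distrib_right)
      also have "\<dots> \<le> (\<Sum>j\<in>{j\<in>B. l j \<ge> l b}. p j * tail_mass n (s * l j) (\<lambda>_. 1))"
      proof (intro sum_mono mult_left_mono)
        fix j assume j: "j \<in> {j\<in>B. l j \<ge> l b}"
        have "?m \<le> (s * l j / (real n + 1)) powr a"
          using j s lb a by (intro powr_mono2 divide_right_mono mult_left_mono) auto
        then have "c * ?m \<le> c * min 1 ((s * l j / (real n + 1)) powr a)"
          using c m1 by (intro mult_left_mono) auto
        also have "\<dots> \<le> tail_mass n (s * l j) (\<lambda>_. 1)"
          using j s by (intro Suc.IH s_l_ge_1) auto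
        finally show "c * ?m \<le> tail_mass n (s * l j) (\<lambda>_. 1)" .
      qed (use p_B in auto)
      also have "\<dots> \<le> (\<Sum>j\<in>B. p j * tail_mass n (s * l j) (\<lambda>_. 1))"
        using s by (intro sum_mono2) (auto intro!: mult_nonneg_nonneg p_B tail_mass_nonneg one s_l_ge_1)
      also have "\<dots> \<le> tail_mass (Suc n) s (\<lambda>_. 1)"
        unfolding eq using p_G by (auto intro!: sum_nonneg mult_nonneg_nonneg)
      finally show ?thesis .
    qed
  qed
  with c show ?thesis by blast
qed

end

subsection \<open>Logarithmic oscillation of densities\<close>

lemma le_two_powr: assumes "0 < t" "t \<le> 1" shows "t \<le> 2 powr (t - 1 :: real)"
proof -
  have "(t - 1) * 1 \<le> (t - 1) * ln 2"
    using assms ln_2_less_1 by (intro mult_left_mono_neg) auto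
  then have "t \<le> 1 + (t - 1) * ln 2" by simp
  also have "\<dots> \<le> exp ((t - 1) * ln 2)" by (rule exp_ge_add_one_self)
  finally show ?thesis by (simp add: powr_def mult.commute)
qed

text \<open>By \<open>le_two_powr\<close> at \<open>t = 1 / s\<close>, the worst case is
  \<open>s = 1\<close>. The bound is uniform in \<open>s\<close> and is the contraction gained by an
  excursion.\<close>

lemma upper_jac_le_half: assumes "s \<ge> 1" "u \<in> {0..1}" shows "upper_jac s u \<le> 1 / 2"
proof -
  have "((1 + u) / 2) powr (1 / s - 1) \<le> (1 / 2) powr (1 / s - 1)"
    using assms by (intro powr_mono2') auto
  also have "\<dots> = 1 / 2 powr (1 / s - 1)"
    by (simp add: powr_divide)
  also have "\<dots> \<le> 1 / (1 / s)"
    using le_two_powr[of "1 / s"] assms by (intro divide_left_mono) auto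
  finally have "1 / (2 * s) * ((1 + u) / 2) powr (1 / s - 1) \<le> 1 / (2 * s) * s"
    using assms by (intro mult_left_mono) auto
  then show ?thesis using assms by (simp add: upper_jac_def)
qed

lemma upper_half_contract:
  assumes s: "s \<ge> 1" and u: "u \<in> {0<..<1}" "v \<in> {0<..<1}"
  shows "\<bar>upper_half s u - upper_half s v\<bar> \<le> 1 / 2 * \<bar>u - v\<bar>"
proof -
  have "norm (upper_half s u - upper_half s v) \<le> 1 / 2 * norm (u - v)"
  proof (rule field_differentiable_bound[where S = "{0..1}" and f' = "upper_jac s"])
    fix x :: real assume x: "x \<in> {0..1}"
    show "(upper_half s has_field_derivative upper_jac s x) (at x within {0..1})"
      unfolding upper_half_def[abs_def] upper_jac_def using x s
      by (auto intro!: derivative_eq_intros simp: field_simps)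
    show "norm (upper_jac s x) \<le> 1 / 2"
      using upper_jac_le_half[OF s x] x s by (simp add: upper_jac_def)
  qed (use u in auto)
  then show ?thesis by simp
qed

lemma lower_half_contract: "s \<ge> 1 \<Longrightarrow> \<bar>lower_half s u - lower_half s v\<bar> \<le> \<bar>u - v\<bar>"
proof -
  assume s: "s \<ge> 1"
  have "\<bar>lower_half s u - lower_half s v\<bar> = 2 powr (- 1 / s) * \<bar>u - v\<bar>"
    by (simp add: lower_half_def abs_mult flip: right_diff_distrib)
  also have "\<dots> \<le> 1 * \<bar>u - v\<bar>"
    using two_powr_neg_bounds[OF s] by (intro mult_right_mono) auto
  finally show ?thesis by simp
qed

text \<open>The logarithmic derivative \<open>(1 / s - 1) / (1 + u)\<close> is at most
  \<open>1\<close> in absolute value, so branches of arbitrarily high exponent share one distortion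
  bound.\<close>

lemma upper_jac_ratio:
  assumes s: "s \<ge> 1" and u: "u \<in> {0<..<1}" "v \<in> {0<..<1}"
  shows "upper_jac s u \<le> exp \<bar>u - v\<bar> * upper_jac s v"
proof -
  let ?t = "1 - 1 / s"
  have t: "0 \<le> ?t" "?t \<le> 1" using s by auto
  have "ln ((1 + v) / 2) - ln ((1 + u) / 2) \<le> ((1 + v) / 2 - (1 + u) / 2) / ((1 + u) / 2)"
    using u by (intro ln_diff_le) auto
  also have "\<dots> = (v - u) / (1 + u)" using u by (simp add: field_simps)
  also have "\<dots> \<le> \<bar>u - v\<bar> / 1" using u by (intro frac_le) auto
  finally have "?t * (ln ((1 + v) / 2) - ln ((1 + u) / 2)) \<le> ?t * \<bar>u - v\<bar>"
    using t by (intro mult_left_mono) auto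
  also have "\<dots> \<le> 1 * \<bar>u - v\<bar>" using t by (intro mult_right_mono) auto
  finally have "(1 / s - 1) * ln ((1 + u) / 2) \<le> \<bar>u - v\<bar> + (1 / s - 1) * ln ((1 + v) / 2)"
    by (simp add: algebra_simps)
  then have "exp ((1 / s - 1) * ln ((1 + u) / 2)) \<le> exp \<bar>u - v\<bar> * exp ((1 / s - 1) * ln ((1 + v) / 2))"
    by (simp flip: exp_add)
  then have "((1 + u) / 2) powr (1 / s - 1) \<le> exp \<bar>u - v\<bar> * ((1 + v) / 2) powr (1 / s - 1)"
    using u by (simp add: powr_def)
  then have "1 / (2 * s) * ((1 + u) / 2) powr (1 / s - 1) \<le> 1 / (2 * s) * (exp \<bar>u - v\<bar> * ((1 + v) / 2) powr (1 / s - 1))"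
    using s by (intro mult_left_mono) auto
  then show ?thesis by (simp add: upper_jac_def mult_ac)
qed

text \<open>The symbolic part of \<open>phase_dist\<close>, separated because prepending a letter
  acts on it alone.\<close>

definition dw :: "(nat \<Rightarrow> nat) \<Rightarrow> (nat \<Rightarrow> nat) \<Rightarrow> real" where
  "dw \<omega> \<omega>' = (if \<omega> = \<omega>' then 0 else (1/2) ^ Suc (LEAST i. \<omega> i \<noteq> \<omega>' i))"

lemma dw_nonneg [simp]: "dw \<omega> \<omega>' \<ge> 0"
  by (simp add: dw_def)

lemma dw_le_half: "dw \<omega> \<omega>' \<le> 1 / 2"
proof -
  have "(1 / 2) * (1/2) ^ n \<le> (1 / 2) * (1::real)" for n
    by (intro mult_left_mono power_le_one) auto
  then show ?thesis by (auto simp: dw_def)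
qed

lemma dw_case_nat: "dw (case_nat j \<omega>) (case_nat j \<omega>') = dw \<omega> \<omega>' / 2"
proof (cases "\<omega> = \<omega>'")
  case False
  then have ne: "case_nat j \<omega> \<noteq> case_nat j \<omega>'"
    by (metis nat.case(2) ext)
  from False obtain n where "\<omega> n \<noteq> \<omega>' n" by auto
  then have "(LEAST i. case_nat j \<omega> i \<noteq> case_nat j \<omega>' i) = Suc (LEAST i. case_nat j \<omega> (Suc i) \<noteq> case_nat j \<omega>' (Suc i))"
    by (intro Least_Suc[of _ "Suc n"]) auto
  then show ?thesis using False ne by (simp add: dw_def)
qed (simp add: dw_def)

text \<open>Convexity of \<open>exp\<close> between \<open>0\<close> and \<open>D * x\<close>. It
  shows that subtracting a small constant raises an oscillation bound only from \<open>D - 1\<close>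
  to \<open>D\<close>.\<close>

lemma exp_interpolate:
  assumes D: "D \<ge> (1::real)" and x: "x \<ge> 0"
  shows "exp ((D - 1) * x) \<le> (1 - 1 / D) * exp (D * x) + 1 / D"
proof -
  have "exp ((1 - 1 / D) *\<^sub>R (D * x) + (1 / D) *\<^sub>R 0) \<le> (1 - 1 / D) * exp (D * x) + (1 / D) * exp 0"
    using convex_onD[OF exp_convex, of "1 / D" "D * x" 0] D by simp
  moreover have "(1 - 1 / D) * (D * x) = (D - 1) * x"
    using D by (simp add: field_simps)
  ultimately show ?thesis by (simp only: real_scaleR_def mult_zero_right add_0_right exp_zero mult_1_right)
qed

section \<open>Regularity classes under the excursion operators\<close>

context random_map
begin

abbreviation "\<Omega>N \<equiv> (UNIV :: nat set) \<rightarrow> {1..N}"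

text \<open>The term with factor \<open>E\<close> is the distortion of the branches; it is absorbed into the first term once the
  contraction factor \<open>1/2\<close> of a full excursion has been gained.\<close>

definition reg :: "real \<Rightarrow> real \<Rightarrow> real \<Rightarrow> real \<Rightarrow> real \<Rightarrow> ((nat \<Rightarrow> nat) \<times> real \<Rightarrow> real) \<Rightarrow> bool" where
  "reg \<alpha> c e D E H \<longleftrightarrow> nonneg H \<and> (\<forall>\<omega>\<in>\<Omega>N. \<forall>\<omega>'\<in>\<Omega>N. \<forall>u\<in>{0<..<1}. \<forall>v\<in>{0<..<1}.
     H (\<omega>, u) \<le> exp (D * (c * dw \<omega> \<omega>' + e * \<bar>u - v\<bar>) powr \<alpha> + E * \<bar>u - v\<bar>) * H (\<omega>', v))"

lemma regD: "reg \<alpha> c e D E H \<Longrightarrow> \<omega> \<in> \<Omega>N \<Longrightarrow> \<omega>' \<in> \<Omega>N \<Longrightarrow> u \<in> {0<..<1} \<Longrightarrow> v \<in> {0<..<1} \<Longrightarrow>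
     H (\<omega>, u) \<le> exp (D * (c * dw \<omega> \<omega>' + e * \<bar>u - v\<bar>) powr \<alpha> + E * \<bar>u - v\<bar>) * H (\<omega>', v)"
  unfolding reg_def by blast

lemma reg_nonneg: "reg \<alpha> c e D E H \<Longrightarrow> nonneg H"
  by (simp add: reg_def)

lemma nonnegD: "nonneg H \<Longrightarrow> \<omega> \<in> \<Omega>N \<Longrightarrow> u \<in> {0<..<1} \<Longrightarrow> 0 \<le> H (\<omega>, u)"
  by (simp add: nonneg_def space_SU)

lemma reg_mono:
  assumes "reg \<alpha> c e D E H" "0 \<le> c" "0 \<le> e" "c \<le> c'" "e \<le> e'" "D \<le> D'" "E \<le> E'" "0 \<le> D" "0 \<le> \<alpha>"
  shows "reg \<alpha> c' e' D' E' H"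
  unfolding reg_def
proof (intro conjI ballI)
  show "nonneg H" using assms(1) by (rule reg_nonneg)
  fix \<omega> \<omega>' u v assume *: "\<omega> \<in> \<Omega>N" "\<omega>' \<in> \<Omega>N" "u \<in> {0<..<1::real}" "v \<in> {0<..<1::real}"
  have "D * (c * dw \<omega> \<omega>' + e * \<bar>u - v\<bar>) powr \<alpha> + E * \<bar>u - v\<bar> \<le>
      D' * (c' * dw \<omega> \<omega>' + e' * \<bar>u - v\<bar>) powr \<alpha> + E' * \<bar>u - v\<bar>"
    using assms
    by (intro add_mono mult_right_mono[OF assms(7)] mult_mono powr_mono2 mult_nonneg_nonneg add_nonneg_nonneg) auto
  then have "exp (D * (c * dw \<omega> \<omega>' + e * \<bar>u - v\<bar>) powr \<alpha> + E * \<bar>u - v\<bar>) * H (\<omega>', v) \<le>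
     exp (D' * (c' * dw \<omega> \<omega>' + e' * \<bar>u - v\<bar>) powr \<alpha> + E' * \<bar>u - v\<bar>) * H (\<omega>', v)"
    using nonnegD[OF reg_nonneg[OF assms(1)], of \<omega>' v] * by (intro mult_right_mono) auto
  then show "H (\<omega>, u) \<le> exp (D' * (c' * dw \<omega> \<omega>' + e' * \<bar>u - v\<bar>) powr \<alpha> + E' * \<bar>u - v\<bar>) * H (\<omega>', v)"
    using regD[OF assms(1) *] by linarith
qed

lemma reg_pre:
  assumes "reg \<alpha> c e D E H" "j \<in> {1..N}"
  shows "reg \<alpha> (c / 2) e D E (pre j H)"
  unfolding reg_def
proof (intro conjI ballI)
  show "nonneg (pre j H)" using assms reg_nonneg nonneg_pre by blast
  fix \<omega> \<omega>' u v assume *: "\<omega> \<in> \<Omega>N" "\<omega>' \<in> \<Omega>N" "u \<in> {0<..<1::real}" "v \<in> {0<..<1::real}"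
  show "pre j H (\<omega>, u) \<le> exp (D * (c / 2 * dw \<omega> \<omega>' + e * \<bar>u - v\<bar>) powr \<alpha> + E * \<bar>u - v\<bar>) * pre j H (\<omega>', v)"
    using regD[OF assms(1) case_nat_space[OF assms(2) *(1)] case_nat_space[OF assms(2) *(2)] *(3,4)]
    by (simp add: pre_def dw_case_nat)
qed

lemma reg_comb:
  assumes "\<And>i. i \<in> S \<Longrightarrow> reg \<alpha> c e D E (H i)" "\<And>i. i \<in> S \<Longrightarrow> w i \<ge> 0"
  shows "reg \<alpha> c e D E (\<lambda>z. \<Sum>i\<in>S. w i * H i z)"
  unfolding reg_def
proof (intro conjI ballI)
  show "nonneg (\<lambda>z. \<Sum>i\<in>S. w i * H i z)"
    using assms(2) reg_nonneg[OF assms(1)] unfolding nonneg_def by (auto intro!: sum_nonneg mult_nonneg_nonneg)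
  fix \<omega> \<omega>' u v assume *: "\<omega> \<in> \<Omega>N" "\<omega>' \<in> \<Omega>N" "u \<in> {0<..<1::real}" "v \<in> {0<..<1::real}"
  have "(\<Sum>i\<in>S. w i * H i (\<omega>, u)) \<le>
     (\<Sum>i\<in>S. w i * (exp (D * (c * dw \<omega> \<omega>' + e * \<bar>u - v\<bar>) powr \<alpha> + E * \<bar>u - v\<bar>) * H i (\<omega>', v)))"
    using assms * by (intro sum_mono mult_left_mono regD) auto
  then show "(\<Sum>i\<in>S. w i * H i (\<omega>, u)) \<le>
     exp (D * (c * dw \<omega> \<omega>' + e * \<bar>u - v\<bar>) powr \<alpha> + E * \<bar>u - v\<bar>) * (\<Sum>i\<in>S. w i * H i (\<omega>', v))"
    unfolding sum_distrib_left by (simp only: mult.left_commute)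
qed

lemma reg_add:
  assumes "reg \<alpha> c e D E H1" "reg \<alpha> c e D E H2"
  shows "reg \<alpha> c e D E (\<lambda>z. H1 z + H2 z)"
  using reg_comb[of "{0::nat, 1}" \<alpha> c e D E "\<lambda>i. if i = 0 then H1 else H2" "\<lambda>_. 1"] assms by simp

lemma reg_letters:
  assumes "\<And>b. b \<in> B \<Longrightarrow> reg \<alpha> c e D E (X b)" "\<And>g. g \<in> G \<Longrightarrow> reg \<alpha> c e D E (Y g)"
  shows "reg \<alpha> c e D E (\<lambda>z. (\<Sum>b\<in>B. p b * X b z) + (\<Sum>g\<in>G. p g * Y g z))"
  by (intro reg_add reg_comb assms p_B p_G)

lemma reg_Nn:
  assumes "reg \<alpha> c e D E H" "0 \<le> c" "0 \<le> e" "0 \<le> D" "0 \<le> \<alpha>"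
  shows "reg \<alpha> c e D E (Nn H)"
  unfolding Nn_def using assms
  by (intro reg_comb p_nonneg reg_mono[OF reg_pre[OF assms(1)]]) auto

text \<open>The contraction of the lower branch tends to \<open>1\<close> as \<open>s\<close> grows,
  so nothing is gained; being linear, the branch has no distortion either.\<close>

lemma reg_K:
  assumes "reg \<alpha> c e D 0 H" "s \<ge> 1" "0 \<le> c" "0 \<le> e" "0 \<le> D" "0 \<le> \<alpha>"
  shows "reg \<alpha> c e D 0 (K s H)"
  unfolding reg_def
proof (intro conjI ballI)
  show "nonneg (K s H)" using assms reg_nonneg nonneg_K by blast
  fix \<omega> \<omega>' u v assume *: "\<omega> \<in> \<Omega>N" "\<omega>' \<in> \<Omega>N" "u \<in> {0<..<1::real}" "v \<in> {0<..<1::real}"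
  have "H (\<omega>, lower_half s u) \<le> exp (D * (c * dw \<omega> \<omega>' + e * \<bar>lower_half s u - lower_half s v\<bar>) powr \<alpha> + 0 * \<bar>lower_half s u - lower_half s v\<bar>) * H (\<omega>', lower_half s v)"
    by (intro regD[OF assms(1)] * lower_half_range assms)
  also have "\<dots> \<le> exp (D * (c * dw \<omega> \<omega>' + e * \<bar>u - v\<bar>) powr \<alpha> + 0 * \<bar>u - v\<bar>) * H (\<omega>', lower_half s v)"
  proof (rule mult_right_mono)
    show "0 \<le> H (\<omega>', lower_half s v)"
      using nonnegD[OF reg_nonneg[OF assms(1)] *(2) lower_half_range[OF assms(2) *(4)]] .
    have "(c * dw \<omega> \<omega>' + e * \<bar>lower_half s u - lower_half s v\<bar>) powr \<alpha> \<le> (c * dw \<omega> \<omega>' + e * \<bar>u - v\<bar>) powr \<alpha>"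
      using assms lower_half_contract[OF assms(2), of u v]
      by (intro powr_mono2 add_mono mult_left_mono add_nonneg_nonneg mult_nonneg_nonneg) auto
    then show "exp (D * (c * dw \<omega> \<omega>' + e * \<bar>lower_half s u - lower_half s v\<bar>) powr \<alpha> + 0 * \<bar>lower_half s u - lower_half s v\<bar>) \<le>
        exp (D * (c * dw \<omega> \<omega>' + e * \<bar>u - v\<bar>) powr \<alpha> + 0 * \<bar>u - v\<bar>)"
      using assms(5) by (simp add: mult_left_mono)
  qed
  finally have "2 powr (- 1 / s) * H (\<omega>, lower_half s u) \<le>
      2 powr (- 1 / s) * (exp (D * (c * dw \<omega> \<omega>' + e * \<bar>u - v\<bar>) powr \<alpha> + 0 * \<bar>u - v\<bar>) * H (\<omega>', lower_half s v))"
    by (intro mult_left_mono) auto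
  then show "K s H (\<omega>, u) \<le> exp (D * (c * dw \<omega> \<omega>' + e * \<bar>u - v\<bar>) powr \<alpha> + 0 * \<bar>u - v\<bar>) * K s H (\<omega>', v)"
    by (simp add: K_def mult_ac)
qed

text \<open>The upper branch halves the distance in \<open>u\<close> and is the only source of
  distortion, recorded by the \<open>1\<close> in the place of \<open>E\<close>.\<close>

lemma reg_J:
  assumes "reg \<alpha> c 1 D 0 H" "s \<ge> 1" "0 \<le> c" "0 \<le> D" "0 \<le> \<alpha>"
  shows "reg \<alpha> c (1/2) D 1 (J s H)"
  unfolding reg_def
proof (intro conjI ballI)
  show "nonneg (J s H)" using assms reg_nonneg nonneg_J by blast
  fix \<omega> \<omega>' u v assume *: "\<omega> \<in> \<Omega>N" "\<omega>' \<in> \<Omega>N" "u \<in> {0<..<1::real}" "v \<in> {0<..<1::real}"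
  have Hv: "0 \<le> H (\<omega>', upper_half s v)"
    using nonnegD[OF reg_nonneg[OF assms(1)] *(2) upper_half_range[OF assms(2) *(4)]] .
  let ?e = "exp (D * (c * dw \<omega> \<omega>' + 1/2 * \<bar>u - v\<bar>) powr \<alpha>)"
  have "H (\<omega>, upper_half s u) \<le> exp (D * (c * dw \<omega> \<omega>' + 1 * \<bar>upper_half s u - upper_half s v\<bar>) powr \<alpha> + 0 * \<bar>upper_half s u - upper_half s v\<bar>) * H (\<omega>', upper_half s v)"
    by (intro regD[OF assms(1)] * upper_half_range assms)
  also have "\<dots> \<le> ?e * H (\<omega>', upper_half s v)"
  proof (rule mult_right_mono[OF _ Hv])
    have "(c * dw \<omega> \<omega>' + 1 * \<bar>upper_half s u - upper_half s v\<bar>) powr \<alpha> \<le> (c * dw \<omega> \<omega>' + 1/2 * \<bar>u - v\<bar>) powr \<alpha>"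
      using assms upper_half_contract[OF assms(2) *(3,4)]
      by (intro powr_mono2 add_mono add_nonneg_nonneg mult_nonneg_nonneg) auto
    then show "exp (D * (c * dw \<omega> \<omega>' + 1 * \<bar>upper_half s u - upper_half s v\<bar>) powr \<alpha> + 0 * \<bar>upper_half s u - upper_half s v\<bar>) \<le> ?e"
      using assms(4) by (simp add: mult_left_mono)
  qed
  finally have "H (\<omega>, upper_half s u) * upper_jac s u \<le> (?e * H (\<omega>', upper_half s v)) * (exp \<bar>u - v\<bar> * upper_jac s v)"
    using Hv upper_jac_bounds[OF assms(2) *(3)] upper_jac_ratio[OF assms(2) *(3,4)] by (intro mult_mono) auto
  then show "J s H (\<omega>, u) \<le> exp (D * (c * dw \<omega> \<omega>' + 1/2 * \<bar>u - v\<bar>) powr \<alpha> + 1 * \<bar>u - v\<bar>) * J s H (\<omega>', v)"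
    by (simp add: J_def exp_add mult_ac)
qed

lemma reg_KN_pow:
  assumes "reg \<alpha> c e D 0 H" "s \<ge> 1" "0 \<le> c" "0 \<le> e" "0 \<le> D" "0 \<le> \<alpha>"
  shows "reg \<alpha> c e D 0 ((KN s ^^ i) H)"
proof (induction i)
  case (Suc i)
  have "reg \<alpha> c e D 0 (KN s ((KN s ^^ i) H))"
    unfolding KN_def[of s "(KN s ^^ i) H" for i] by (intro reg_Nn reg_K Suc assms)
  then show ?case by simp
qed (use assms in simp)

text \<open>An excursion uses at least one letter, which halves the distance of the sequences, and
  ends with the upper branch, which halves that of the points. Everything in between only has to do
  no harm.\<close>

lemma reg_RA_YA:
  assumes "reg \<alpha> 1 1 D 0 H" "s \<ge> 1" "0 \<le> D" "0 \<le> \<alpha>"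
  shows "reg \<alpha> (1/2) (1/2) D 1 (RA n s H)" "reg \<alpha> (1/2) (1/2) D 1 (YA n s H)"
proof -
  have zero: "reg \<alpha> (1/2) (1/2) D 1 (\<lambda>z. 0)" by (simp add: reg_def nonneg_def)
  have "reg \<alpha> (1/2) (1/2) D 1 (RA n s H) \<and> reg \<alpha> (1/2) (1/2) D 1 (YA n s H)"
    using assms
  proof (induction n arbitrary: s H)
    case 0
    show ?case using zero by simp
  next
    case (Suc n)
    have pj: "reg \<alpha> (1/2) 1 D 0 (pre j H)" if "j \<in> {1..N}" for j
      using reg_pre[OF Suc.prems(1) that] by simp
    have pj1: "reg \<alpha> 1 1 D 0 (pre b H)" if "b \<in> B" for b
      using Suc.prems by (intro reg_mono[OF pj[OF letter_B[OF that]]]) auto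
    have RB: "reg \<alpha> (1/2) (1/2) D 1 (RB n (s * r g) (pre g H))"
      and YB: "reg \<alpha> (1/2) (1/2) D 1 (YB n (s * r g) (pre g H))" if "g \<in> G" for g
      unfolding RB_def YB_def
      by (intro reg_J reg_K reg_KN_pow pj letter_G that s_r_ge_1 Suc.prems; simp)+
    have "reg \<alpha> (1/2) (1/2) D 1 (RA n (s * l b) (pre b H))" "reg \<alpha> (1/2) (1/2) D 1 (YA n (s * l b) (pre b H))"
      if "b \<in> B" for b
      using Suc.IH[OF pj1[OF that] s_l_ge_1[OF Suc.prems(2) that] Suc.prems(3,4)] by auto
    then show ?case
      unfolding RA.simps YA.simps by (intro conjI reg_letters RB YB)
  qed
  then show "reg \<alpha> (1/2) (1/2) D 1 (RA n s H)" "reg \<alpha> (1/2) (1/2) D 1 (YA n s H)" by auto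
qed

text \<open>Since \<open>\<bar>u - v\<bar> \<le> \<bar>u - v\<bar> powr \<alpha>\<close> on the unit
  interval, the distortion costs the summand \<open>1\<close>, while halving the distance gains the
  factor \<open>2 powr (- \<alpha>)\<close>.\<close>

lemma reg_contract:
  assumes H: "reg \<alpha> (1/2) (1/2) D 1 H" and \<alpha>: "0 < \<alpha>" "\<alpha> < 1" and D: "0 \<le> D"
  shows "reg \<alpha> 1 1 (D * 2 powr (- \<alpha>) + 1) 0 H"
  unfolding reg_def
proof (intro conjI ballI)
  show "nonneg H" using H by (rule reg_nonneg)
  fix \<omega> \<omega>' u v assume *: "\<omega> \<in> \<Omega>N" "\<omega>' \<in> \<Omega>N" "u \<in> {0<..<1::real}" "v \<in> {0<..<1::real}"
  let ?d = "1 * dw \<omega> \<omega>' + 1 * \<bar>u - v\<bar>"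
  have "(1/2 * dw \<omega> \<omega>' + 1/2 * \<bar>u - v\<bar>) powr \<alpha> = (?d / 2) powr \<alpha>"
    by (simp add: add_divide_distrib)
  also have "\<dots> = 2 powr (- \<alpha>) * ?d powr \<alpha>"
    by (simp add: powr_divide powr_minus field_simps)
  finally have 1: "(1/2 * dw \<omega> \<omega>' + 1/2 * \<bar>u - v\<bar>) powr \<alpha> = 2 powr (- \<alpha>) * ?d powr \<alpha>" .
  have "\<bar>u - v\<bar> \<le> \<bar>u - v\<bar> powr \<alpha>"
  proof (cases "u = v")
    case False
    then show ?thesis
      using * \<alpha> powr_mono'[of \<alpha> 1 "\<bar>u - v\<bar>"] by auto
  qed simp
  also have "\<dots> \<le> ?d powr \<alpha>" using \<alpha> by (intro powr_mono2) auto
  finally have "D * (1/2 * dw \<omega> \<omega>' + 1/2 * \<bar>u - v\<bar>) powr \<alpha> + 1 * \<bar>u - v\<bar> \<le> (D * 2 powr (- \<alpha>) + 1) * ?d powr \<alpha>"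
    unfolding 1 by (simp add: algebra_simps)
  then have "exp (D * (1/2 * dw \<omega> \<omega>' + 1/2 * \<bar>u - v\<bar>) powr \<alpha> + 1 * \<bar>u - v\<bar>) * H (\<omega>', v) \<le>
      exp ((D * 2 powr (- \<alpha>) + 1) * ?d powr \<alpha> + 0 * \<bar>u - v\<bar>) * H (\<omega>', v)"
    using nonnegD[OF reg_nonneg[OF H] *(2,4)] by (intro mult_right_mono) auto
  then show "H (\<omega>, u) \<le> exp ((D * 2 powr (- \<alpha>) + 1) * ?d powr \<alpha> + 0 * \<bar>u - v\<bar>) * H (\<omega>', v)"
    using regD[OF H *] by linarith
qed

text \<open>\<open>exp_interpolate\<close> leaves a surplus
  \<open>(exp (D * x) - 1) * (h / D)\<close>, which covers the loss
  \<open>(exp (D * x) - 1) * c\<close> because \<open>D * c \<le> h\<close>.\<close>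

lemma reg_diff_const:
  assumes H: "reg \<alpha> 1 1 (D - 1) 0 H" and D: "D \<ge> 1" and c: "c \<ge> 0"
    "\<And>z. z \<in> space SU \<Longrightarrow> D * c \<le> H z"
  shows "reg \<alpha> 1 1 D 0 (\<lambda>z. H z - c)"
  unfolding reg_def
proof (intro conjI ballI)
  have "c \<le> D * c" using mult_right_mono[OF D c(1)] by simp
  then show "nonneg (\<lambda>z. H z - c)" using c(2) unfolding nonneg_def by fastforce
  fix \<omega> \<omega>' u v assume *: "\<omega> \<in> \<Omega>N" "\<omega>' \<in> \<Omega>N" "u \<in> {0<..<1::real}" "v \<in> {0<..<1::real}"
  define x where "x = (1 * dw \<omega> \<omega>' + 1 * \<bar>u - v\<bar>) powr \<alpha>"
  have x: "x \<ge> 0" by (simp add: x_def)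
  define h where "h = H (\<omega>', v)"
  have h: "c \<le> h / D" using c(2)[of "(\<omega>', v)"] * D by (simp add: h_def space_SU field_simps)
  have h0: "h \<ge> 0" using nonnegD[OF reg_nonneg[OF H] *(2,4)] by (simp add: h_def)
  have "H (\<omega>, u) \<le> exp ((D - 1) * x) * h"
    using regD[OF H *] by (simp add: x_def h_def)
  also have "\<dots> \<le> ((1 - 1 / D) * exp (D * x) + 1 / D) * h"
    using exp_interpolate[OF D x] h0 by (intro mult_right_mono)
  also have "\<dots> = exp (D * x) * h - (exp (D * x) - 1) * (h / D)"
    by (simp add: algebra_simps diff_divide_distrib)
  also have "\<dots> \<le> exp (D * x) * h - (exp (D * x) - 1) * c"
    using h D x by (intro diff_left_mono mult_left_mono) auto
  finally show "H (\<omega>, u) - c \<le> exp (D * (1 * dw \<omega> \<omega>' + 1 * \<bar>u - v\<bar>) powr \<alpha> + 0 * \<bar>u - v\<bar>) * (H (\<omega>', v) - c)"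
    by (simp add: x_def h_def algebra_simps)
qed

lemma reg_ratio:
  assumes H: "reg \<alpha> 1 1 D 0 H" and D: "D \<ge> 0" and \<alpha>: "0 < \<alpha>" "\<alpha> < 1" and z: "z \<in> space SU" "z' \<in> space SU"
  shows "H z \<le> exp (2 * D) * H z'"
proof -
  obtain \<omega> u \<omega>' v where zz: "z = (\<omega>, u)" "z' = (\<omega>', v)" by (metis surj_pair)
  then have *: "\<omega> \<in> \<Omega>N" "\<omega>' \<in> \<Omega>N" "u \<in> {0<..<1}" "v \<in> {0<..<1}" using z by (auto simp: space_SU)
  have "(1 * dw \<omega> \<omega>' + 1 * \<bar>u - v\<bar>) powr \<alpha> \<le> 2 powr \<alpha>"
    using dw_le_half[of \<omega> \<omega>'] * \<alpha> by (intro powr_mono2) auto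
  also have "\<dots> \<le> 2 powr 1" using \<alpha> by (intro powr_mono) auto
  finally have "exp (D * (1 * dw \<omega> \<omega>' + 1 * \<bar>u - v\<bar>) powr \<alpha> + 0 * \<bar>u - v\<bar>) \<le> exp (2 * D)"
    using mult_left_mono[OF _ D] by (fastforce simp: mult.commute)
  then have "exp (D * (1 * dw \<omega> \<omega>' + 1 * \<bar>u - v\<bar>) powr \<alpha> + 0 * \<bar>u - v\<bar>) * H z' \<le> exp (2 * D) * H z'"
    using nonnegD[OF reg_nonneg[OF H] *(2,4)] zz by (intro mult_right_mono) auto
  then show ?thesis using regD[OF H *] zz by simp
qed

lemma reg_bounds:
  assumes H: "reg \<alpha> 1 1 D 0 H" "bmeas SU H" and D: "D \<ge> 0" and \<alpha>: "0 < \<alpha>" "\<alpha> < 1" and z: "z \<in> space SU"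
  shows "H z \<le> exp (2 * D) * I H" "I H \<le> exp (2 * D) * H z"
proof -
  have "I (\<lambda>_. H z) \<le> I (\<lambda>z'. exp (2 * D) * H z')"
    using reg_ratio[OF H(1) D \<alpha> z] H(2) by (intro I_mono) auto
  then show "H z \<le> exp (2 * D) * I H" by (simp add: I_cmult)
  have "I H \<le> I (\<lambda>_. exp (2 * D) * H z)"
    using reg_ratio[OF H(1) D \<alpha> _ z] H(2) by (intro I_mono) auto
  then show "I H \<le> exp (2 * D) * H z" by simp
qed

end

subsection \<open>Regeneration for the random map\<close>

locale mixing_map = random_map +
  fixes \<alpha> q0 q :: real
  assumes \<alpha>: "0 < \<alpha>" "\<alpha> < 1" and q: "1 < q" "q < q0"
    and moment: "(\<Sum>b\<in>B. p b * l b powr q0) < 1" and G_nonempty: "G \<noteq> {}"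
begin

text \<open>\<open>D0\<close> is chosen such that a return turns the bound \<open>D0\<close> on the oscillation into \<open>D0 - 1\<close>; the gain is what allows
  subtracting the fraction \<open>\<delta>\<close>.\<close>

definition D0 where "D0 = 2 / (1 - 2 powr (- \<alpha>))"
text \<open>Equivalently \<open>D0 * \<delta> = exp (- 2 * D0)\<close>, which is what
  \<open>reg_diff_const\<close> asks for: a density of the cone is everywhere at least
  \<open>exp (- 2 * D0)\<close> times its mass.\<close>

definition \<delta> where "\<delta> = exp (- 2 * D0) / D0"
definition Cone where "Cone = {H. bmeas SU H \<and> reg \<alpha> 1 1 D0 0 H}"
definition Q where "Q i H = (\<lambda>z. RA i 1 H z - \<delta> * I (RA i 1 H))"
text \<open>A constant of the context, because the parameter \<open>C1\<close> of the interpretation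
  of \<open>regeneration\<close> below has to be a term.\<close>

definition Cu where "Cu = (SOME C. C > 0 \<and> (\<forall>n s H c. s \<ge> 1 \<longrightarrow> bmeas SU H \<longrightarrow> nonneg H \<longrightarrow>
    (\<forall>z\<in>space SU. H z \<le> c) \<longrightarrow> tail_mass n s H \<le> c * C * s powr q0 * wt q0 n))"

lemma two_powr_\<alpha>: "0 < 2 powr (- \<alpha>)" "2 powr (- \<alpha>) < 1"
  using \<alpha> by (auto intro!: powr_less_one)

lemma D0: "D0 \<ge> 2" "D0 * 2 powr (- \<alpha>) + 1 = D0 - 1"
proof -
  have "2 * (1 - 2 powr (- \<alpha>)) \<le> 2" using two_powr_\<alpha>(1) by simp
  then show "D0 \<ge> 2" unfolding D0_def using two_powr_\<alpha>(2) by (subst pos_le_divide_eq) auto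
  have "0 < 1 - 2 powr (- \<alpha>)" using two_powr_\<alpha>(2) by linarith
  then have "D0 * (1 - 2 powr (- \<alpha>)) = 2" by (metis D0_def less_irrefl nonzero_eq_divide_eq)
  then show "D0 * 2 powr (- \<alpha>) + 1 = D0 - 1" by (simp add: algebra_simps)
qed

lemma D0_\<delta>: "D0 * \<delta> = exp (- 2 * D0)" using D0 by (simp add: \<delta>_def)

lemma \<delta>_bounds: "0 < \<delta>" "\<delta> < 1"
proof -
  show "0 < \<delta>" using D0 by (simp add: \<delta>_def)
  have "exp (- 2 * D0) \<le> 1" using D0 by simp
  also have "1 < D0" using D0 by simp
  finally show "\<delta> < 1" using D0 by (simp add: \<delta>_def)
qed

lemma Cone_bmeas: "H \<in> Cone \<Longrightarrow> bmeas SU H" by (simp add: Cone_def)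
lemma Cone_reg: "H \<in> Cone \<Longrightarrow> reg \<alpha> 1 1 D0 0 H" by (simp add: Cone_def)
lemma Cone_nonneg: "H \<in> Cone \<Longrightarrow> nonneg H" using Cone_reg reg_nonneg by blast

lemma reg_half_imp: "reg \<alpha> (1/2) (1/2) D0 1 H \<Longrightarrow> reg \<alpha> 1 1 (D0 - 1) 0 H"
  using reg_contract[of \<alpha> D0 H] \<alpha> D0 by simp

lemma reg_minus1_imp: "reg \<alpha> 1 1 (D0 - 1) 0 H \<Longrightarrow> reg \<alpha> 1 1 D0 0 H"
  using D0 \<alpha> by (elim reg_mono) auto

lemma reg_half_Cone: "bmeas SU H \<Longrightarrow> reg \<alpha> (1/2) (1/2) D0 1 H \<Longrightarrow> H \<in> Cone"
  unfolding Cone_def using reg_minus1_imp reg_half_imp by blast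

lemma RA_reg: "H \<in> Cone \<Longrightarrow> reg \<alpha> (1/2) (1/2) D0 1 (RA i 1 H)"
  and YA_reg: "H \<in> Cone \<Longrightarrow> reg \<alpha> (1/2) (1/2) D0 1 (YA i 1 H)"
  using reg_RA_YA[of \<alpha> D0 H 1 i] D0 \<alpha> Cone_reg by auto

lemma RA_bmeas1: "H \<in> Cone \<Longrightarrow> bmeas SU (RA i 1 H)"
  and YA_bmeas1: "H \<in> Cone \<Longrightarrow> bmeas SU (YA i 1 H)"
  using RA_bmeas[OF Cone_bmeas, of H 1 i] YA_bmeas[OF Cone_bmeas, of H 1 i] by auto

lemma RA_Cone: "H \<in> Cone \<Longrightarrow> RA i 1 H \<in> Cone"
  by (rule reg_half_Cone[OF RA_bmeas1 RA_reg])

lemma Cone_bounds: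
  assumes "H \<in> Cone" "z \<in> space SU" shows "H z \<le> exp (2 * D0) * I H" "I H \<le> exp (2 * D0) * H z"
  using reg_bounds[OF Cone_reg Cone_bmeas, OF assms(1) assms(1) _ \<alpha> assms(2)] D0 by auto

lemma I_Cone_nonneg: "H \<in> Cone \<Longrightarrow> I H \<ge> 0"
  by (intro I_nonneg' Cone_nonneg)

lemma Q_Cone: assumes H: "H \<in> Cone" shows "Q i H \<in> Cone"
  unfolding Cone_def
proof (intro CollectI conjI)
  show "bmeas SU (Q i H)" unfolding Q_def by (intro bmeas_diff RA_bmeas1 H bmeas_const)
  show "reg \<alpha> 1 1 D0 0 (Q i H)" unfolding Q_def
  proof (rule reg_diff_const)
    show "reg \<alpha> 1 1 (D0 - 1) 0 (RA i 1 H)" by (intro reg_half_imp RA_reg H)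
    show "1 \<le> D0" using D0 by simp
    show "0 \<le> \<delta> * I (RA i 1 H)" using \<delta>_bounds I_Cone_nonneg[OF RA_Cone[OF H]] by simp
    fix z assume z: "z \<in> space SU"
    have "exp (- 2 * D0) * I (RA i 1 H) \<le> exp (- 2 * D0) * (exp (2 * D0) * RA i 1 H z)"
      using Cone_bounds(2)[OF RA_Cone[OF H] z] by (intro mult_left_mono) auto
    also have "\<dots> = RA i 1 H z" by (simp flip: exp_add mult.assoc)
    finally show "D0 * (\<delta> * I (RA i 1 H)) \<le> RA i 1 H z" by (simp add: D0_\<delta> flip: mult.assoc)
  qed
qed

lemma Cu: "Cu > 0" "s \<ge> 1 \<Longrightarrow> bmeas SU H \<Longrightarrow> nonneg H \<Longrightarrow> (\<And>z. z \<in> space SU \<Longrightarrow> H z \<le> c) \<Longrightarrow>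
    tail_mass n s H \<le> c * Cu * s powr q0 * wt q0 n"
proof -
  have "Cu > 0 \<and> (\<forall>n s H c. s \<ge> 1 \<longrightarrow> bmeas SU H \<longrightarrow> nonneg H \<longrightarrow>
    (\<forall>z\<in>space SU. H z \<le> c) \<longrightarrow> tail_mass n s H \<le> c * Cu * s powr q0 * wt q0 n)"
    unfolding Cu_def by (rule someI_ex) (rule tail_mass_upper[OF _ moment], use q in auto)
  then show "Cu > 0" "s \<ge> 1 \<Longrightarrow> bmeas SU H \<Longrightarrow> nonneg H \<Longrightarrow> (\<And>z. z \<in> space SU \<Longrightarrow> H z \<le> c) \<Longrightarrow>
    tail_mass n s H \<le> c * Cu * s powr q0 * wt q0 n" by blast+
qed

lemma reg_const: "c \<ge> 0 \<Longrightarrow> 0 \<le> D \<Longrightarrow> 0 \<le> E \<Longrightarrow> reg \<beta> a e D E (\<lambda>_. c)"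
  unfolding reg_def by (auto simp: nonneg_def intro!: mult_right_mono[of 1 _ c, simplified])

lemma const_Cone: "c \<ge> 0 \<Longrightarrow> (\<lambda>_. c) \<in> Cone"
  unfolding Cone_def using D0 by (auto intro!: reg_const)

text \<open>A good letter sends the points with \<open>u powr (r g) > 1/2\<close> back to the left
  half in one step. This is the source of aperiodicity.\<close>

lemma I_RA_1_pos: "I (RA 1 1 (\<lambda>_. 1)) > 0"
proof -
  have "I (RB 0 s (\<lambda>_. 1)) > 0" if s: "s \<ge> 1" for s
  proof -
    have "I (K s (\<lambda>_. 1)) = 2 powr (- 1 / s)" by (simp add: K_def)
    then have "I (RB 0 s (\<lambda>_. 1)) = 1 - 2 powr (- 1 / s)"
      using I_change[OF s, of "\<lambda>_. 1"] by (simp add: RB_def)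
    then show ?thesis using two_powr_neg_bounds[OF s] by simp
  qed
  then have "(\<Sum>g\<in>G. p g * I (RB 0 (1 * r g) (\<lambda>_. 1))) > 0"
    using G_nonempty p_pos letter_G r_ge_1 by (intro sum_pos mult_pos_pos) auto
  then show ?thesis
    using I_RA_Suc[of "\<lambda>_. 1" 1 0] by simp
qed

text \<open>The tail constant is \<open>exp (2 * D0) * Cu\<close>, because a density of the cone is
  bounded by \<open>exp (2 * D0)\<close> times its mass.\<close>

sublocale rg: regeneration Cone I "\<lambda>i. RA i 1" Q "\<lambda>_. 1" \<delta> q0 q "exp (2 * D0) * Cu"
proof
  show "(\<lambda>_. 1) \<in> Cone" by (rule const_Cone) simp
  show "I (\<lambda>_. 1) = 1" by simp
  show "0 \<le> I H" if "H \<in> Cone" for H using that by (rule I_Cone_nonneg)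
  show "0 \<le> I (RA i 1 H)" if "H \<in> Cone" for H i using that by (intro I_Cone_nonneg RA_Cone)
  show "Q i H \<in> Cone" if "H \<in> Cone" for H i using that by (rule Q_Cone)
  show "I (Q i H) = (1 - \<delta>) * I (RA i 1 H)" if "H \<in> Cone" for H i
    unfolding Q_def using RA_bmeas1[OF that] by (subst I_diff) (auto simp: algebra_simps)
  show "(\<Sum>i=1..n. I (RA i 1 H)) \<le> I H" if "H \<in> Cone" for H n
    using tail_mass_nonneg[OF Cone_bmeas[OF that] Cone_nonneg[OF that], of 1 n] by (simp add: tail_mass_def)
  show "I H - (\<Sum>i=1..n. I (RA i 1 H)) \<le> exp (2 * D0) * Cu * I H * wt q0 n" if "H \<in> Cone" for H n
    using Cu(2)[OF _ Cone_bmeas[OF that] Cone_nonneg[OF that] Cone_bounds(1)[OF that], of 1 n]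
    by (simp add: tail_mass_def mult_ac)
qed (use \<delta>_bounds q I_RA_1_pos in auto)

text \<open>The density behind the boundary term \<open>W\<close>: on \<open>(1/2, 3/4)\<close> at
  time \<open>n\<close>, with no regeneration so far. Keeping densities instead of integrals against
  one \<open>f\<close> is what later yields the density of \<open>\<mu>\<close>.\<close>

function Wd :: "nat \<Rightarrow> ((nat \<Rightarrow> nat) \<times> real \<Rightarrow> real) \<Rightarrow> (nat \<Rightarrow> nat) \<times> real \<Rightarrow> real" where
  "Wd n H z = YA n 1 H z + (\<Sum>i=1..n. Wd (n - i) (Q i H) z)"
  by auto
termination by (relation "inv_image less_than fst") auto

declare Wd.simps [simp del]

lemma Wd_eq: "Wd n H = (\<lambda>z. YA n 1 H z + (\<Sum>i=1..n. 1 * Wd (n - i) (Q i H) z))"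
  by (rule ext, subst Wd.simps) simp

lemma Wd_bmeas: "H \<in> Cone \<Longrightarrow> bmeas SU (Wd n H)"
proof (induction n arbitrary: H rule: less_induct)
  case (less n)
  show ?case
    by (subst Wd_eq, intro bmeas_add bmeas_sum bmeas_cmult YA_bmeas1 less.prems less.IH Q_Cone) auto
qed

lemma Wd_reg: "H \<in> Cone \<Longrightarrow> reg \<alpha> 1 1 (D0 - 1) 0 (Wd n H)"
proof (induction n arbitrary: H rule: less_induct)
  case (less n)
  show ?case
    by (subst Wd_eq, intro reg_add reg_comb reg_half_imp YA_reg less.prems less.IH Q_Cone) auto
qed

lemma Wd_Cone: "H \<in> Cone \<Longrightarrow> Wd n H \<in> Cone"
  using Wd_bmeas[of H n] reg_minus1_imp[OF Wd_reg, of H n] by (simp add: Cone_def)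

lemma I_Wd_mult:
  assumes H: "H \<in> Cone" and \<phi>: "bmeas SU \<phi>"
  shows "I (\<lambda>z. Wd n H z * \<phi> z) = I (\<lambda>z. YA n 1 H z * \<phi> z) + (\<Sum>i=1..n. I (\<lambda>z. Wd (n - i) (Q i H) z * \<phi> z))"
proof -
  have "I (\<lambda>z. Wd n H z * \<phi> z) = I (\<lambda>z. YA n 1 H z * \<phi> z + (\<Sum>i=1..n. Wd (n - i) (Q i H) z * \<phi> z))"
    by (subst Wd_eq) (simp add: distrib_right sum_distrib_right)
  also have "\<dots> = I (\<lambda>z. YA n 1 H z * \<phi> z) + (\<Sum>i=1..n. I (\<lambda>z. Wd (n - i) (Q i H) z * \<phi> z))"
    by (subst I_add I_sum; (intro bmeas_mult bmeas_sum YA_bmeas1 Wd_bmeas Q_Cone H \<phi> refl)?)+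
  finally show ?thesis .
qed

definition w1 :: "((nat \<Rightarrow> nat) \<times> real \<Rightarrow> real) \<Rightarrow> real" where
  "w1 f = (\<Sum>n. I (\<lambda>z. Wd n (\<lambda>_. 1) z * fY f z))"

theorem A_estimate:
  assumes f: "bmeas SX f" "suppY f" and H: "H \<in> Cone"
  shows "\<exists>C. \<forall>n. \<bar>A f n 1 H - I H * w1 f * (1 / (\<Sum>k\<le>n. rg.T k (\<lambda>_. 1)))\<bar> \<le> C * renewal_err q n"
proof -
  have fY: "bmeas SU (fY f)" by (rule fY_bmeas[OF f(1)])
  obtain c where c: "c \<ge> 0" "\<And>z. z \<in> space SU \<Longrightarrow> \<bar>fY f z\<bar> \<le> c"
    using fY by (auto elim: bmeasE)
  show ?thesis
  unfolding w1_def
proof (rule rg.regeneration_estimate[where D = "\<lambda>n H. I (\<lambda>z. YA n 1 H z * fY f z)"])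
  show "A f n 1 H = I (\<lambda>z. YA n 1 H z * fY f z) + (\<Sum>i=1..n. A f (n - i) 1 (RA i 1 H))" if "H \<in> Cone" for H n
    by (rule A_decomp[OF f Cone_bmeas[OF that]]) simp
  show "A f n 1 (RA i 1 H) = A f n 1 (Q i H) + \<delta> * I (RA i 1 H) * A f n 1 (\<lambda>_. 1)" if "H \<in> Cone" for H i n
  proof -
    have "A f n 1 (Q i H) = A f n 1 (RA i 1 H) - A f n 1 (\<lambda>z. \<delta> * I (RA i 1 H) * 1)"
      unfolding Q_def mult_1_right using f RA_bmeas1[OF that] by (intro A_diff) auto
    also have "A f n 1 (\<lambda>z. \<delta> * I (RA i 1 H) * 1) = \<delta> * I (RA i 1 H) * A f n 1 (\<lambda>_. 1)"
      by (rule A_cmult)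
    finally show ?thesis by simp
  qed
  show "I (\<lambda>z. Wd n H z * fY f z) = I (\<lambda>z. YA n 1 H z * fY f z) + (\<Sum>i=1..n. I (\<lambda>z. Wd (n - i) (Q i H) z * fY f z))"
    if "H \<in> Cone" for H n
    by (rule I_Wd_mult[OF that fY])
  show "\<bar>I (\<lambda>z. YA n 1 H z * fY f z)\<bar> \<le> c * I (RA (Suc n) 1 H)" if "H \<in> Cone" for H n
  proof -
    have "\<bar>I (\<lambda>z. YA n 1 H z * fY f z)\<bar> \<le> c * I (YA n 1 H)"
      using that reg_nonneg[OF YA_reg[OF that]] c(2)
      by (intro I_mult_bound YA_bmeas1 fY) (auto simp: nonneg_def)
    also have "\<dots> \<le> c * I (RA (Suc n) 1 H)"
      using c Cone_bmeas[OF that] Cone_nonneg[OF that] by (intro mult_left_mono I_YA_le_RA) auto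
    finally show ?thesis .
  qed
  qed fact
qed

definition M where "M = (\<Sum>k. rg.T k (\<lambda>_. 1))"

lemma T_summable: "summable (\<lambda>k. rg.T k (\<lambda>_. 1))"
proof -
  obtain A' where A: "A' \<ge> 0" "\<And>n. rg.T n (\<lambda>_. 1) \<le> A' * I (\<lambda>_. 1) * wt q n"
    using rg.T_tail' rg.one(1) by metis
  show ?thesis
  proof (rule summable_comparison_test)
    show "summable (\<lambda>n. A' * I (\<lambda>_. 1) * wt q n)" by (intro summable_mult summable_wt q)
    show "\<exists>N. \<forall>n\<ge>N. norm (rg.T n (\<lambda>_. 1)) \<le> A' * I (\<lambda>_. 1) * wt q n"
      using A(2) rg.T_nonneg[OF rg.one(1)] by auto
  qed
qed

lemma T_partial: "1 \<le> (\<Sum>k\<le>n. rg.T k (\<lambda>_. 1))" "(\<Sum>k\<le>n. rg.T k (\<lambda>_. 1)) \<le> M"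
proof -
  have "rg.T 0 (\<lambda>_. 1) \<le> (\<Sum>k\<le>n. rg.T k (\<lambda>_. 1))"
    by (rule member_le_sum) (auto intro: rg.T_nonneg[OF rg.one(1)])
  then show "1 \<le> (\<Sum>k\<le>n. rg.T k (\<lambda>_. 1))" by simp
  show "(\<Sum>k\<le>n. rg.T k (\<lambda>_. 1)) \<le> M"
    unfolding M_def by (intro sum_le_suminf T_summable) (auto intro: rg.T_nonneg[OF rg.one(1)])
qed

lemma M_ge_1: "M \<ge> 1" using T_partial[of 0] by simp

lemma renewal_err_tendsto: "(\<lambda>n. renewal_err q n) \<longlonglongrightarrow> 0"
proof (rule tendsto_sandwich[of "\<lambda>_. 0" _ _ "\<lambda>n. wt (q - 1) n"])
  have "renewal_err q n \<le> wt (q - 1) n" for n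
  proof -
    have "(\<Sum>k\<le>n. wt (q - 1) k) \<le> (\<Sum>k\<le>n. 1)" using q by (intro sum_mono wt_le_1) auto
    then have "renewal_err q n \<le> wt q n * (real n + 1)"
      unfolding renewal_err_def by (intro mult_left_mono) auto
    then show ?thesis using Suc_mult_wt[of n q] by (simp add: mult.commute)
  qed
  then show "eventually (\<lambda>n. renewal_err q n \<le> wt (q - 1) n) sequentially" by simp
  show "(\<lambda>n. wt (q - 1) n) \<longlonglongrightarrow> 0" unfolding wt_def using q by real_asymp
qed auto

lemma A_tendsto:
  assumes f: "bmeas SX f" "suppY f" and H: "H \<in> Cone"
  shows "(\<lambda>n. A f n 1 H) \<longlonglongrightarrow> I H * (w1 f / M)"
proof -
  obtain C where C: "\<And>n. \<bar>A f n 1 H - I H * w1 f * (1 / (\<Sum>k\<le>n. rg.T k (\<lambda>_. 1)))\<bar> \<le> C * renewal_err q n"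
    using A_estimate[OF assms] by blast
  have "(\<lambda>n. C * renewal_err q n) \<longlonglongrightarrow> C * 0"
    by (intro tendsto_intros renewal_err_tendsto)
  then have C0: "(\<lambda>n. C * renewal_err q n) \<longlonglongrightarrow> 0" by simp
  have 1: "(\<lambda>n. A f n 1 H - I H * w1 f * (1 / (\<Sum>k\<le>n. rg.T k (\<lambda>_. 1)))) \<longlonglongrightarrow> 0"
    by (rule Lim_null_comparison[OF _ C0]) (use C in auto)
  have "(\<lambda>n. \<Sum>k\<le>n. rg.T k (\<lambda>_. 1)) \<longlonglongrightarrow> M"
    unfolding M_def by (rule summable_LIMSEQ'[OF T_summable])
  then have "(\<lambda>n. I H * w1 f * (1 / (\<Sum>k\<le>n. rg.T k (\<lambda>_. 1)))) \<longlonglongrightarrow> I H * w1 f * (1 / M)"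
    using M_ge_1 by (intro tendsto_intros) auto
  from tendsto_add[OF 1 this] show ?thesis by simp
qed

text \<open>\<open>W_le_regen\<close> for the constant observable \<open>1\<close>: the masses are
  dominated by multiples of the regeneration probabilities, which are summable.\<close>

lemma I_Wd_summable: "summable (\<lambda>n. I (Wd n (\<lambda>_. 1)))"
proof -
  have le: "\<bar>I (Wd n (\<lambda>_. 1))\<bar> \<le> 1 / \<delta> * rg.regen (Suc n) (\<lambda>_. 1)" for n
  proof (rule rg.W_le_regen[where W = "\<lambda>n H. I (Wd n H)" and D = "\<lambda>n H. I (YA n 1 H)"])
    show "I (Wd n H) = I (YA n 1 H) + (\<Sum>i=1..n. I (Wd (n - i) (Q i H)))" if "H \<in> Cone" for n H
      using I_Wd_mult[OF that bmeas_const[of SU 1], of n] by simp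
    show "\<bar>I (YA n 1 H)\<bar> \<le> 1 * I (RA (Suc n) 1 H)" if "H \<in> Cone" for n H
      using I_YA_le_RA[OF Cone_bmeas[OF that] Cone_nonneg[OF that], of 1 n]
        I_nonneg'[OF reg_nonneg[OF YA_reg[OF that, of n]]] by simp
  qed (rule rg.one)
  have s: "summable (\<lambda>n. 1 / \<delta> * rg.regen (Suc n) (\<lambda>_. 1))"
    using sums_summable[OF rg.regen_sums[OF rg.one(1)]] summable_Suc_iff[of "\<lambda>n. rg.regen n (\<lambda>_. 1)"]
    by (intro summable_mult) simp
  show ?thesis
    by (rule summable_comparison_test'[OF s, of 0]) (use le in simp)
qed

lemma Wd_one_bounds:
  assumes "z \<in> space SU"
  shows "0 \<le> Wd n (\<lambda>_. 1) z" "Wd n (\<lambda>_. 1) z \<le> exp (2 * D0) * I (Wd n (\<lambda>_. 1))"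
    "summable (\<lambda>n. Wd n (\<lambda>_. 1) z)"
proof -
  note W = Wd_Cone[OF rg.one(1)]
  show *: "0 \<le> Wd n (\<lambda>_. 1) z" "Wd n (\<lambda>_. 1) z \<le> exp (2 * D0) * I (Wd n (\<lambda>_. 1))" for n
    using Cone_nonneg[OF W] Cone_bounds(1)[OF W] assms by (auto simp: nonneg_def)
  show "summable (\<lambda>n. Wd n (\<lambda>_. 1) z)"
    by (rule summable_comparison_test[OF _ summable_mult[OF I_Wd_summable, of "exp (2 * D0)"]])
       (use * in auto)
qed

text \<open>This is the density of the acs measure on \<open>(1/2, 3/4)\<close>.\<close>

definition \<rho> :: "(nat \<Rightarrow> nat) \<times> real \<Rightarrow> real" where
  "\<rho> z = (1 / M) * (\<Sum>n. Wd n (\<lambda>_. 1) z)"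

lemma \<rho>_bmeas: "bmeas SU \<rho>"
proof -
  have "bmeas SU (\<lambda>z. \<Sum>n. Wd n (\<lambda>_. 1) z)"
  proof (rule bmeasI)
    show "(\<lambda>z. \<Sum>n. Wd n (\<lambda>_. 1) z) \<in> borel_measurable SU"
      by (intro borel_measurable_suminf bmeas_measurable Wd_bmeas rg.one)
    fix z assume z: "z \<in> space SU"
    have "(\<Sum>n. Wd n (\<lambda>_. 1) z) \<le> (\<Sum>n. exp (2 * D0) * I (Wd n (\<lambda>_. 1)))"
      by (intro suminf_le Wd_one_bounds z summable_mult I_Wd_summable)
    moreover have "0 \<le> (\<Sum>n. Wd n (\<lambda>_. 1) z)"
      by (intro suminf_nonneg Wd_one_bounds z)
    ultimately show "\<bar>\<Sum>n. Wd n (\<lambda>_. 1) z\<bar> \<le> (\<Sum>n. exp (2 * D0) * I (Wd n (\<lambda>_. 1)))" by simp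
  qed
  then show ?thesis unfolding \<rho>_def[abs_def] by (rule bmeas_cmult)
qed

text \<open>The bound \<open>D0 - 1\<close> instead of \<open>D0\<close> leaves room for a factor of
  oscillation \<open>1\<close>, namely the shifted \<open>h\<close> in the correlations.\<close>

lemma \<rho>_reg: "reg \<alpha> 1 1 (D0 - 1) 0 \<rho>"
  unfolding reg_def
proof (intro conjI ballI)
  show "nonneg \<rho>" unfolding nonneg_def \<rho>_def
    using M_ge_1 by (intro ballI mult_nonneg_nonneg suminf_nonneg Wd_one_bounds) auto
  fix \<omega> \<omega>' u v assume *: "\<omega> \<in> \<Omega>N" "\<omega>' \<in> \<Omega>N" "u \<in> {0<..<1::real}" "v \<in> {0<..<1::real}"
  define e where "e = exp ((D0 - 1) * (1 * dw \<omega> \<omega>' + 1 * \<bar>u - v\<bar>) powr \<alpha> + 0 * \<bar>u - v\<bar>)"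
  have s: "(\<omega>, u) \<in> space SU" "(\<omega>', v) \<in> space SU" using * by (auto simp: space_SU)
  have "(\<Sum>n. Wd n (\<lambda>_. 1) (\<omega>, u)) \<le> (\<Sum>n. e * Wd n (\<lambda>_. 1) (\<omega>', v))"
    unfolding e_def by (intro suminf_le regD[OF Wd_reg[OF rg.one(1)] *] Wd_one_bounds s summable_mult)
  also have "\<dots> = e * (\<Sum>n. Wd n (\<lambda>_. 1) (\<omega>', v))"
    by (intro suminf_mult Wd_one_bounds s)
  finally have "1 / M * (\<Sum>n. Wd n (\<lambda>_. 1) (\<omega>, u)) \<le> 1 / M * (e * (\<Sum>n. Wd n (\<lambda>_. 1) (\<omega>', v)))"
    using M_ge_1 by (intro mult_left_mono) auto
  then show "\<rho> (\<omega>, u) \<le> exp ((D0 - 1) * (1 * dw \<omega> \<omega>' + 1 * \<bar>u - v\<bar>) powr \<alpha> + 0 * \<bar>u - v\<bar>) * \<rho> (\<omega>', v)"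
    by (simp only: \<rho>_def e_def[symmetric] mult.left_commute)
qed

lemma w1_eq:
  assumes \<phi>: "bmeas SX f"
  shows "w1 f / M = I (\<lambda>z. \<rho> z * fY f z)"
proof -
  have fY: "bmeas SU (fY f)" by (rule fY_bmeas[OF \<phi>])
  obtain c where c: "c \<ge> 0" "\<And>z. z \<in> space SU \<Longrightarrow> \<bar>fY f z\<bar> \<le> c"
    using fY by (auto elim: bmeasE)
  have b: "bmeas SU (\<lambda>z. Wd n (\<lambda>_. 1) z * fY f z)" for n
    by (intro bmeas_mult Wd_bmeas rg.one fY)
  have bd: "norm (Wd n (\<lambda>_. 1) z * fY f z) \<le> c * Wd n (\<lambda>_. 1) z" if "z \<in> space SU" for n z
    using Wd_one_bounds(1)[OF that, of n] c(2)[OF that]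
    by (simp add: abs_mult mult.commute mult_right_mono)
  have "(\<integral>z. (\<Sum>n. Wd n (\<lambda>_. 1) z * fY f z) \<partial>SU) = (\<Sum>n. (\<integral>z. Wd n (\<lambda>_. 1) z * fY f z \<partial>SU))"
  proof (rule integral_suminf)
    show "integrable SU (\<lambda>z. Wd n (\<lambda>_. 1) z * fY f z)" for n
      by (rule bmeas_integrable[OF prob_space_SU b])
    show "AE z in SU. summable (\<lambda>n. norm (Wd n (\<lambda>_. 1) z * fY f z))"
      by (intro AE_I2 summable_comparison_test'[OF summable_mult[OF Wd_one_bounds(3)]]) (use bd in auto)
    show "summable (\<lambda>n. \<integral>z. norm (Wd n (\<lambda>_. 1) z * fY f z) \<partial>SU)"
    proof (rule summable_comparison_test'[OF summable_mult[OF I_Wd_summable, of c]])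
      fix n
      have "(\<integral>z. norm (Wd n (\<lambda>_. 1) z * fY f z) \<partial>SU) \<le> (\<integral>z. c * Wd n (\<lambda>_. 1) z \<partial>SU)"
        using bd Wd_bmeas[OF rg.one(1), of n]
        by (intro Bochner_Integration.integral_mono integrable_norm bmeas_integrable[OF prob_space_SU] b bmeas_cmult)
      then show "norm (\<integral>z. norm (Wd n (\<lambda>_. 1) z * fY f z) \<partial>SU) \<le> c * I (Wd n (\<lambda>_. 1))"
        by (simp add: I_def)
    qed
  qed
  then have "w1 f = I (\<lambda>z. \<Sum>n. Wd n (\<lambda>_. 1) z * fY f z)"
    by (simp add: w1_def I_def)
  also have "\<dots> = I (\<lambda>z. M * (\<rho> z * fY f z))"
  proof (rule I_cong)
    fix z assume z: "z \<in> space SU"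
    have "(\<Sum>n. Wd n (\<lambda>_. 1) z * fY f z) = (\<Sum>n. Wd n (\<lambda>_. 1) z) * fY f z"
      by (rule suminf_mult2[OF Wd_one_bounds(3)[OF z], symmetric])
    then show "(\<Sum>n. Wd n (\<lambda>_. 1) z * fY f z) = M * (\<rho> z * fY f z)"
      using M_ge_1 by (simp add: \<rho>_def)
  qed
  also have "\<dots> = M * I (\<lambda>z. \<rho> z * fY f z)" by (rule I_cmult)
  finally show ?thesis using M_ge_1 by simp
qed

end

subsection \<open>Identification of the acs measure\<close>

text \<open>Here \<open>\<kappa> n u\<close> stands for the mean of \<open>psi f n\<close> over the
  sequences at \<open>x = 1 - u\<close>. The uniform bound \<open>c\<close> makes the convergence
  stable under limits in the mean, so it passes from Lipschitz densities, which the cone argument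
  can treat, to the merely integrable density of \<open>\<mu>\<close>.\<close>

locale weak_star =
  fixes \<kappa> :: "nat \<Rightarrow> real \<Rightarrow> real" and c \<Lambda> :: real
  assumes \<kappa>_meas: "\<And>n. \<kappa> n \<in> borel_measurable U" and \<kappa>_bound: "\<And>n u. u \<in> {0<..<1} \<Longrightarrow> \<bar>\<kappa> n u\<bar> \<le> c"
    and lipschitz: "\<And>\<phi> L. bmeas U \<phi> \<Longrightarrow> (\<And>u v. \<bar>\<phi> u - \<phi> v\<bar> \<le> L * \<bar>u - v\<bar>) \<Longrightarrow>
      (\<lambda>n. \<integral>u. \<phi> u * \<kappa> n u \<partial>U) \<longlonglongrightarrow> (\<integral>u. \<phi> u \<partial>U) * \<Lambda>"
begin

definition conv :: "(real \<Rightarrow> real) \<Rightarrow> bool" where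
  "conv g \<longleftrightarrow> (\<lambda>n. \<integral>u. g u * \<kappa> n u \<partial>U) \<longlonglongrightarrow> (\<integral>u. g u \<partial>U) * \<Lambda>"

lemma c_nonneg: "c \<ge> 0" using \<kappa>_bound[of "1/2" 0] by auto

lemma integrable_mult_\<kappa>: "integrable U g \<Longrightarrow> integrable U (\<lambda>u. g u * \<kappa> n u)"
proof (rule Bochner_Integration.integrable_bound[of U "\<lambda>u. c * g u"])
  assume g: "integrable U g"
  then show "integrable U (\<lambda>u. c * g u)" by simp
  show "(\<lambda>u. g u * \<kappa> n u) \<in> borel_measurable U"
    using g \<kappa>_meas by (intro borel_measurable_times) auto
  show "AE u in U. norm (g u * \<kappa> n u) \<le> norm (c * g u)"
    using \<kappa>_bound c_nonneg by (auto simp: abs_mult mult.commute[of "c"] intro!: mult_left_mono)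
qed

lemma conv_cong: "(\<And>u. u \<in> {0<..<1} \<Longrightarrow> g u = h u) \<Longrightarrow> conv g \<longleftrightarrow> conv h"
  unfolding conv_def
  by (intro arg_cong2[of _ _ _ _ "\<lambda>a b. a \<longlonglongrightarrow> b * \<Lambda>"] ext Bochner_Integration.integral_cong) auto

lemma conv_add:
  assumes "integrable U g" "integrable U h" "conv g" "conv h"
  shows "conv (\<lambda>u. g u + h u)"
  using tendsto_add[OF assms(3,4)[unfolded conv_def]] assms(1,2) integrable_mult_\<kappa>
  unfolding conv_def by (simp add: distrib_right)

lemma conv_cmult: "conv g \<Longrightarrow> conv (\<lambda>u. a * g u)"
  unfolding conv_def using tendsto_mult_left[of _ _ sequentially a] by (fastforce simp: mult.assoc)

lemma conv_limit:
  assumes g: "\<And>m. conv (g m)" "\<And>m. integrable U (g m)"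
    and w: "integrable U w" "\<And>m u. u \<in> {0<..<1} \<Longrightarrow> \<bar>g m u\<bar> \<le> w u"
    and lim: "\<And>u. u \<in> {0<..<1} \<Longrightarrow> (\<lambda>m. g m u) \<longlonglongrightarrow> h u" and h: "integrable U h"
  shows "conv h"
  unfolding conv_def
proof (rule LIMSEQ_I)
  fix e :: real assume e: "e > 0"
  define a where "a = c + \<bar>\<Lambda>\<bar> + 1"
  have a: "a > 0" using c_nonneg by (simp add: a_def)
  have d: "integrable U (\<lambda>u. \<bar>g m u - h u\<bar>)" for m using g h by auto
  have "(\<lambda>m. \<integral>u. \<bar>g m u - h u\<bar> \<partial>U) \<longlonglongrightarrow> (\<integral>u. 0 \<partial>U)"
  proof (rule integral_dominated_convergence[where w = "\<lambda>u. w u + \<bar>h u\<bar>"])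
    show "AE u in U. (\<lambda>m. \<bar>g m u - h u\<bar>) \<longlonglongrightarrow> 0"
      using lim by (auto simp: LIM_zero_iff tendsto_rabs_zero_iff)
    show "AE u in U. norm \<bar>g m u - h u\<bar> \<le> w u + \<bar>h u\<bar>" for m
      using w(2)[of _ m] by (auto intro!: order.trans[OF abs_triangle_ineq4] add_mono)
  qed (use w h d in auto)
  then have "(\<lambda>m. \<integral>u. \<bar>g m u - h u\<bar> \<partial>U) \<longlonglongrightarrow> 0" by simp
  from order_tendstoD(2)[OF this, of "e / (2 * a)"] a e
  obtain m where m: "(\<integral>u. \<bar>g m u - h u\<bar> \<partial>U) < e / (2 * a)"
    by (auto simp: eventually_sequentially)
  obtain n0 where n0: "\<And>n. n \<ge> n0 \<Longrightarrow> norm ((\<integral>u. g m u * \<kappa> n u \<partial>U) - (\<integral>u. g m u \<partial>U) * \<Lambda>) < e / 2"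
    using LIMSEQ_D[OF g(1)[of m, unfolded conv_def], of "e / 2"] e by auto
  have "norm ((\<integral>u. h u * \<kappa> n u \<partial>U) - (\<integral>u. h u \<partial>U) * \<Lambda>) < e" if n: "n \<ge> n0" for n
  proof -
    let ?d = "\<integral>u. \<bar>g m u - h u\<bar> \<partial>U"
    have "(\<integral>u. h u * \<kappa> n u \<partial>U) - (\<integral>u. g m u * \<kappa> n u \<partial>U) = (\<integral>u. (h u - g m u) * \<kappa> n u \<partial>U)"
      using integrable_mult_\<kappa> g h by (simp add: left_diff_distrib)
    also have "\<bar>\<dots>\<bar> \<le> (\<integral>u. \<bar>(h u - g m u) * \<kappa> n u\<bar> \<partial>U)" by (rule integral_abs_bound)
    also have "\<dots> \<le> (\<integral>u. c * \<bar>g m u - h u\<bar> \<partial>U)"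
      using g h d \<kappa>_bound
      by (intro Bochner_Integration.integral_mono integrable_abs integrable_mult_\<kappa>)
         (auto simp: abs_mult abs_minus_commute mult.commute[of c] intro!: mult_left_mono)
    finally have 1: "\<bar>(\<integral>u. h u * \<kappa> n u \<partial>U) - (\<integral>u. g m u * \<kappa> n u \<partial>U)\<bar> \<le> c * ?d" by simp
    have "(\<integral>u. g m u \<partial>U) * \<Lambda> - (\<integral>u. h u \<partial>U) * \<Lambda> = (\<integral>u. g m u - h u \<partial>U) * \<Lambda>"
      using g h by (simp add: left_diff_distrib)
    also have "\<bar>\<dots>\<bar> \<le> ?d * \<bar>\<Lambda>\<bar>"
      unfolding abs_mult by (intro mult_right_mono integral_abs_bound) auto
    finally have 2: "\<bar>(\<integral>u. g m u \<partial>U) * \<Lambda> - (\<integral>u. h u \<partial>U) * \<Lambda>\<bar> \<le> ?d * \<bar>\<Lambda>\<bar>" .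
    have "?d \<ge> 0" by (intro Bochner_Integration.integral_nonneg) auto
    then have "c * ?d + ?d * \<bar>\<Lambda>\<bar> \<le> a * ?d" by (simp add: a_def algebra_simps)
    also have "\<dots> < e / 2" using m a by (simp add: field_simps)
    finally show ?thesis using 1 2 n0[OF n] by (simp only: real_norm_def)
  qed
  then show "\<exists>no. \<forall>n\<ge>no. norm ((\<integral>u. h u * \<kappa> n u \<partial>U) - (\<integral>u. h u \<partial>U) * \<Lambda>) < e" by blast
qed

lemma conv_lipschitz: "bmeas U \<phi> \<Longrightarrow> (\<And>u v. \<bar>\<phi> u - \<phi> v\<bar> \<le> L * \<bar>u - v\<bar>) \<Longrightarrow> conv \<phi>"
  unfolding conv_def by (rule lipschitz)

lemma conv_const: "conv (\<lambda>_. a)"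
  by (rule conv_lipschitz[where L = 0]) auto

lemma ind_integrable: "A \<in> sets borel \<Longrightarrow> integrable U (indicator A :: real \<Rightarrow> real)"
  by (intro U.bmeas_integrable bmeasI[where c = 1] measurable_U1) (auto simp: indicator_def)

lemma conv_interval: "conv (indicator {a..b})"
proof -
  \<comment> \<open>For \<open>a \<le> b\<close> this is the distance to \<open>{a..b}\<close>; the
    functions \<open>\<phi> m\<close> are Lipschitz with constant \<open>m\<close> and converge to
    the indicator.\<close>
  define t where "t u = max 0 (max (a - u) (u - b))" for u :: real
  define \<phi> where "\<phi> m u = max 0 (1 - real m * t u)" for m and u :: real
  have tail_mass: "\<bar>t u - t v\<bar> \<le> \<bar>u - v\<bar>" for u v unfolding t_def by linarith
  have t0: "t u \<ge> 0" for u by (simp add: t_def)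
  have \<phi>01: "0 \<le> \<phi> m u" "\<phi> m u \<le> 1" for m u using t0 by (auto simp: \<phi>_def)
  have meas: "\<phi> m \<in> borel_measurable U" for m
    unfolding \<phi>_def[abs_def] t_def by (intro measurable_U1) measurable
  have bm: "bmeas U (\<phi> m)" for m
    by (intro bmeasI[where c = 1] meas) (simp only: abs_of_nonneg[OF \<phi>01(1)] \<phi>01(2))
  have lip: "\<bar>\<phi> m u - \<phi> m v\<bar> \<le> real m * \<bar>u - v\<bar>" for m u v
  proof -
    have "\<bar>\<phi> m u - \<phi> m v\<bar> \<le> \<bar>real m * t u - real m * t v\<bar>" unfolding \<phi>_def by linarith
    also have "\<dots> = real m * \<bar>t u - t v\<bar>" by (simp add: abs_mult flip: right_diff_distrib)
    also have "\<dots> \<le> real m * \<bar>u - v\<bar>" by (intro mult_left_mono tail_mass) auto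
    finally show ?thesis .
  qed
  show ?thesis
  proof (rule conv_limit[where g = \<phi> and w = "\<lambda>_. 1"])
    show "conv (\<phi> m)" for m by (rule conv_lipschitz[OF bm lip])
    show "integrable U (\<phi> m)" for m by (rule U.bmeas_integrable[OF bm])
    show "\<bar>\<phi> m u\<bar> \<le> 1" for m u using \<phi>01[of m u] by auto
    show "(\<lambda>m. \<phi> m u) \<longlonglongrightarrow> indicator {a..b} u" for u
    proof (cases "u \<in> {a..b}")
      case True
      then have "t u = 0" by (simp add: t_def)
      then show ?thesis using True by (simp add: \<phi>_def)
    next
      case False
      then have t: "t u > 0" by (auto simp: t_def)
      obtain N where N: "real N > 1 / t u" using reals_Archimedean2 by blast
      have "\<phi> m u = 0" if "m \<ge> N" for m
      proof -
        have "1 / t u \<le> real m" using N that by linarith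
        then have "1 \<le> real m * t u" using t by (simp add: field_simps)
        then show ?thesis by (simp add: \<phi>_def)
      qed
      then have "eventually (\<lambda>m. \<phi> m u = 0) sequentially" by (auto simp: eventually_sequentially)
      then show ?thesis using False by (simp add: tendsto_eventually)
    qed
  qed (auto intro: ind_integrable)
qed

lemma conv_borel: "A \<in> sets borel \<Longrightarrow> conv (indicator A)"
proof (induction rule: borel_set_induct)
  case empty
  then show ?case using conv_const[of 0] by (simp add: indicator_def)
next
  case (interval a b)
  then show ?case by (intro conv_interval)
next
  case (compl A)
  have "conv (\<lambda>u. 1 + (-1) * indicator A u)"
    using compl by (intro conv_add conv_const conv_cmult integrable_mult_right ind_integrable) auto
  then show ?case
    by (rule conv_cong[THEN iffD1, rotated]) (auto simp: indicator_def)
next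
  case (union f)
  have dis: "disjoint_family f" using union by simp
  have S: "conv (\<lambda>u. \<Sum>i<m. indicator (f i) u) \<and> integrable U (\<lambda>u. \<Sum>i<m. indicator (f i) u :: real)" for m
  proof (induction m)
    case 0
    show ?case using conv_const[of 0] by simp
  next
    case (Suc m)
    then show ?case
      using union by (auto intro!: conv_add Bochner_Integration.integrable_add ind_integrable)
  qed
  have sum_ind: "(\<Sum>i<m. indicator (f i) u :: real) = indicator (\<Union>i<m. f i) u" for m u
    by (rule indicator_UN_disjoint[symmetric])
       (use dis in \<open>auto simp: disjoint_family_on_def\<close>)
  show ?case
  proof (rule conv_limit[where g = "\<lambda>m u. \<Sum>i<m. indicator (f i) u" and w = "\<lambda>_. 1"])
    show "(\<lambda>m. \<Sum>i<m. indicator (f i) u :: real) \<longlonglongrightarrow> indicator (\<Union> (range f)) u" for u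
      unfolding sum_ind by (rule LIMSEQ_indicator_UN)
    show "\<bar>\<Sum>i<m. indicator (f i) u\<bar> \<le> (1::real)" for m u
      unfolding sum_ind by (simp add: indicator_def)
    show "integrable U (indicator (\<Union> (range f)) :: real \<Rightarrow> real)"
      using union by (intro ind_integrable) auto
  qed (use S in auto)
qed

theorem conv_integrable: "integrable U g \<Longrightarrow> conv g"
proof (induction rule: integrable_induct)
  case (base A c)
  obtain A' where A': "A' \<in> sets borel" "A = {0<..<1} \<inter> A'"
    using base(1) unfolding sets_U sets_restrict_space by auto
  have "conv (\<lambda>u. c * indicator A' u)" by (intro conv_cmult conv_borel A')
  then show ?case
    by (rule conv_cong[THEN iffD1, rotated]) (auto simp: A'(2) indicator_def)
next
  case (add f g)
  then show ?case by (intro conv_add)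
next
  case (lim f s)
  show ?case
  proof (rule conv_limit[where g = s and w = "\<lambda>u. 2 * \<bar>f u\<bar>"])
    show "integrable U (\<lambda>u. 2 * \<bar>f u\<bar>)" using lim by auto
  qed (use lim in auto)
qed

end

context letters
begin

lemma fubini_snd:
  assumes X: "prob_space X" and \<Phi>: "bmeas (BM \<Otimes>\<^sub>M X) \<Phi>"
  shows "(\<integral>z. \<Phi> z \<partial>(BM \<Otimes>\<^sub>M X)) = (\<integral>x. (\<integral>\<omega>. \<Phi> (\<omega>, x) \<partial>BM) \<partial>X)"
    and "bmeas X (\<lambda>x. \<integral>\<omega>. \<Phi> (\<omega>, x) \<partial>BM)"
    and "(\<And>z. z \<in> space (BM \<Otimes>\<^sub>M X) \<Longrightarrow> \<bar>\<Phi> z\<bar> \<le> c) \<Longrightarrow> x \<in> space X \<Longrightarrow> \<bar>\<integral>\<omega>. \<Phi> (\<omega>, x) \<partial>BM\<bar> \<le> c"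
proof -
  interpret X: prob_space X by fact
  interpret BM: prob_space BM by (rule prob_space_BM)
  interpret BX: pair_prob_space BM X ..
  have int: "integrable (BM \<Otimes>\<^sub>M X) \<Phi>"
    by (rule bmeas_integrable[OF BX.prob_space_axioms \<Phi>])
  then show "(\<integral>z. \<Phi> z \<partial>(BM \<Otimes>\<^sub>M X)) = (\<integral>x. (\<integral>\<omega>. \<Phi> (\<omega>, x) \<partial>BM) \<partial>X)"
    using BX.integral_snd[of "\<lambda>\<omega> x. \<Phi> (\<omega>, x)"] by simp
  have bd: "\<bar>\<integral>\<omega>. \<Phi> (\<omega>, x) \<partial>BM\<bar> \<le> c" if c: "\<And>z. z \<in> space (BM \<Otimes>\<^sub>M X) \<Longrightarrow> \<bar>\<Phi> z\<bar> \<le> c" and x: "x \<in> space X" for c x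
  proof -
    have b: "bmeas BM (\<lambda>\<omega>. \<Phi> (\<omega>, x))"
      using x by (intro bmeas_comp[OF \<Phi>]) measurable
    have "\<bar>\<integral>\<omega>. \<Phi> (\<omega>, x) \<partial>BM\<bar> \<le> (\<integral>\<omega>. \<bar>\<Phi> (\<omega>, x)\<bar> \<partial>BM)" by (rule integral_abs_bound)
    also have "\<dots> \<le> (\<integral>\<omega>. c \<partial>BM)"
      using x c BM.bmeas_integrable[OF b] by (intro Bochner_Integration.integral_mono) (auto simp: space_pair_measure)
    finally show ?thesis using BM.prob_space by simp
  qed
  show "(\<And>z. z \<in> space (BM \<Otimes>\<^sub>M X) \<Longrightarrow> \<bar>\<Phi> z\<bar> \<le> c) \<Longrightarrow> x \<in> space X \<Longrightarrow> \<bar>\<integral>\<omega>. \<Phi> (\<omega>, x) \<partial>BM\<bar> \<le> c"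
    by (rule bd)
  obtain c where c: "\<And>z. z \<in> space (BM \<Otimes>\<^sub>M X) \<Longrightarrow> \<bar>\<Phi> z\<bar> \<le> c" using \<Phi> by (auto simp: bmeas_def)
  show "bmeas X (\<lambda>x. \<integral>\<omega>. \<Phi> (\<omega>, x) \<partial>BM)"
  proof (rule bmeasI[where c = c])
    show "(\<lambda>x. \<integral>\<omega>. \<Phi> (\<omega>, x) \<partial>BM) \<in> borel_measurable X"
      using borel_measurable_integrable[OF BX.integrable_snd[of "\<lambda>\<omega> x. \<Phi> (\<omega>, x)"]] int by simp
  qed (use bd[OF c] in auto)
qed

end

abbreviation "L01 \<equiv> restrict_space lborel {0..1::real}"

text \<open>The reflection \<open>x = 1 - u\<close> is the coordinate \<open>xR 1\<close>, in which
  \<open>Bf\<close> describes an orbit started anywhere in the interval.\<close>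

lemma L01_to_U:
  fixes h :: "real \<Rightarrow> real"
  assumes "integrable L01 h"
  shows "integrable U (\<lambda>u. h (1 - u))" "(\<integral>x. h x \<partial>L01) = (\<integral>u. h (1 - u) \<partial>U)"
proof -
  define g where "g x = indicator {0..1} x * h x" for x
  have int: "integrable lborel g"
    using assms unfolding g_def by (subst (asm) integrable_restrict_space) auto
  have "integrable lborel (\<lambda>u. g (1 + (-1) * u))"
    by (rule lborel_integrable_real_affine[OF int]) simp
  then have i1: "integrable lborel (\<lambda>u. g (1 - u))" by simp
  have i2: "integrable lborel (\<lambda>u. indicator {0<..<1} u * g (1 - u))"
    using integrable_mult_indicator[OF _ i1, of "{0<..<1}"] by simp
  have e: "indicator {0<..<1} u *\<^sub>R h (1 - u) = indicator {0<..<1} u * g (1 - u)" for u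
    by (auto simp: g_def indicator_def)
  show "integrable U (\<lambda>u. h (1 - u))"
    unfolding U_def using i2[folded e] by (subst integrable_restrict_space) simp_all
  have "(\<integral>x. h x \<partial>L01) = (\<integral>x. g x \<partial>lborel)"
    unfolding g_def by (subst Bochner_Integration.integral_restrict_space) auto
  also have "\<dots> = (\<integral>u. g (1 - u) \<partial>lborel)"
    using lborel_integral_real_affine[of "-1" g 1] by simp
  also have "\<dots> = (\<integral>u. indicator {0<..<1} u * g (1 - u) \<partial>lborel)"
  proof (rule integral_cong_AE)
    have "AE u in lborel. u \<noteq> (0::real) \<and> u \<noteq> 1"
      using AE_lborel_singleton[of "0::real"] AE_lborel_singleton[of "1::real"] by eventually_elim auto
    then show "AE u in lborel. g (1 - u) = indicator {0<..<1} u * g (1 - u)"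
      by eventually_elim (auto simp: g_def indicator_def)
  qed (use i1 i2 in auto)
  also have "\<dots> = (\<integral>u. h (1 - u) \<partial>U)"
    unfolding U_def by (subst Bochner_Integration.integral_restrict_space, simp, simp only: e)
  finally show "(\<integral>x. h x \<partial>L01) = (\<integral>u. h (1 - u) \<partial>U)" .
qed

context mixing_map
begin

text \<open>Started anywhere in the interval, the orbit first enters the left half at some time
  \<open>i\<close>, with density \<open>RB i 1 H\<close> in the cone; from there
  \<open>A_tendsto\<close> applies. Tannery's theorem with majorant \<open>c * I (RB i 1 H)\<close>
  exchanges limit and sum.\<close>

lemma Bf_tendsto:
  assumes f: "bmeas SX f" "suppY f" and H: "bmeas SU H" "reg \<alpha> (1/2) 1 D0 0 H"
  shows "(\<lambda>n. Bf f n 1 H) \<longlonglongrightarrow> I H * (w1 f / M)"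
proof -
  have fY: "bmeas SU (fY f)" by (rule fY_bmeas[OF f(1)])
  obtain c where c: "c \<ge> 0" "\<And>z. z \<in> space SX \<Longrightarrow> \<bar>f z\<bar> \<le> c"
    using f by (auto elim: bmeasE)
  have cY: "\<bar>fY f z\<bar> \<le> c" if "z \<in> space SU" for z
    unfolding fY_def using measurable_space[OF xY_measurable that] by (rule c(2))
  have nn: "nonneg H" using H(2) by (rule reg_nonneg)
  obtain cH where cH: "\<And>z. z \<in> space SU \<Longrightarrow> \<bar>H z\<bar> \<le> cH" using H(1) by (auto simp: bmeas_def)
  have RBC: "RB i 1 H \<in> Cone" for i
    using D0 \<alpha> by (intro reg_half_Cone RB_bmeas H(1)) (auto simp: RB_def intro!: reg_J reg_KN_pow H(2))
  have IRB: "I (RB i 1 H) \<ge> 0" for i by (intro I_Cone_nonneg RBC)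
  have "(\<lambda>n. I ((KN 1 ^^ Suc n) H)) \<longlonglongrightarrow> 0"
  proof (rule tendsto_sandwich[of "\<lambda>_. 0" _ _ "\<lambda>n. (1/2) ^ Suc n * cH"])
    have "I ((KN 1 ^^ m) H) \<le> (2 powr (- 1 / 1)) ^ m * cH" for m
      using cH by (intro I_KN_pow_bound H(1) nn) (auto simp: abs_le_iff)
    then show "eventually (\<lambda>n. I ((KN 1 ^^ Suc n) H) \<le> (1/2) ^ Suc n * cH) sequentially"
      by (intro always_eventually allI) (metis (no_types) div_by_1 powr_minus_divide powr_one zero_le_numeral)
    show "eventually (\<lambda>n. 0 \<le> I ((KN 1 ^^ Suc n) H)) sequentially"
      by (intro always_eventually allI I_nonneg' nonneg_KN_pow nn) simp
    have "(\<lambda>n. (1/2 :: real) ^ n) \<longlonglongrightarrow> 0" by (rule LIMSEQ_power_zero) simp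
    then have "(\<lambda>n. (1/2 :: real) ^ Suc n * cH) \<longlonglongrightarrow> 0 * cH"
      by (intro tendsto_mult_right) (rule LIMSEQ_Suc)
    then show "(\<lambda>n. (1/2 :: real) ^ Suc n * cH) \<longlonglongrightarrow> 0" by simp
  qed auto
  then have "(\<lambda>n. I H - I ((KN 1 ^^ Suc n) H)) \<longlonglongrightarrow> I H - 0" by (intro tendsto_intros)
  then have "(\<lambda>n. \<Sum>i\<le>n. I (RB i 1 H)) \<longlonglongrightarrow> I H"
    using sum_I_RB[OF H(1), of 1] by simp
  then have sms: "(\<lambda>i. I (RB i 1 H)) sums I H"
    by (simp add: sums_def_le)
  define a where "a i n = (if i \<le> n then A f (n - i) 1 (RB i 1 H) else 0)" for i n
  have A_bd: "\<bar>A f m 1 H'\<bar> \<le> c * I H'" if "H' \<in> Cone" for m H'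
    unfolding A_def using that Cone_nonneg[OF that] c
    by (intro I_mult_bound bmeas_comp[OF psi_bmeas xI_measurable] f psi_bound Cone_bmeas measurable_space[OF xI_measurable])
       (auto simp: nonneg_def)
  have "eventually (\<lambda>n. summable (\<lambda>i. norm (a i n))) sequentially \<and> summable (\<lambda>i. norm (I (RB i 1 H) * (w1 f / M))) \<and>
      (\<lambda>n. \<Sum>i. a i n) \<longlonglongrightarrow> (\<Sum>i. I (RB i 1 H) * (w1 f / M))"
  proof (rule tannerys_theorem[where M = "\<lambda>i. c * I (RB i 1 H)"])
    show "(\<lambda>n. a i n) \<longlonglongrightarrow> I (RB i 1 H) * (w1 f / M)" for i
    proof (rule LIMSEQ_offset[where k = i])
      show "(\<lambda>n. a i (n + i)) \<longlonglongrightarrow> I (RB i 1 H) * (w1 f / M)"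
        using A_tendsto[OF f RBC[of i]] by (simp add: a_def)
    qed
    show "eventually (\<lambda>(i, n). norm (a i n) \<le> c * I (RB i 1 H)) (at_top \<times>\<^sub>F sequentially)"
      using A_bd[OF RBC] c IRB by (intro always_eventually) (auto simp: a_def)
    show "summable (\<lambda>i. c * I (RB i 1 H))" using sms by (intro summable_mult) (rule sums_summable)
  qed simp
  then have lim: "(\<lambda>n. \<Sum>i. a i n) \<longlonglongrightarrow> (\<Sum>i. I (RB i 1 H) * (w1 f / M))" by blast
  have "(\<Sum>i. I (RB i 1 H) * (w1 f / M)) = I H * (w1 f / M)"
    using sums_mult2[OF sms] by (rule sums_unique[symmetric])
  moreover have "(\<Sum>i. a i n) = (\<Sum>i\<le>n. A f (n - i) 1 (RB i 1 H))" for n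
    by (subst suminf_finite[of "{..n}"]) (auto simp: a_def)
  ultimately have 1: "(\<lambda>n. \<Sum>i\<le>n. A f (n - i) 1 (RB i 1 H)) \<longlonglongrightarrow> I H * (w1 f / M)"
    using lim by simp
  have "(\<lambda>n. c * I (RB (Suc n) 1 H)) \<longlonglongrightarrow> c * 0"
    using summable_LIMSEQ_zero[OF sums_summable[OF sms]] by (intro tendsto_intros LIMSEQ_Suc)
  then have z: "(\<lambda>n. c * I (RB (Suc n) 1 H)) \<longlonglongrightarrow> 0" by simp
  have 2: "(\<lambda>n. I (\<lambda>z. YB n 1 H z * fY f z)) \<longlonglongrightarrow> 0"
  proof (rule Lim_null_comparison[OF _ z])
    have "\<bar>I (\<lambda>z. YB n 1 H z * fY f z)\<bar> \<le> c * I (YB n 1 H)" for n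
      using nonneg_YB[OF nn, of 1 n] cY by (intro I_mult_bound YB_bmeas H(1) fY) (auto simp: nonneg_def)
    then show "eventually (\<lambda>n. norm (I (\<lambda>z. YB n 1 H z * fY f z)) \<le> c * I (RB (Suc n) 1 H)) sequentially"
      using I_RB_Suc[OF H(1), of 1] by simp
  qed
  show ?thesis
    using tendsto_add[OF 2 1] Bf_decomp[OF f(1) _ f(2) H(1), of 1] by simp
qed

end

section \<open>Integrals with respect to a given acs measure\<close>

locale acs_map = mixing_map +
  fixes \<mu> :: "real measure"
  assumes prob_\<mu>: "prob_space \<mu>" and acs: "acs_measure N T p \<mu>"
begin

abbreviation "PM \<equiv> BM \<Otimes>\<^sub>M \<mu>"

lemma sets_\<mu>: "sets \<mu> = sets X01" and ac_\<mu>: "absolutely_continuous L01 \<mu>"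
  and inv_\<mu>: "S \<in> sets \<mu> \<Longrightarrow> (\<Sum>j\<in>{1..N}. ennreal (p j) * emeasure \<mu> {x \<in> {0..1}. T j x \<in> S}) = emeasure \<mu> S"
  using acs by (auto simp: acs_measure_def)

lemma space_\<mu>: "space \<mu> = {0..1}"
  using sets_eq_imp_space_eq[OF sets_\<mu>] by simp

lemma sets_PM: "sets PM = sets SX"
  by (rule sets_pair_measure_cong[OF refl sets_\<mu>])

lemma space_PM: "space PM = space SX"
  by (rule sets_eq_imp_space_eq[OF sets_PM])

lemma bmeas_PM: "bmeas PM \<Phi> \<longleftrightarrow> bmeas SX \<Phi>"
  by (simp add: bmeas_def space_PM measurable_cong_sets[OF sets_PM refl])

lemma bmeas_\<mu>: "bmeas \<mu> \<Phi> \<longleftrightarrow> bmeas X01 \<Phi>"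
  by (simp add: bmeas_def space_\<mu> measurable_cong_sets[OF sets_\<mu> refl])

lemma prob_PM: "prob_space PM" by (rule prob_space_pair[OF prob_\<mu>])

text \<open>The defining identity says that \<open>\<mu>\<close> is the image of
  \<open>P1 \<Otimes>\<^sub>M \<mu>\<close> under \<open>(j, x) \<mapsto> T j x\<close>.\<close>

lemma \<mu>_invariant:
  assumes \<phi>: "bmeas X01 \<phi>"
  shows "(\<Sum>j\<in>{1..N}. p j * (\<integral>x. \<phi> (T j x) \<partial>\<mu>)) = (\<integral>x. \<phi> x \<partial>\<mu>)"
proof -
  interpret \<mu>: prob_space \<mu> by (rule prob_\<mu>)
  interpret P1: prob_space P1 by (rule prob_space_P1)
  interpret P\<mu>: pair_prob_space P1 \<mu> ..
  have m: "(\<lambda>z. T (fst z) (snd z)) \<in> measurable (P1 \<Otimes>\<^sub>M \<mu>) \<mu>"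
  proof (rule measurable_compose_countable'[where I = "{1..N}" and f = "\<lambda>j z. T j (snd z)"])
    show "(\<lambda>z. T j (snd z)) \<in> measurable (P1 \<Otimes>\<^sub>M \<mu>) \<mu>" if "j \<in> {1..N}" for j
      using T_measurable[OF that] measurable_cong_sets[OF sets_\<mu> sets_\<mu>]
      by (intro measurable_compose[OF measurable_snd]) auto
    show "fst \<in> measurable (P1 \<Otimes>\<^sub>M \<mu>) (count_space {1..N})"
      using measurable_fst[of P1 \<mu>] by (simp add: measurable_def sets_point_measure space_point_measure)
  qed auto
  have eq: "distr (P1 \<Otimes>\<^sub>M \<mu>) \<mu> (\<lambda>z. T (fst z) (snd z)) = \<mu>"
  proof (rule measure_eqI)
    fix S assume "S \<in> sets (distr (P1 \<Otimes>\<^sub>M \<mu>) \<mu> (\<lambda>z. T (fst z) (snd z)))"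
    then have S: "S \<in> sets \<mu>" by simp
    let ?V = "(\<lambda>z. T (fst z) (snd z)) -` S \<inter> space (P1 \<Otimes>\<^sub>M \<mu>)"
    have "emeasure (distr (P1 \<Otimes>\<^sub>M \<mu>) \<mu> (\<lambda>z. T (fst z) (snd z))) S = emeasure (P1 \<Otimes>\<^sub>M \<mu>) ?V"
      by (rule emeasure_distr[OF m S])
    also have "\<dots> = (\<integral>\<^sup>+j. emeasure \<mu> (Pair j -` ?V) \<partial>P1)"
      by (rule \<mu>.emeasure_pair_measure_alt[OF measurable_sets[OF m S]])
    also have "\<dots> = (\<Sum>j\<in>{1..N}. ennreal (p j) * emeasure \<mu> (Pair j -` ?V))"
      by (rule nn_integral_point_measure_finite) simp
    also have "\<dots> = (\<Sum>j\<in>{1..N}. ennreal (p j) * emeasure \<mu> {x \<in> {0..1}. T j x \<in> S})"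
      by (intro sum.cong arg_cong2[of _ _ _ _ "(*)"] arg_cong2[of _ _ _ _ emeasure])
         (auto simp: space_pair_measure space_point_measure space_\<mu>)
    also have "\<dots> = emeasure \<mu> S" by (rule inv_\<mu>[OF S])
    finally show "emeasure (distr (P1 \<Otimes>\<^sub>M \<mu>) \<mu> (\<lambda>z. T (fst z) (snd z))) S = emeasure \<mu> S" .
  qed simp
  have b: "bmeas (P1 \<Otimes>\<^sub>M \<mu>) (\<lambda>z. \<phi> (T (fst z) (snd z)))"
    using \<phi> by (intro bmeas_comp[OF _ m]) (simp add: bmeas_\<mu>)
  have \<phi>_meas: "\<phi> \<in> borel_measurable \<mu>"
    using \<phi> by (intro bmeas_measurable) (simp add: bmeas_\<mu>)
  have "(\<integral>x. \<phi> x \<partial>\<mu>) = (\<integral>z. \<phi> (T (fst z) (snd z)) \<partial>(P1 \<Otimes>\<^sub>M \<mu>))"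
    using integral_distr[OF m \<phi>_meas] unfolding eq .
  also have "\<dots> = (\<integral>j. (\<integral>x. \<phi> (T j x) \<partial>\<mu>) \<partial>P1)"
    using P\<mu>.integral_fst'[OF bmeas_integrable[OF P\<mu>.prob_space_axioms b]] by simp
  also have "\<dots> = (\<Sum>j\<in>{1..N}. p j * (\<integral>x. \<phi> (T j x) \<partial>\<mu>))"
    using p_nonneg by (subst lebesgue_integral_point_measure_finite) auto
  finally show ?thesis by simp
qed

lemma PM_invariant:
  assumes f: "bmeas SX f"
  shows "(\<integral>z. psi f n z \<partial>PM) = (\<integral>z. f z \<partial>PM)"
proof (induction n)
  case (Suc n)
  have b: "bmeas PM (psi f n)" for n using psi_bmeas[OF f] by (simp add: bmeas_PM)
  have bj: "bmeas PM (\<lambda>z. psi f n (fst z, T j (snd z)))" if "j \<in> {1..N}" for j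
  proof (rule bmeas_comp[OF b])
    have "T j \<in> measurable \<mu> \<mu>" using T_measurable[OF that] measurable_cong_sets[OF sets_\<mu> sets_\<mu>] by auto
    then show "(\<lambda>z. (fst z, T j (snd z))) \<in> measurable PM PM"
      by (intro measurable_Pair measurable_fst measurable_compose[OF measurable_snd])
  qed
  define k where "k x = (\<integral>\<omega>. psi f n (\<omega>, x) \<partial>BM)" for x
  have k: "bmeas X01 k"
    using fubini_snd(2)[OF prob_\<mu> b[of n]] by (simp add: k_def[abs_def] bmeas_\<mu>)
  have "(\<integral>z. psi f (Suc n) z \<partial>PM) = (\<Sum>j\<in>{1..N}. p j * (\<integral>z. psi f (Suc n) (case_nat j (fst z), snd z) \<partial>PM))"
    by (rule shift_integral[OF prob_\<mu> b])
  also have "\<dots> = (\<Sum>j\<in>{1..N}. p j * (\<integral>x. k (T j x) \<partial>\<mu>))"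
    using fubini_snd(1)[OF prob_\<mu> bj] by (intro sum.cong) (auto simp: psi_case_nat k_def)
  also have "\<dots> = (\<integral>x. k x \<partial>\<mu>)" by (rule \<mu>_invariant[OF k])
  also have "\<dots> = (\<integral>z. psi f n z \<partial>PM)"
    unfolding k_def by (rule fubini_snd(1)[OF prob_\<mu> b, symmetric])
  finally show ?case using Suc by simp
qed simp

lemma density_\<mu>:
  obtains D where "integrable U D" "(\<integral>u. D u \<partial>U) = 1"
    "\<And>k. bmeas X01 k \<Longrightarrow> (\<integral>x. k x \<partial>\<mu>) = (\<integral>u. D u * k (1 - u) \<partial>U)"
proof -
  interpret L: prob_space L01 by (rule prob_space_restrict_space) auto
  interpret \<mu>: prob_space \<mu> by (rule prob_\<mu>)
  have sets_L: "sets \<mu> = sets L01"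
    using sets_\<mu> by (simp add: sets_restrict_space)
  define D where "D x = enn2real (RN_deriv L01 \<mu> x)" for x
  have int: "integrable L01 (\<lambda>x. D x * k x)" "(\<integral>x. k x \<partial>\<mu>) = (\<integral>x. D x * k x \<partial>L01)" if "bmeas \<mu> k" for k
  proof -
    have k: "k \<in> borel_measurable L01"
      using bmeas_measurable[OF that] measurable_cong_sets[OF sets_L refl] by auto
    show "integrable L01 (\<lambda>x. D x * k x)"
      using L.RN_deriv_integrable[OF \<mu>.sigma_finite_measure_axioms ac_\<mu> sets_L k] \<mu>.bmeas_integrable[OF that]
      by (simp add: D_def)
    show "(\<integral>x. k x \<partial>\<mu>) = (\<integral>x. D x * k x \<partial>L01)"
      using L.RN_deriv_integral[OF \<mu>.sigma_finite_measure_axioms ac_\<mu> sets_L k] by (simp add: D_def)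
  qed
  have 1: "integrable L01 D" "(\<integral>x. D x \<partial>L01) = 1"
    using int[of "\<lambda>_. 1"] \<mu>.prob_space by auto
  show thesis
  proof (rule that[of "\<lambda>u. D (1 - u)"])
    show "integrable U (\<lambda>u. D (1 - u))" by (rule L01_to_U[OF 1(1)])
    show "(\<integral>u. D (1 - u) \<partial>U) = 1" using L01_to_U(2)[OF 1(1)] 1(2) by simp
    show "(\<integral>x. k x \<partial>\<mu>) = (\<integral>u. D (1 - u) * k (1 - u) \<partial>U)" if "bmeas X01 k" for k
      using int[of k] L01_to_U(2)[of "\<lambda>x. D x * k x"] that by (simp add: bmeas_\<mu>)
  qed
qed

text \<open>By invariance the integral of \<open>psi f n\<close> does not depend on
  \<open>n\<close>. Written with the density \<open>D\<close> of \<open>\<mu>\<close> it is the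
  integral of \<open>D u * \<kappa> n u\<close>, whose limit is supplied by
  \<open>weak_star\<close>.\<close>

theorem integral_PM:
  assumes f: "bmeas SX f" "suppY f"
  shows "(\<integral>z. f z \<partial>PM) = w1 f / M"
proof -
  obtain c where c: "c \<ge> 0" "\<And>z. z \<in> space SX \<Longrightarrow> \<bar>f z\<bar> \<le> c"
    using f by (auto elim: bmeasE)
  define k where "k n x = (\<integral>\<omega>. psi f n (\<omega>, x) \<partial>BM)" for n x
  define \<kappa> where "\<kappa> n u = k n (1 - u)" for n u
  have bpsi: "bmeas SX (psi f n)" for n by (rule psi_bmeas[OF f(1)])
  have bP: "bmeas PM (psi f n)" for n using bpsi by (simp add: bmeas_PM)
  have k: "bmeas X01 (k n)" for n
    using fubini_snd(2)[OF prob_\<mu> bP[of n]] by (simp add: k_def[abs_def] bmeas_\<mu>)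
  have bR: "bmeas SU (\<lambda>z. psi f n (fst z, xR 1 (snd z)))" for n
    by (rule bmeas_comp[OF bpsi xR_measurable]) simp
  have \<kappa>_eq: "\<kappa> n u = (\<integral>\<omega>. psi f n (\<omega>, xR 1 u) \<partial>BM)" if "u \<in> {0<..<1}" for n u
    using that by (simp add: \<kappa>_def k_def xR_def)
  interpret ws: weak_star \<kappa> c "w1 f / M"
  proof
    show "\<kappa> n \<in> borel_measurable U" for n
    proof -
      have "(\<lambda>u. \<integral>\<omega>. psi f n (\<omega>, xR 1 u) \<partial>BM) \<in> borel_measurable U"
        using bmeas_measurable[OF fubini_snd(2)[OF U.prob_space_axioms bR[of n]]] by simp
      then show ?thesis
        by (rule measurable_cong[THEN iffD1, rotated]) (simp add: \<kappa>_eq)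
    qed
    show "\<bar>\<kappa> n u\<bar> \<le> c" if "u \<in> {0<..<1}" for n u
      unfolding \<kappa>_def k_def
      by (rule fubini_snd(3)[OF prob_\<mu> bP]) (use that psi_bound[OF c(2)] in \<open>auto simp: space_PM space_\<mu>\<close>)
    fix \<phi> L assume \<phi>: "bmeas U \<phi>" and lip: "\<And>u v. \<bar>\<phi> u - \<phi> v\<bar> \<le> L * \<bar>u - v\<bar>"
    obtain d where d: "d \<ge> 0" "\<And>u. u \<in> {0<..<1} \<Longrightarrow> \<bar>\<phi> u\<bar> \<le> d" using \<phi> by (auto elim: bmeasE)
    \<comment> \<open>With \<open>\<phi> + c0 \<ge> \<bar>L\<bar>\<close> the Lipschitz bound
      becomes a logarithmic oscillation of at most \<open>\<bar>u - v\<bar>\<close>, within the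
      allowance \<open>D0 \<ge> 1\<close>. The constant is subtracted again by linearity.\<close>
    define c0 where "c0 = d + \<bar>L\<bar>"
    have b\<phi>: "bmeas SU (\<lambda>z. \<phi> (snd z))" by (rule bmeas_comp[OF \<phi> measurable_snd])
    have lb: "\<phi> u + c0 \<ge> \<bar>L\<bar>" if "u \<in> {0<..<1}" for u
      using d(2)[OF that] by (simp add: c0_def)
    have regH: "reg \<alpha> (1/2) 1 D0 0 (\<lambda>z. \<phi> (snd z) + c0)"
      unfolding reg_def
    proof (intro conjI ballI)
      show "nonneg (\<lambda>z. \<phi> (snd z) + c0)"
        unfolding nonneg_def using lb by (force simp: space_SU)
      fix \<omega> \<omega>' u v assume *: "\<omega> \<in> \<Omega>N" "\<omega>' \<in> \<Omega>N" "u \<in> {0<..<1::real}" "v \<in> {0<..<1::real}"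
      have "\<phi> u + c0 \<le> (\<phi> v + c0) + \<bar>L\<bar> * \<bar>u - v\<bar>"
        using lip[of u v] mult_right_mono[OF abs_ge_self[of L], of "\<bar>u - v\<bar>"] by linarith
      also have "\<dots> \<le> (\<phi> v + c0) + (\<phi> v + c0) * \<bar>u - v\<bar>"
        using lb[OF *(4)] by (intro add_left_mono mult_right_mono) auto
      also have "\<dots> = (1 + \<bar>u - v\<bar>) * (\<phi> v + c0)" by (simp add: algebra_simps)
      also have "\<dots> \<le> exp \<bar>u - v\<bar> * (\<phi> v + c0)"
        using lb[OF *(4)] by (intro mult_right_mono exp_ge_add_one_self) auto
      also have "\<dots> \<le> exp (D0 * (1/2 * dw \<omega> \<omega>' + 1 * \<bar>u - v\<bar>) powr \<alpha> + 0 * \<bar>u - v\<bar>) * (\<phi> v + c0)"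
      proof (rule mult_right_mono)
        have "\<bar>u - v\<bar> \<le> \<bar>u - v\<bar> powr \<alpha>"
        proof (cases "u = v")
          case False
          then show ?thesis using * \<alpha> powr_mono'[of \<alpha> 1 "\<bar>u - v\<bar>"] by auto
        qed simp
        also have "\<dots> \<le> (1/2 * dw \<omega> \<omega>' + 1 * \<bar>u - v\<bar>) powr \<alpha>" using \<alpha> by (intro powr_mono2) auto
        also have "\<dots> \<le> D0 * (1/2 * dw \<omega> \<omega>' + 1 * \<bar>u - v\<bar>) powr \<alpha>"
          using mult_right_mono[of 1 D0 "(1/2 * dw \<omega> \<omega>' + 1 * \<bar>u - v\<bar>) powr \<alpha>"] D0 by simp
        finally show "exp \<bar>u - v\<bar> \<le> exp (D0 * (1/2 * dw \<omega> \<omega>' + 1 * \<bar>u - v\<bar>) powr \<alpha> + 0 * \<bar>u - v\<bar>)" by simp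
      qed (use lb[OF *(4)] in auto)
      finally show "\<phi> (snd (\<omega>, u)) + c0 \<le>
          exp (D0 * (1/2 * dw \<omega> \<omega>' + 1 * \<bar>u - v\<bar>) powr \<alpha> + 0 * \<bar>u - v\<bar>) * (\<phi> (snd (\<omega>', v)) + c0)" by simp
    qed
    have c00: "c0 \<ge> 0" using d by (simp add: c0_def)
    have t1: "(\<lambda>n. Bf f n 1 (\<lambda>z. \<phi> (snd z) + c0)) \<longlonglongrightarrow> I (\<lambda>z. \<phi> (snd z) + c0) * (w1 f / M)"
      by (intro Bf_tendsto f regH bmeas_add b\<phi> bmeas_const)
    have t2: "(\<lambda>n. Bf f n 1 (\<lambda>z. c0)) \<longlonglongrightarrow> I (\<lambda>z. c0) * (w1 f / M)"
      using D0 c00 by (intro Bf_tendsto f reg_const bmeas_const) auto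
    have "Bf f n 1 (\<lambda>z. \<phi> (snd z) + c0) - Bf f n 1 (\<lambda>z. c0) = Bf f n 1 (\<lambda>z. \<phi> (snd z))" for n
      unfolding Bf_def distrib_right
      by (subst I_add) (auto intro!: bmeas_mult b\<phi> bR bmeas_cmult)
    moreover have "I (\<lambda>z. \<phi> (snd z) + c0) - I (\<lambda>z. c0) = I (\<lambda>z. \<phi> (snd z))"
      using b\<phi> by (subst I_add) auto
    ultimately have "(\<lambda>n. Bf f n 1 (\<lambda>z. \<phi> (snd z))) \<longlonglongrightarrow> I (\<lambda>z. \<phi> (snd z)) * (w1 f / M)"
      using tendsto_diff[OF t1 t2] by (simp only: left_diff_distrib[symmetric])
    moreover have "Bf f n 1 (\<lambda>z. \<phi> (snd z)) = (\<integral>u. \<phi> u * \<kappa> n u \<partial>U)" for n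
    proof -
      have "Bf f n 1 (\<lambda>z. \<phi> (snd z)) = (\<integral>u. (\<integral>\<omega>. \<phi> u * psi f n (\<omega>, xR 1 u) \<partial>BM) \<partial>U)"
        unfolding Bf_def I_def using fubini_snd(1)[OF U.prob_space_axioms bmeas_mult[OF b\<phi> bR[of n]]] by simp
      also have "\<dots> = (\<integral>u. \<phi> u * \<kappa> n u \<partial>U)"
        by (intro Bochner_Integration.integral_cong) (auto simp: \<kappa>_eq)
      finally show ?thesis .
    qed
    moreover have "I (\<lambda>z. \<phi> (snd z)) = (\<integral>u. \<phi> u \<partial>U)"
      unfolding I_def using fubini_snd(1)[OF U.prob_space_axioms b\<phi>] prob_space.prob_space[OF prob_space_BM] by simp
    ultimately show "(\<lambda>n. \<integral>u. \<phi> u * \<kappa> n u \<partial>U) \<longlonglongrightarrow> (\<integral>u. \<phi> u \<partial>U) * (w1 f / M)" by simp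
  qed
  obtain D where D: "integrable U D" "(\<integral>u. D u \<partial>U) = 1"
    "\<And>k. bmeas X01 k \<Longrightarrow> (\<integral>x. k x \<partial>\<mu>) = (\<integral>u. D u * k (1 - u) \<partial>U)"
    by (rule density_\<mu>) blast
  have "(\<integral>u. D u * \<kappa> n u \<partial>U) = (\<integral>z. f z \<partial>PM)" for n
  proof -
    have "(\<integral>z. f z \<partial>PM) = (\<integral>z. psi f n z \<partial>PM)" by (rule PM_invariant[OF f(1), symmetric])
    also have "\<dots> = (\<integral>x. k n x \<partial>\<mu>)" unfolding k_def by (rule fubini_snd(1)[OF prob_\<mu> bP])
    also have "\<dots> = (\<integral>u. D u * \<kappa> n u \<partial>U)" unfolding \<kappa>_def by (rule D(3)[OF k])
    finally show ?thesis by simp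
  qed
  then have "(\<lambda>n::nat. \<integral>z. f z \<partial>PM) \<longlonglongrightarrow> 1 * (w1 f / M)"
    using ws.conv_integrable[OF D(1)] unfolding ws.conv_def D(2) by simp
  then show ?thesis by (simp add: LIMSEQ_const_iff)
qed

end

subsection \<open>The lower bound for correlations\<close>

lemma bernoulli_powr:
  fixes t x :: real
  assumes t: "0 \<le> t" "t \<le> 1" and x: "x > 1"
  shows "(1 - 1 / x) powr t \<le> 1 - t / x"
proof -
  let ?y = "ln (1 - 1 / x)"
  have pos: "1 - 1 / x > 0" using x by (simp add: field_simps)
  have "exp ((1 - t) *\<^sub>R 0 + t *\<^sub>R ?y) \<le> (1 - t) * exp 0 + t * exp ?y"
    using t by (intro convex_onD[OF exp_convex]) auto
  then have "exp (t * ?y) \<le> (1 - t) + t * (1 - 1 / x)" using pos by simp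
  then show ?thesis using pos x by (simp add: powr_def algebra_simps)
qed

text \<open>Bernoulli's inequality shows that the increment of \<open>x powr (1 - s)\<close> over
  the last unit step is at least \<open>(1 - s) * x powr (- s)\<close>, which is the induction
  step.\<close>

lemma sum_wt_upper:
  assumes s: "0 < s" "s < 1"
  shows "(\<Sum>k\<le>n. wt s k) \<le> (real n + 1) powr (1 - s) / (1 - s)"
proof (induction n)
  case 0
  show ?case using s by simp
next
  case (Suc n)
  define x where "x = real n + 2"
  have x: "x > 1" by (simp add: x_def)
  have "(x - 1) powr (1 - s) = x powr (1 - s) * (1 - 1 / x) powr (1 - s)"
    using x by (simp add: powr_mult[symmetric] right_diff_distrib)
  also have "\<dots> \<le> x powr (1 - s) * (1 - (1 - s) / x)"
    using bernoulli_powr[of "1 - s" x] s x by (intro mult_left_mono) auto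
  also have "\<dots> = x powr (1 - s) - (1 - s) * x powr (- s)"
    using x by (simp add: powr_diff powr_minus field_simps)
  finally have "((x - 1) powr (1 - s) + (1 - s) * x powr (- s)) / (1 - s) \<le> x powr (1 - s) / (1 - s)"
    using s by (intro divide_right_mono) auto
  then have "(x - 1) powr (1 - s) / (1 - s) + x powr (- s) \<le> x powr (1 - s) / (1 - s)"
    using s by (simp add: add_divide_distrib)
  then show ?case using Suc by (simp add: wt_def x_def algebra_simps)
qed

text \<open>The value \<open>q = 2\<close>, where the sum in \<open>renewal_err\<close> grows like a
  logarithm, is excluded; \<open>choose_exponents\<close> avoids it.\<close>

lemma renewal_err_negligible:
  assumes q: "q > 1" and \<gamma>: "q > 2 \<and> \<gamma> > - q \<or> q < 2 \<and> \<gamma> > 2 - 2 * q"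
  shows "(\<lambda>n. renewal_err q n / (real n + 1) powr \<gamma>) \<longlonglongrightarrow> 0"
proof -
  obtain C \<beta> where C: "\<beta> < \<gamma>" "\<And>n. renewal_err q n \<le> C * (real n + 1) powr \<beta>"
  proof (cases "q > 2")
    case True
    have "renewal_err q n \<le> suminf (wt (q - 1)) * (real n + 1) powr (- q)" for n
      unfolding renewal_err_def using sum_wt_le[of "q - 1" "{..n}"] True
      by (simp add: wt_def mult.commute mult_right_mono)
    then show ?thesis using that[of "- q" "suminf (wt (q - 1))"] \<gamma> True by auto
  next
    case False
    then have q2: "q < 2" "\<gamma> > 2 - 2 * q" using \<gamma> by auto
    have "renewal_err q n \<le> 1 / (2 - q) * (real n + 1) powr (2 - 2 * q)" for n
    proof -
      have "renewal_err q n \<le> wt q n * ((real n + 1) powr (1 - (q - 1)) / (1 - (q - 1)))"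
        unfolding renewal_err_def using q q2 by (intro mult_left_mono sum_wt_upper) auto
      also have "\<dots> = 1 / (2 - q) * ((real n + 1) powr (- q) * (real n + 1) powr (2 - q))"
        by (simp add: wt_def)
      also have "(real n + 1) powr (- q) * (real n + 1) powr (2 - q) = (real n + 1) powr (2 - 2 * q)"
        by (simp flip: powr_add)
      finally show ?thesis .
    qed
    then show ?thesis using that[of "2 - 2 * q" "1 / (2 - q)"] q2 by auto
  qed
  have lim: "(\<lambda>n. C * (real n + 1) powr (\<beta> - \<gamma>)) \<longlonglongrightarrow> 0"
    using C(1) by real_asymp
  have "norm (renewal_err q n / (real n + 1) powr \<gamma>) \<le> C * (real n + 1) powr (\<beta> - \<gamma>)" for n
    using C(2)[of n] by (simp add: powr_diff divide_right_mono)
  then show ?thesis by (intro Lim_null_comparison[OF _ lim] always_eventually allI)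
qed

lemma phase_dist_eq: "phase_dist (\<omega>, x) (\<omega>', y) = dw \<omega> \<omega>' + \<bar>x - y\<bar>"
  by (simp add: phase_dist_def dw_def)

lemma dw_pos: "\<omega> \<noteq> \<omega>' \<Longrightarrow> dw \<omega> \<omega>' > 0"
  by (simp add: dw_def)

lemma hoelder_bound:
  assumes "h \<in> hoelder N \<alpha>"
  obtains C where "C \<ge> 0" "\<And>z1 z2. z1 \<in> phase_space N \<Longrightarrow> z2 \<in> phase_space N \<Longrightarrow>
    \<bar>h z1 - h z2\<bar> \<le> C * phase_dist z1 z2 powr \<alpha>"
proof -
  obtain C where C: "\<And>z1 z2. z1 \<in> phase_space N \<Longrightarrow> z2 \<in> phase_space N \<Longrightarrow> z1 \<noteq> z2 \<Longrightarrow>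
      \<bar>h z1 - h z2\<bar> / phase_dist z1 z2 powr \<alpha> \<le> C"
    using assms unfolding hoelder_def bdd_above_def by blast
  show thesis
  proof (rule that[of "max C 0"])
    fix z1 z2 assume z: "z1 \<in> phase_space N" "z2 \<in> phase_space N"
    show "\<bar>h z1 - h z2\<bar> \<le> max C 0 * phase_dist z1 z2 powr \<alpha>"
    proof (cases "z1 = z2")
      case False
      obtain \<omega> x \<omega>' y where e: "z1 = (\<omega>, x)" "z2 = (\<omega>', y)" by (metis surj_pair)
      have "phase_dist z1 z2 > 0"
        using False dw_pos[of \<omega> \<omega>'] unfolding e phase_dist_eq
        by (cases "\<omega> = \<omega>'") (auto intro: add_nonneg_pos add_pos_nonneg)
      then have "\<bar>h z1 - h z2\<bar> \<le> C * phase_dist z1 z2 powr \<alpha>"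
        using C[OF z False] by (simp add: divide_le_eq)
      also have "\<dots> \<le> max C 0 * phase_dist z1 z2 powr \<alpha>" by (intro mult_right_mono) auto
      finally show ?thesis .
    qed simp
  qed simp
qed

section \<open>Hoelder functions as regular densities\<close>

context random_map
begin

lemma reg_mult:
  assumes "reg \<alpha> c e D1 0 H1" "reg \<alpha> c e D2 0 H2"
  shows "reg \<alpha> c e (D1 + D2) 0 (\<lambda>z. H1 z * H2 z)"
  unfolding reg_def
proof (intro conjI ballI)
  show "nonneg (\<lambda>z. H1 z * H2 z)"
    using reg_nonneg[OF assms(1)] reg_nonneg[OF assms(2)] by (simp add: nonneg_def)
  fix \<omega> \<omega>' u v assume *: "\<omega> \<in> \<Omega>N" "\<omega>' \<in> \<Omega>N" "u \<in> {0<..<1::real}" "v \<in> {0<..<1::real}"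
  let ?d = "(c * dw \<omega> \<omega>' + e * \<bar>u - v\<bar>) powr \<alpha>"
  have "H1 (\<omega>, u) * H2 (\<omega>, u) \<le> (exp (D1 * ?d + 0 * \<bar>u - v\<bar>) * H1 (\<omega>', v)) * (exp (D2 * ?d + 0 * \<bar>u - v\<bar>) * H2 (\<omega>', v))"
    using nonnegD[OF reg_nonneg[OF assms(1)] *(2,4)] nonnegD[OF reg_nonneg[OF assms(2)] *(1,3)]
    by (intro mult_mono regD[OF assms(1)] regD[OF assms(2)] *) auto
  then show "H1 (\<omega>, u) * H2 (\<omega>, u) \<le> exp ((D1 + D2) * ?d + 0 * \<bar>u - v\<bar>) * (H1 (\<omega>', v) * H2 (\<omega>', v))"
    by (simp add: distrib_right exp_add mult_ac)
qed

text \<open>Once \<open>fY h + c0 \<ge> C\<close>, the Hoelder bound is at most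
  \<open>fY h + c0\<close> times the \<open>\<alpha>\<close>-th power of the distance, and
  \<open>1 + y \<le> exp y\<close> makes this a logarithmic oscillation with constant
  \<open>1\<close>.\<close>

lemma hoelder_reg:
  assumes C: "C \<ge> 0" and \<alpha>: "\<alpha> > 0"
    and h: "\<And>z1 z2. z1 \<in> phase_space N \<Longrightarrow> z2 \<in> phase_space N \<Longrightarrow> \<bar>h z1 - h z2\<bar> \<le> C * phase_dist z1 z2 powr \<alpha>"
    and c0: "\<And>z. z \<in> space SU \<Longrightarrow> C \<le> fY h z + c0"
  shows "reg \<alpha> 1 1 1 0 (\<lambda>z. fY h z + c0)"
  unfolding reg_def
proof (intro conjI ballI)
  show "nonneg (\<lambda>z. fY h z + c0)" using c0 C unfolding nonneg_def by (meson order.trans)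
  fix \<omega> \<omega>' u v assume *: "\<omega> \<in> \<Omega>N" "\<omega>' \<in> \<Omega>N" "u \<in> {0<..<1::real}" "v \<in> {0<..<1::real}"
  let ?d = "1 * dw \<omega> \<omega>' + 1 * \<bar>u - v\<bar>"
  have lb: "C \<le> fY h (\<omega>', v) + c0" using * by (intro c0) (auto simp: space_SU)
  have "\<bar>h (\<omega>, (3 - u) / 4) - h (\<omega>', (3 - v) / 4)\<bar> \<le> C * phase_dist (\<omega>, (3 - u) / 4) (\<omega>', (3 - v) / 4) powr \<alpha>"
    using * by (intro h) (auto simp: phase_space_def)
  also have "\<dots> \<le> C * ?d powr \<alpha>"
  proof (intro mult_left_mono powr_mono2 C)
    have "(3 - u) / 4 - (3 - v) / 4 = (v - u) / 4" by (simp add: field_simps)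
    then have "\<bar>(3 - u) / 4 - (3 - v) / 4\<bar> = \<bar>u - v\<bar> / 4" by (simp only: abs_divide) (simp add: abs_minus_commute)
    moreover have "\<bar>u - v\<bar> / 4 \<le> \<bar>u - v\<bar>" by simp
    ultimately have "\<bar>(3 - u) / 4 - (3 - v) / 4\<bar> \<le> \<bar>u - v\<bar>" by (simp only:)
    then show "phase_dist (\<omega>, (3 - u) / 4) (\<omega>', (3 - v) / 4) \<le> ?d" unfolding phase_dist_eq by (simp only: mult_1_left add_left_mono)
  qed (use \<alpha> in \<open>auto simp: phase_dist_eq\<close>)
  also have "\<dots> \<le> (fY h (\<omega>', v) + c0) * ?d powr \<alpha>" by (intro mult_right_mono lb) auto
  finally have "fY h (\<omega>, u) + c0 \<le> (1 + ?d powr \<alpha>) * (fY h (\<omega>', v) + c0)"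
    by (simp add: fY_def algebra_simps)
  also have "\<dots> \<le> exp (?d powr \<alpha>) * (fY h (\<omega>', v) + c0)"
    using lb C by (intro mult_right_mono exp_ge_add_one_self) auto
  finally show "fY h (\<omega>, u) + c0 \<le> exp (1 * ?d powr \<alpha> + 0 * \<bar>u - v\<bar>) * (fY h (\<omega>', v) + c0)" by simp
qed

text \<open>Compare with \<open>(\<omega>, 0)\<close>, where \<open>h\<close> vanishes by
  \<open>suppY\<close>; the distance is at most \<open>1\<close>.\<close>

lemma hoelder_bounded:
  assumes C: "C \<ge> 0" and \<alpha>: "\<alpha> > 0" "\<alpha> < 1"
    and h: "\<And>z1 z2. z1 \<in> phase_space N \<Longrightarrow> z2 \<in> phase_space N \<Longrightarrow> \<bar>h z1 - h z2\<bar> \<le> C * phase_dist z1 z2 powr \<alpha>"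
    and h0: "suppY h" and z: "z \<in> phase_space N"
  shows "\<bar>h z\<bar> \<le> 2 * C"
proof -
  obtain \<omega> x where e: "z = (\<omega>, x)" by (metis surj_pair)
  have w: "\<omega> \<in> \<Omega>N" "x \<in> {0..1}" using z by (auto simp: e phase_space_def)
  have "h (\<omega>, 0) = 0" using w by (intro suppYD[OF h0]) auto
  moreover have "\<bar>h z - h (\<omega>, 0)\<bar> \<le> C * phase_dist z (\<omega>, 0) powr \<alpha>"
    using w by (intro h z) (auto simp: phase_space_def)
  moreover have "phase_dist z (\<omega>, 0) powr \<alpha> \<le> 1 powr \<alpha>"
    using w \<alpha> by (intro powr_mono2) (auto simp: e phase_dist_eq dw_def)
  then have "C * phase_dist z (\<omega>, 0) powr \<alpha> \<le> C * 2" using C by (intro mult_left_mono) auto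
  ultimately show ?thesis by simp
qed

end

context mixing_map
begin

text \<open>The terms from \<open>n + 1\<close> to \<open>2 * n + 1\<close> suffice: there are
  \<open>n + 1\<close> of them, each at least \<open>c * (2 * (n + 1)) powr (- a)\<close>, because
  mass that has not returned cannot have regenerated.\<close>

lemma tail_sum_lower:
  assumes b: "b \<in> B" and a: "a > 0" and L: "(\<Sum>j\<in>{j\<in>B. l j \<ge> l b}. p j) * l b powr a = 1"
  shows "\<exists>c>0. \<forall>n. c * (real n + 1) powr (1 - a) \<le> M - (\<Sum>k\<le>n. rg.T k (\<lambda>_. 1))"
proof -
  obtain c where c: "c > 0" "\<And>n s. s \<ge> 1 \<Longrightarrow> c * min 1 ((s / (real n + 1)) powr a) \<le> tail_mass n s (\<lambda>_. 1)"
    using tail_mass_lower[OF b a L G_nonempty] by blast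
  have T: "c * (real n + 1) powr (- a) \<le> rg.T n (\<lambda>_. 1)" for n
  proof -
    have "(1 / (real n + 1)) powr a \<le> 1" using a by (intro powr_le1) auto
    then have "c * (real n + 1) powr (- a) = c * min 1 ((1 / (real n + 1)) powr a)"
      by (simp add: powr_divide powr_minus field_simps)
    also have "\<dots> \<le> tail_mass n 1 (\<lambda>_. 1)" by (rule c(2)) simp
    also have "\<dots> = rg.return_tail n (\<lambda>_. 1)" by (simp add: tail_mass_def rg.return_tail_def)
    also have "\<dots> \<le> rg.T n (\<lambda>_. 1)" by (rule rg.return_tail_le_T[OF rg.one(1)])
    finally show ?thesis .
  qed
  have "c * 2 powr (- a) * (real n + 1) powr (1 - a) \<le> M - (\<Sum>k\<le>n. rg.T k (\<lambda>_. 1))" for n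
  proof -
    have "c * 2 powr (- a) * (real n + 1) powr (1 - a) = (real n + 1) * (c * (2 * (real n + 1)) powr (- a))"
    proof -
      have "(real n + 1) powr (1 - a) = (real n + 1) * (real n + 1) powr (- a)"
        by (simp add: powr_mult_base)
      moreover have "(2 * (real n + 1)) powr (- a) = 2 powr (- a) * (real n + 1) powr (- a)"
        by (rule powr_mult; simp)
      ultimately show ?thesis by (simp only: mult_ac)
    qed
    also have "\<dots> = (\<Sum>k\<in>{Suc n..2 * n + 1}. c * (2 * (real n + 1)) powr (- a))" by simp
    also have "\<dots> \<le> (\<Sum>k\<in>{Suc n..2 * n + 1}. rg.T k (\<lambda>_. 1))"
    proof (rule sum_mono)
      fix k assume k: "k \<in> {Suc n..2 * n + 1}"
      then have "(2 * (real n + 1)) powr (- a) \<le> (real k + 1) powr (- a)"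
        using a by (intro powr_mono2') auto
      then have "c * (2 * (real n + 1)) powr (- a) \<le> c * (real k + 1) powr (- a)" using c by simp
      also have "\<dots> \<le> rg.T k (\<lambda>_. 1)" by (rule T)
      finally show "c * (2 * (real n + 1)) powr (- a) \<le> rg.T k (\<lambda>_. 1)" .
    qed
    also have "\<dots> = (\<Sum>k\<le>2 * n + 1. rg.T k (\<lambda>_. 1)) - (\<Sum>k\<le>n. rg.T k (\<lambda>_. 1))"
    proof -
      have "{..2 * n + 1} = {..n} \<union> {Suc n..2 * n + 1}" by auto
      then have "(\<Sum>k\<le>2 * n + 1. rg.T k (\<lambda>_. 1)) = (\<Sum>k\<le>n. rg.T k (\<lambda>_. 1)) + (\<Sum>k\<in>{Suc n..2 * n + 1}. rg.T k (\<lambda>_. 1))"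
        by (simp only:) (rule sum.union_disjoint; auto)
      then show ?thesis by simp
    qed
    also have "\<dots> \<le> M - (\<Sum>k\<le>n. rg.T k (\<lambda>_. 1))" using T_partial(2)[of "2 * n + 1"] by simp
    finally show ?thesis .
  qed
  moreover have "c * 2 powr (- a) > 0" using c by simp
  ultimately show ?thesis by blast
qed

end

lemma linear_combination:
  fixes a1 a2 i1 i2 c F m S :: real
  shows "(a1 - c * a2) - F * (i1 - c * i2) * (m / S) =
    (a1 - i1 * (m * F) * (1 / S)) - c * (a2 - i2 * (m * F) * (1 / S))"
  unfolding divide_inverse by algebra

context acs_map
begin

lemma suppY_mult: "suppY h \<Longrightarrow> suppY (\<lambda>z. g z * h z)"
  by (simp add: suppY_def)

lemma integral_PM_\<rho>: "bmeas SX f \<Longrightarrow> suppY f \<Longrightarrow> (\<integral>z. f z \<partial>PM) = I (\<lambda>z. \<rho> z * fY f z)"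
  by (simp add: integral_PM w1_eq)

text \<open>Applying \<open>integral_PM\<close> to the product \<open>psi f (Suc n) z * h z\<close> itself shows that \<open>\<rho>\<close> is also the joint density with the symbols.\<close>

lemma product_integral:
  assumes f: "bmeas SX f" and h: "bmeas SX h" "suppY h"
  shows "(\<integral>z. psi f (Suc n) z * h z \<partial>PM) = A f n 1 (Nn (\<lambda>z. \<rho> z * fY h z))"
proof -
  let ?X = "\<lambda>z. \<rho> z * fY h z"
  have bX: "bmeas SU ?X" by (intro bmeas_mult \<rho>_bmeas fY_bmeas h)
  have bP: "bmeas SX (\<lambda>z. psi f (Suc n) z * h z)" by (intro bmeas_mult psi_bmeas f h)
  have bY: "bmeas SU (\<lambda>z. \<rho> z * fY (\<lambda>z. psi f (Suc n) z * h z) z)"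
    by (intro bmeas_mult \<rho>_bmeas fY_bmeas bP)
  have bA: "bmeas SU (\<lambda>z. pre j ?X z * psi f n (fst z, xI 1 (snd z)))" if "j \<in> {1..N}" for j
    by (intro A_integrand f bmeas_pre bX that) simp
  have "(\<integral>z. psi f (Suc n) z * h z \<partial>PM) = I (\<lambda>z. \<rho> z * fY (\<lambda>z. psi f (Suc n) z * h z) z)"
    by (intro integral_PM_\<rho> bP suppY_mult h)
  also have "\<dots> = (\<Sum>j\<in>{1..N}. p j * I (pre j (\<lambda>z. \<rho> z * fY (\<lambda>z. psi f (Suc n) z * h z) z)))"
    by (rule I_shift[OF bY])
  also have "\<dots> = (\<Sum>j\<in>{1..N}. p j * I (\<lambda>z. pre j ?X z * psi f n (fst z, xI 1 (snd z))))"
  proof (intro sum.cong refl arg_cong2[of _ _ _ _ "(*)"] I_cong)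
    fix j z assume j: "j \<in> {1..N}" and z: "z \<in> space SU"
    then have u: "snd z \<in> {0<..<1}" by (auto simp: space_SU)
    then have "T j ((3 - snd z) / 4) = xI 1 (snd z)"
      using T_right[OF j, of "(3 - snd z) / 4"] by (simp add: xI_def field_simps)
    then show "pre j (\<lambda>z. \<rho> z * fY (\<lambda>z. psi f (Suc n) z * h z) z) z =
        pre j ?X z * psi f n (fst z, xI 1 (snd z))"
      by (simp only: pre_def fY_def psi_case_nat fst_conv snd_conv mult_ac)
  qed
  also have "\<dots> = I (\<lambda>z. \<Sum>j\<in>{1..N}. p j * (pre j ?X z * psi f n (fst z, xI 1 (snd z))))"
    by (subst I_sum) (auto simp: I_cmult intro!: bmeas_cmult bA)
  also have "\<dots> = A f n 1 (Nn ?X)"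
    by (simp add: A_def Nn_def sum_distrib_right mult.assoc)
  finally show ?thesis .
qed

text \<open>Since \<open>h\<close> may change sign, \<open>fY h\<close> is written as
  \<open>(fY h + c0) - c0\<close>. The product \<open>\<rho> * (fY h + c0)\<close> has oscillation
  bound \<open>(D0 - 1) + 1\<close>, so it fits into the cone, and the estimates for it and for
  \<open>\<rho>\<close> are combined linearly.\<close>

theorem correlation_estimate:
  assumes f: "bmeas SX f" "suppY f" and h: "bmeas SX h" "suppY h"
    and C: "C \<ge> 0" "\<And>z1 z2. z1 \<in> phase_space N \<Longrightarrow> z2 \<in> phase_space N \<Longrightarrow> \<bar>h z1 - h z2\<bar> \<le> C * phase_dist z1 z2 powr \<alpha>"
  shows "\<exists>A. \<forall>n. \<bar>(\<integral>z. psi f (Suc n) z * h z \<partial>PM) -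
    (\<integral>z. f z \<partial>PM) * (\<integral>z. h z \<partial>PM) * (M / (\<Sum>k\<le>n. rg.T k (\<lambda>_. 1)))\<bar> \<le> A * renewal_err q n"
proof -
  \<comment> \<open>As \<open>\<bar>fY h z\<bar> \<le> 2 * C\<close>, the shift leaves at least
    \<open>C\<close>, as \<open>hoelder_reg\<close> requires.\<close>
  define c0 where "c0 = 3 * C"
  have bd: "\<bar>fY h z\<bar> \<le> 2 * C" if "z \<in> space SU" for z
    unfolding fY_def using measurable_space[OF xY_measurable that]
    by (intro hoelder_bounded[OF C(1) \<alpha> C(2) h(2)]) (auto simp: space_SX)
  have lb: "C \<le> fY h z + c0" if "z \<in> space SU" for z
    using bd[OF that] by (simp add: c0_def)
  have bY: "bmeas SU (fY h)" by (rule fY_bmeas[OF h(1)])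
  let ?H1 = "\<lambda>z. \<rho> z * (fY h z + c0)"
  have b1: "bmeas SU ?H1" by (intro bmeas_mult \<rho>_bmeas bmeas_add bY bmeas_const)
  have r1: "reg \<alpha> 1 1 D0 0 ?H1"
    using reg_mult[OF \<rho>_reg hoelder_reg[OF C(1) \<alpha>(1) C(2) lb]] by simp
  have r2: "reg \<alpha> 1 1 D0 0 \<rho>" by (rule reg_minus1_imp[OF \<rho>_reg])
  have C1: "Nn ?H1 \<in> Cone" and C2: "Nn \<rho> \<in> Cone"
    unfolding Cone_def using D0 \<alpha> by (auto intro!: bmeas_Nn b1 \<rho>_bmeas reg_Nn r1 r2)
  obtain A1 where A1: "\<And>n. \<bar>A f n 1 (Nn ?H1) - I (Nn ?H1) * w1 f * (1 / (\<Sum>k\<le>n. rg.T k (\<lambda>_. 1)))\<bar> \<le> A1 * renewal_err q n"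
    using A_estimate[OF f C1] by blast
  obtain A2 where A2: "\<And>n. \<bar>A f n 1 (Nn \<rho>) - I (Nn \<rho>) * w1 f * (1 / (\<Sum>k\<le>n. rg.T k (\<lambda>_. 1)))\<bar> \<le> A2 * renewal_err q n"
    using A_estimate[OF f C2] by blast
  have Neq: "Nn (\<lambda>z. \<rho> z * fY h z) = (\<lambda>z. Nn ?H1 z - c0 * Nn \<rho> z)"
    by (rule ext) (simp add: Nn_def pre_def sum_distrib_left sum_subtractf[symmetric] algebra_simps)
  have bN: "bmeas SU (Nn ?H1)" "bmeas SU (Nn \<rho>)" by (intro bmeas_Nn b1 \<rho>_bmeas)+
  have Aeq: "A f n 1 (Nn (\<lambda>z. \<rho> z * fY h z)) = A f n 1 (Nn ?H1) - c0 * A f n 1 (Nn \<rho>)" for n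
    unfolding Neq by (subst A_diff) (auto simp: A_cmult f intro: bN)
  have "(\<integral>z. h z \<partial>PM) = I (Nn (\<lambda>z. \<rho> z * fY h z))"
    using integral_PM_\<rho>[OF h] I_Nn[OF bmeas_mult[OF \<rho>_bmeas bY]] by simp
  also have "\<dots> = I (Nn ?H1) - c0 * I (Nn \<rho>)"
    unfolding Neq by (subst I_diff) (auto simp: I_cmult intro: bN)
  finally have Ieq: "(\<integral>z. h z \<partial>PM) = I (Nn ?H1) - c0 * I (Nn \<rho>)" .
  have w1: "w1 f = M * (\<integral>z. f z \<partial>PM)" using integral_PM[OF f] M_ge_1 by simp
  show ?thesis
  proof (intro exI allI)
    fix n
    let ?S = "\<Sum>k\<le>n. rg.T k (\<lambda>_. 1)"
    define x1 where "x1 = A f n 1 (Nn ?H1) - I (Nn ?H1) * w1 f * (1 / ?S)"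
    define x2 where "x2 = A f n 1 (Nn \<rho>) - I (Nn \<rho>) * w1 f * (1 / ?S)"
    have "(\<integral>z. psi f (Suc n) z * h z \<partial>PM) - (\<integral>z. f z \<partial>PM) * (\<integral>z. h z \<partial>PM) * (M / ?S) = x1 - c0 * x2"
      unfolding product_integral[OF f(1) h] Aeq Ieq x1_def x2_def w1 by (rule linear_combination)
    moreover have "\<bar>x1 - c0 * x2\<bar> \<le> \<bar>x1\<bar> + c0 * \<bar>x2\<bar>"
      using abs_triangle_ineq4[of x1 "c0 * x2"] C(1) by (simp add: abs_mult c0_def)
    moreover have "\<bar>x1\<bar> \<le> A1 * renewal_err q n" unfolding x1_def by (rule A1)
    moreover have "c0 * \<bar>x2\<bar> \<le> c0 * (A2 * renewal_err q n)"
      unfolding x2_def using A2[of n] C(1) by (intro mult_left_mono) (auto simp: c0_def)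
    ultimately show "\<bar>(\<integral>z. psi f (Suc n) z * h z \<partial>PM) - (\<integral>z. f z \<partial>PM) * (\<integral>z. h z \<partial>PM) * (M / ?S)\<bar> \<le>
        (A1 + c0 * A2) * renewal_err q n" by (simp add: algebra_simps)
  qed
qed

text \<open>With the partial sum \<open>S \<le> M\<close>, the main term contains
  \<open>M / S - 1 = (M - S) / S \<ge> (M - S) / M\<close>, and \<open>tail_sum_lower\<close> bounds
  \<open>M - S\<close> from below. Half of this absorbs the renewal error.\<close>

theorem correlation_lower_bound:
  assumes f: "bmeas SX f" "suppY f" and h: "bmeas SX h" "suppY h"
    and C: "C \<ge> 0" "\<And>z1 z2. z1 \<in> phase_space N \<Longrightarrow> z2 \<in> phase_space N \<Longrightarrow> \<bar>h z1 - h z2\<bar> \<le> C * phase_dist z1 z2 powr \<alpha>"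
    and pos: "(\<integral>z. f z \<partial>PM) * (\<integral>z. h z \<partial>PM) > 0"
    and b: "b \<in> B" and a: "a > 0" and L: "(\<Sum>j\<in>{j\<in>B. l j \<ge> l b}. p j) * l b powr a = 1"
    and qa: "q > 2 \<and> 1 - a > - q \<or> q < 2 \<and> 1 - a > 2 - 2 * q"
  shows "\<exists>c>0. eventually (\<lambda>n. c * (real n + 1) powr (1 - a) \<le>
    \<bar>(\<integral>z. psi f (Suc n) z * h z \<partial>PM) - (\<integral>z. f z \<partial>PM) * (\<integral>z. h z \<partial>PM)\<bar>) sequentially"
proof -
  define P where "P = (\<integral>z. f z \<partial>PM) * (\<integral>z. h z \<partial>PM)"
  obtain A where A: "\<And>n. \<bar>(\<integral>z. psi f (Suc n) z * h z \<partial>PM) - P * (M / (\<Sum>k\<le>n. rg.T k (\<lambda>_. 1)))\<bar> \<le> A * renewal_err q n"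
    using correlation_estimate[OF f h C] unfolding P_def by blast
  obtain c where c: "c > 0" "\<And>n. c * (real n + 1) powr (1 - a) \<le> M - (\<Sum>k\<le>n. rg.T k (\<lambda>_. 1))"
    using tail_sum_lower[OF b a L] by blast
  define c1 where "c1 = P * c / M"
  have c1: "c1 > 0" using pos c M_ge_1 by (simp add: c1_def P_def)
  have "(\<lambda>n. A * (renewal_err q n / (real n + 1) powr (1 - a))) \<longlonglongrightarrow> A * 0"
    using renewal_err_negligible[OF q(1) qa] by (intro tendsto_intros)
  then have "eventually (\<lambda>n. A * (renewal_err q n / (real n + 1) powr (1 - a)) < c1 / 2) sequentially"
    using c1 by (intro order_tendstoD) auto
  then have "eventually (\<lambda>n. c1 / 2 * (real n + 1) powr (1 - a) \<le>
    \<bar>(\<integral>z. psi f (Suc n) z * h z \<partial>PM) - P\<bar>) sequentially"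
  proof eventually_elim
    case (elim n)
    let ?x = "(real n + 1) powr (1 - a)" and ?S = "\<Sum>k\<le>n. rg.T k (\<lambda>_. 1)"
    have x: "?x > 0" by simp
    have e: "A * renewal_err q n \<le> c1 / 2 * ?x" using elim x by (simp add: field_simps)
    have "c1 * ?x = P / M * (c * ?x)" by (simp add: c1_def)
    also have "\<dots> \<le> P / M * (M - ?S)"
      using c(2)[of n] pos M_ge_1 by (intro mult_left_mono) (auto simp: P_def)
    also have "\<dots> \<le> P / ?S * (M - ?S)"
    proof (intro mult_right_mono divide_left_mono)
      show "0 < M * ?S" using M_ge_1 T_partial(1)[of n] by (intro mult_pos_pos) auto
    qed (use pos T_partial[of n] in \<open>auto simp: P_def\<close>)
    also have "\<dots> = P * (M / ?S) - P" using T_partial(1)[of n] by (simp add: field_simps)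
    finally show ?case using A[of n] e by linarith
  qed
  then show ?thesis using c1 unfolding P_def by (intro exI[of _ "c1 / 2"]) auto
qed

end

text \<open>At \<open>x = 1/4\<close> a good map is at least \<open>1/2\<close>, a bad one is below
  it.\<close>

lemma not_good_and_bad: "good_map a S \<Longrightarrow> \<not> bad_map b S"
proof
  assume g: "good_map a S" and b: "bad_map b S"
  have a: "a \<ge> 1" and "S (1/4) = 1 - 2 powr a * (1/2 - 1/4) powr a"
    using g unfolding good_map_def by auto
  moreover have "2 powr a * (1/2 - 1/4) powr a = (1/2) powr a"
    by (simp add: powr_mult[symmetric])
  moreover have "(1/2::real) powr a \<le> (1/2) powr 1"
    using a by (intro powr_mono') auto
  ultimately have "S (1/4) \<ge> 1/2" by simp
  moreover have "S (1/4) = 1/2 - 2 powr (b - 1) * (1/2 - 1/4) powr b"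
    using b unfolding bad_map_def by auto
  then have "S (1/4) < 1/2" by simp
  ultimately show False by simp
qed

text \<open>With \<open>L\<close> the largest exponent, \<open>theta\<close> equals
  \<open>L powr gamma1\<close>, and \<open>l b powr q \<le> l b * L powr (q - 1)\<close>. So the
  moment is at most \<open>L powr (gamma1 + q - 1)\<close>.\<close>

lemma gamma1_neg_and_moment:
  assumes B: "finite B" "B \<noteq> {}" and l: "\<And>b. b \<in> B \<Longrightarrow> l b > (1::real)" and p: "\<And>b. b \<in> B \<Longrightarrow> p b > 0"
    and \<theta>: "theta B l p < 1"
  shows "gamma1 B l p < 0"
    and "1 \<le> q \<Longrightarrow> q < 1 - gamma1 B l p \<Longrightarrow> (\<Sum>b\<in>B. p b * l b powr q) < 1"
proof -
  define L where "L = Max (l ` B)"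
  have "L \<in> l ` B" unfolding L_def using B by (intro Max_in) auto
  then have L: "L > 1" using l by auto
  have le: "l b \<le> L" if "b \<in> B" for b unfolding L_def using B that by (intro Max_ge) auto
  have \<theta>0: "theta B l p > 0"
    unfolding theta_def using B l p by (intro sum_pos mult_pos_pos) (auto intro: less_trans[of 0 1])
  have lnL: "ln L > 0" using L by simp
  show "gamma1 B l p < 0"
    using \<theta> \<theta>0 lnL by (simp add: gamma1_def L_def[symmetric] divide_neg_pos)
  have \<theta>L: "theta B l p = L powr gamma1 B l p"
    using \<theta>0 lnL L by (simp add: gamma1_def L_def[symmetric] powr_def)
  assume q: "1 \<le> q" "q < 1 - gamma1 B l p"
  have "(\<Sum>b\<in>B. p b * l b powr q) \<le> (\<Sum>b\<in>B. p b * l b * L powr (q - 1))"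
  proof (rule sum_mono)
    fix b assume b: "b \<in> B"
    have "l b powr q = l b * l b powr (q - 1)" using l[OF b] by (simp add: powr_mult_base)
    also have "\<dots> \<le> l b * L powr (q - 1)"
      using l[OF b] le[OF b] q by (intro mult_left_mono powr_mono2) auto
    finally show "p b * l b powr q \<le> p b * l b * L powr (q - 1)"
      using p[OF b] by (simp add: mult.assoc)
  qed
  also have "\<dots> = L powr (gamma1 B l p + (q - 1))"
    unfolding sum_distrib_right[symmetric] theta_def[symmetric] \<theta>L by (simp add: powr_add)
  also have "\<dots> < 1" using L q by (intro powr_less_one) auto
  finally show "(\<Sum>b\<in>B. p b * l b powr q) < 1" .
qed

text \<open>The gap conditions leave room for a moment exponent \<open>q\<close> for which the renewal error term is
  negligible against \<open>n powr \<gamma>2\<close>.\<close>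

lemma choose_exponents:
  fixes \<gamma>1 \<gamma>2 :: real
  assumes "\<gamma>1 < 0" and "\<gamma>1 < -1 \<Longrightarrow> \<gamma>2 > \<gamma>1 - 1" and "-1 \<le> \<gamma>1 \<Longrightarrow> \<gamma>2 > 2 * \<gamma>1" and "\<gamma>2 \<le> 1"
  obtains q q0 where "1 < q" "q < q0" "q0 < 1 - \<gamma>1" "q > 2 \<and> \<gamma>2 > - q \<or> q < 2 \<and> \<gamma>2 > 2 - 2 * q"
proof (cases "\<gamma>1 < -1")
  case True
  then have "max 2 (- \<gamma>2) < 1 - \<gamma>1" using assms by auto
  then obtain q where q: "max 2 (- \<gamma>2) < q" "q < 1 - \<gamma>1" using dense by blast
  obtain q0 where "q < q0" "q0 < 1 - \<gamma>1" using dense[OF q(2)] by blast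
  then show thesis using q by (intro that[of q q0]) auto
next
  case False
  then have "max 1 (1 - \<gamma>2 / 2) < 1 - \<gamma>1" using assms by auto
  then obtain q where q: "max 1 (1 - \<gamma>2 / 2) < q" "q < 1 - \<gamma>1" using dense by blast
  obtain q0 where "q < q0" "q0 < 1 - \<gamma>1" using dense[OF q(2)] by blast
  then show thesis using q False by (intro that[of q q0]) auto
qed

context acs_map
begin

lemma psi_measurable: "f \<in> borel_measurable SX \<Longrightarrow> psi f n \<in> borel_measurable SX"
proof (induction n)
  case (Suc n)
  show ?case
    using measurable_compose[OF skew_measurable Suc.IH[OF Suc.prems]] by (simp add: psi_Suc[abs_def])
qed simp

text \<open>The indicator \<open>e\<close> of the set where \<open>f\<close> and \<open>g\<close>
  differ has integral \<open>0\<close>, hence so has \<open>psi e n\<close> by invariance.\<close>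

lemma psi_AE_cong:
  assumes f: "f \<in> borel_measurable SX" and g: "g \<in> borel_measurable SX"
    and eq: "AE z in PM. f z = g z"
  shows "AE z in PM. psi f n z = psi g n z"
proof -
  define e where "e z = (if f z = g z then 0 else 1 :: real)" for z
  have "{z \<in> space SX. f z = g z} \<in> sets SX" using f g by measurable
  then have em: "e \<in> borel_measurable SX"
    unfolding e_def by (intro measurable_If) auto
  then have e: "bmeas SX e" by (rule bmeasI[where c = 1]) (simp add: e_def)
  have "AE z in PM. e z = 0" using eq by eventually_elim (simp add: e_def)
  then have "(\<integral>z. e z \<partial>PM) = 0" by (rule integral_eq_zero_AE)
  then have 0: "(\<integral>z. psi e n z \<partial>PM) = 0" by (simp add: PM_invariant[OF e])
  have "bmeas PM (psi e n)" using psi_bmeas[OF e] by (simp add: bmeas_PM)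
  then have "integrable PM (psi e n)" by (rule bmeas_integrable[OF prob_PM])
  moreover have "AE z in PM. 0 \<le> psi e n z" by (simp add: psi_def e_def)
  ultimately have "AE z in PM. psi e n z = 0"
    using integral_nonneg_eq_0_iff_AE 0 by blast
  then show ?thesis by eventually_elim (simp add: psi_def e_def split: if_splits)
qed

end

theorem theorem1p4:
  fixes N :: nat
    and T :: "nat \<Rightarrow> real \<Rightarrow> real"
    and p l :: "nat \<Rightarrow> real"
    and B :: "nat set"
    and \<mu> :: "real measure"
    and PM :: "((nat \<Rightarrow> nat) \<times> real) measure"
    and f h :: "(nat \<Rightarrow> nat) \<times> real \<Rightarrow> real"
  assumes good_or_bad: "\<And>j. j \<in> {1..N} \<Longrightarrow> (\<exists>r. good_map r (T j)) \<or> (\<exists>l'. bad_map l' (T j))"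
    and good_nonempty: "good_symbols N T \<noteq> {}"
    and B_eq: "B = bad_symbols N T"
    and bad_nonempty: "B \<noteq> {}"
    and l_param: "\<And>b. b \<in> B \<Longrightarrow> bad_map (l b) (T b)"
    and p_pos: "\<And>j. j \<in> {1..N} \<Longrightarrow> p j > 0"
    and p_sum: "(\<Sum>j\<in>{1..N}. p j) = 1"
    and theta_less: "theta B l p < 1"
    and mu_prob: "prob_space \<mu>"
    and mu_acs: "acs_measure N T p \<mu>"
    and PM_eq: "PM = bernoulli_measure N p \<Otimes>\<^sub>M \<mu>"
    and gap1: "gamma1 B l p < -1 \<Longrightarrow> gamma2 B l p > gamma1 B l p - 1"
    and gap2: "-1 \<le> gamma1 B l p \<Longrightarrow> gamma1 B l p < 0 \<Longrightarrow> gamma2 B l p > 2 * gamma1 B l p"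
    and f_bounded: "f \<in> L_infinity PM"
    and h_hoelder: "h \<in> hoelder_functions N"
    and f_zero: "\<And>\<omega> x. (\<omega>, x) \<in> phase_space N \<Longrightarrow> x \<in> {0..1/2} \<union> {3/4..1} \<Longrightarrow> f (\<omega>, x) = 0"
    and h_zero: "\<And>\<omega> x. (\<omega>, x) \<in> phase_space N \<Longrightarrow> x \<in> {0..1/2} \<union> {3/4..1} \<Longrightarrow> h (\<omega>, x) = 0"
    and integrals_pos: "(LINT z|PM. f z) * (LINT z|PM. h z) > 0"
  shows "(\<lambda>n. \<bar>correlation PM (skew_map T) n f h\<bar>) \<in> \<Omega>(\<lambda>n. real n powr gamma2 B l p)"
proof -
  have B_sub: "B \<subseteq> {1..N}" unfolding B_eq bad_symbols_def by auto
  then have fin: "finite B" by (rule finite_subset) simp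
  have l1: "l b > 1" if "b \<in> B" for b using l_param[OF that] by (simp add: bad_map_def)
  have pB: "p b > 0" if "b \<in> B" for b using p_pos B_sub that by blast
  define r where "r g = (SOME r. good_map r (T g))" for g
  have good: "good_map (r g) (T g)" if "g \<in> {1..N} - B" for g
  proof -
    have "\<exists>r. good_map r (T g)"
      using good_or_bad[of g] that unfolding B_eq bad_symbols_def by blast
    then show ?thesis unfolding r_def by (rule someI_ex)
  qed
  have G_ne: "{1..N} - B \<noteq> {}"
    using good_nonempty not_good_and_bad l_param unfolding good_symbols_def by blast
  obtain \<alpha> where \<alpha>: "0 < \<alpha>" "\<alpha> < 1" "h \<in> hoelder N \<alpha>"
    using h_hoelder by (auto simp: hoelder_functions_def)
  obtain C where C: "C \<ge> 0" "\<And>z1 z2. z1 \<in> phase_space N \<Longrightarrow> z2 \<in> phase_space N \<Longrightarrow>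
    \<bar>h z1 - h z2\<bar> \<le> C * phase_dist z1 z2 powr \<alpha>"
    using hoelder_bound[OF \<alpha>(3)] by blast
  interpret random_map N p B l r T
    by unfold_locales (use p_pos p_sum B_sub l_param good in auto)
  have Gne: "G \<noteq> {}" using G_ne by (simp add: G_def)
  have \<gamma>1: "gamma1 B l p < 0" by (rule gamma1_neg_and_moment(1)[OF fin bad_nonempty l1 pB theta_less])
  have "gamma2 B l p - 1 \<in> (\<lambda>b. ln (pi_bad B l p b) / ln (l b)) ` B"
    unfolding gamma2_def using fin bad_nonempty Max_in[of "(\<lambda>b. ln (pi_bad B l p b) / ln (l b)) ` B"] by simp
  then obtain b where b: "b \<in> B" "gamma2 B l p - 1 = ln (pi_bad B l p b) / ln (l b)" by auto
  \<comment> \<open>The exponent with \<open>\<pi> * l b powr a = 1\<close> for a letter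
    \<open>b\<close> attaining the maximum in \<open>gamma2\<close>, so that \<open>1 - a\<close> is
    \<open>gamma2\<close>.\<close>
  define a where "a = 1 - gamma2 B l p"
  define \<pi> where "\<pi> = pi_bad B l p b"
  have \<pi>0: "\<pi> > 0" unfolding \<pi>_def pi_bad_def using fin b pB by (intro sum_pos) auto
  have "\<pi> \<le> (\<Sum>j\<in>B. p j)"
    unfolding \<pi>_def pi_bad_def using fin pB by (intro sum_mono2) (auto intro: less_imp_le)
  \<comment> \<open>Strict because some good letter has positive probability; this is what makes
    \<open>a\<close> positive.\<close>
  also have "(\<Sum>j\<in>B. p j) < (\<Sum>j\<in>B. p j) + (\<Sum>j\<in>G. p j)"
    using Gne p_pos letter_G by (simp add: sum_pos)
  also have "\<dots> = 1" using sum_letters[of p] p_sum by simp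
  finally have \<pi>1: "\<pi> < 1" .
  have lnl: "ln (l b) > 0" using l1[OF b(1)] by simp
  have a_eq: "a * ln (l b) = - ln \<pi>"
    using b(2) lnl by (simp add: a_def \<pi>_def field_simps)
  have a: "a > 0"
  proof -
    have "a * ln (l b) > 0" unfolding a_eq using \<pi>0 \<pi>1 by simp
    then show ?thesis using lnl by (simp add: zero_less_mult_iff)
  qed
  have L: "(\<Sum>j\<in>{j\<in>B. l j \<ge> l b}. p j) * l b powr a = 1"
  proof -
    have "l b powr a = exp (- ln \<pi>)" using l1[OF b(1)] by (simp add: powr_def a_eq)
    also have "\<dots> = 1 / \<pi>" using \<pi>0 by (simp add: exp_minus inverse_eq_divide)
    finally show ?thesis using \<pi>0 by (simp add: \<pi>_def pi_bad_def)
  qed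
  have g2: "gamma2 B l p \<le> 1" using a by (simp add: a_def)
  obtain q q0 where qs: "1 < q" "q < q0" "q0 < 1 - gamma1 B l p"
    "q > 2 \<and> gamma2 B l p > - q \<or> q < 2 \<and> gamma2 B l p > 2 - 2 * q"
    using choose_exponents[OF \<gamma>1 gap1 gap2[OF _ \<gamma>1] g2] by blast
  have moment: "(\<Sum>b\<in>B. p b * l b powr q0) < 1"
    using qs by (intro gamma1_neg_and_moment(2)[OF fin bad_nonempty l1 pB theta_less]) auto
  interpret acs_map N p B l r T \<alpha> q0 q \<mu>
    by (intro acs_map.intro mixing_map.intro random_map_axioms mixing_map_axioms.intro
        acs_map_axioms.intro \<alpha>(1,2) qs(1,2) moment Gne mu_prob mu_acs)
  have hs: "suppY h" and fs: "suppY f"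
    unfolding suppY_def using h_zero f_zero by (auto simp: phase_space_def)
  have hb: "bmeas SX h"
  proof (rule bmeasI)
    \<comment> \<open>The integral of a non-integrable function is \<open>0\<close> by default, so
      positivity of the product supplies integrability of \<open>h\<close>, and with it
      measurability.\<close>
    have "integrable PM h" using integrals_pos not_integrable_integral_eq by fastforce
    then show "h \<in> borel_measurable SX"
      using measurable_cong_sets[OF sets_PM refl] unfolding PM_eq by auto
    show "\<bar>h z\<bar> \<le> 2 * C" if "z \<in> space SX" for z
      using that by (intro hoelder_bounded[OF C(1) \<alpha>(1,2) C(2) hs]) (simp_all add: space_SX)
  qed
  have fm: "f \<in> borel_measurable SX"
    using f_bounded measurable_cong_sets[OF sets_PM refl] unfolding L_infinity_def PM_eq by auto
  obtain c0 where c0: "AE z in PM. \<bar>f z\<bar> \<le> c0" using f_bounded unfolding L_infinity_def by auto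
  \<comment> \<open>\<open>f\<close> is bounded only almost everywhere. The truncation is bounded
    everywhere, keeps the zeros and, by \<open>psi_AE_cong\<close>, changes \<open>f\<close> along
    orbits only on null sets.\<close>
  define f' where "f' z = max (- \<bar>c0\<bar>) (min \<bar>c0\<bar> (f z))" for z
  have fb: "bmeas SX f'"
    unfolding f'_def by (rule bmeasI[where c = "\<bar>c0\<bar>"]) (use fm in auto)
  have fs': "suppY f'" using fs by (simp add: suppY_def f'_def)
  have ae: "AE z in PM. f z = f' z" using c0 by eventually_elim (auto simp: f'_def)
  have m: "x \<in> borel_measurable PM" if "x \<in> borel_measurable SX" for x :: "_ \<Rightarrow> real"
    using that measurable_cong_sets[OF sets_PM refl] unfolding PM_eq by auto
  have int_f: "(LINT z|PM. f z) = (LINT z|PM. f' z)"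
    using ae fm bmeas_measurable[OF fb] by (intro integral_cong_AE m)
  have int_fh: "(LINT z|PM. f ((skew_map T ^^ n) z) * h z) = (LINT z|PM. psi f' n z * h z)" for n
  proof (rule integral_cong_AE)
    show "AE z in PM. f ((skew_map T ^^ n) z) * h z = psi f' n z * h z"
      using psi_AE_cong[OF fm bmeas_measurable[OF fb] ae[unfolded PM_eq], of n] unfolding PM_eq
      by eventually_elim (simp add: psi_def)
    show "(\<lambda>z. f ((skew_map T ^^ n) z) * h z) \<in> borel_measurable PM"
      using psi_measurable[OF fm, of n] bmeas_measurable[OF hb]
      by (intro borel_measurable_times m) (simp_all add: psi_def[abs_def])
    show "(\<lambda>z. psi f' n z * h z) \<in> borel_measurable PM"
      using psi_measurable[OF bmeas_measurable[OF fb], of n] bmeas_measurable[OF hb]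
      by (intro borel_measurable_times m)
  qed
  have "\<exists>c>0. eventually (\<lambda>n. c * (real n + 1) powr (1 - a) \<le>
    \<bar>(LINT z|PM. psi f' (Suc n) z * h z) - (LINT z|PM. f' z) * (LINT z|PM. h z)\<bar>) sequentially"
    unfolding PM_eq
  proof (rule correlation_lower_bound[OF fb fs' hb hs C _ b(1) a L])
    show "(\<integral>z. f' z \<partial>(bernoulli_measure N p \<Otimes>\<^sub>M \<mu>)) * (\<integral>z. h z \<partial>(bernoulli_measure N p \<Otimes>\<^sub>M \<mu>)) > 0"
      using integrals_pos unfolding int_f unfolding PM_eq .
    show "q > 2 \<and> 1 - a > - q \<or> q < 2 \<and> 1 - a > 2 - 2 * q" using qs(4) by (simp add: a_def)
  qed
  then obtain c where c: "c > 0" "eventually (\<lambda>n. c * (real n + 1) powr (1 - a) \<le>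
    \<bar>(LINT z|PM. psi f' (Suc n) z * h z) - (LINT z|PM. f' z) * (LINT z|PM. h z)\<bar>) sequentially"
    by blast
  \<comment> \<open>The index is \<open>Suc n\<close> because a point of \<open>(1/2, 3/4)\<close>,
    where \<open>h\<close> lives, needs one step to reach the left half; \<open>n + 1\<close> is
    then exactly the base of the power.\<close>
  have "eventually (\<lambda>n. c * real (Suc n) powr gamma2 B l p \<le> \<bar>correlation PM (skew_map T) (Suc n) f h\<bar>) sequentially"
    using c(2) by eventually_elim (simp add: correlation_def int_f int_fh a_def add.commute del: funpow.simps)
  then have "eventually (\<lambda>n. c * real n powr gamma2 B l p \<le> \<bar>correlation PM (skew_map T) n f h\<bar>) sequentially"
    by (rule eventually_sequentially_Suc[THEN iffD1])
  then show ?thesis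
    by (intro landau_omega.bigI[OF c(1)]) simp
qed

end
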